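(* Let $X$ be an $n$-dimensional compact complex manifold and $G\subset\mathrm{Aut}^0(X)$ a divisorial Lie group with Lie algebra $\mathfrak g$. Then there is a complete Ricci-flat hermitian metric on $X\setminus D_{\mathfrak g}$. If moreover $G$ is abelian, then there is a complete Ricci-flat Kähler $G$-invariant metric on $X\setminus D_{\mathfrak g}$.
   Context: All Lie groups are complex Lie groups; $\mathrm{Aut}^0(X)$ is the identity component of $\mathrm{Aut}(X)$. A Lie group $G\subset \mathrm{Aut}(X)$ is divisorial if $\dim G=\dim X$ and its action on $X$ has an open orbit. The Lie algebra $\mathfrak g$ is identified with a subspace of $H^0(X,T_X)$. $D_{\mathfrak g}\in|-K_X|$ is the divisor of zeros of the section $s^{(1)}\wedge\dots\wedge s^{(n)}$ of $-K_X$, where $s^{(1)},\dots,s^{(n)}$ is a basis of $\mathfrak g$. For a (not necessarily Kähler) hermitian metric $g$, Ricci-flat means $\mathrm{Ric}(g)=\frac{i}{2\pi}\partial\bar\partial\log\det g=0$. *)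

theory Defs
  imports "HOL-Analysis.Analysis" "HOL-Algebra.Bij"
begin

section \<open>Holomorphic and smooth maps between coordinate spaces\<close>

definition holo_on :: "(complex^'n::finite \<Rightarrow> complex^'m::finite) \<Rightarrow> (complex^'n) set \<Rightarrow> bool"
  where "holo_on f S \<longleftrightarrow>
    (\<forall>z\<in>S. \<exists>D. (f has_derivative D) (at z) \<and> (\<forall>a v. D (a *s v) = a *s D v))"

text \<open>Real differentiability of order \<open>k\<close>, meant for open \<open>S\<close> in finite dimension.\<close>

fun Ck_on :: "nat \<Rightarrow> ('v::real_normed_vector \<Rightarrow> 'w::real_normed_vector) \<Rightarrow> 'v set \<Rightarrow> bool"
  where
    "Ck_on 0 f S \<longleftrightarrow> continuous_on S f"
  | "Ck_on (Suc k) f S \<longleftrightarrow>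
       (\<forall>x\<in>S. f differentiable (at x)) \<and>
       (\<forall>v. Ck_on k (\<lambda>x. frechet_derivative f (at x) v) S)"

definition smooth_on :: "('v::real_normed_vector \<Rightarrow> 'w::real_normed_vector) \<Rightarrow> 'v set \<Rightarrow> bool"
  where "smooth_on f S \<longleftrightarrow> (\<forall>k. Ck_on k f S)"

text \<open>The Wirtinger derivatives \<open>\<partial>/\<partial>z\<^sub>i\<close> and \<open>\<partial>/\<partial>z\<^sub>i\<close>-bar.\<close>

definition wirtinger :: "'n \<Rightarrow> (complex^'n::finite \<Rightarrow> complex) \<Rightarrow> complex^'n \<Rightarrow> complex"
  where "wirtinger i f z =
    (frechet_derivative f (at z) (axis i 1) - \<i> * frechet_derivative f (at z) (axis i \<i>)) / 2"

definition wirtinger_bar :: "'n \<Rightarrow> (complex^'n::finite \<Rightarrow> complex) \<Rightarrow> complex^'n \<Rightarrow> complex"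
  where "wirtinger_bar i f z =
    (frechet_derivative f (at z) (axis i 1) + \<i> * frechet_derivative f (at z) (axis i \<i>)) / 2"


section \<open>Complex manifolds\<close>

text \<open>A chart is its domain together with its coordinate map. The atlas of a manifold is any
  holomorphic atlas, not necessarily the maximal one.\<close>

type_synonym ('a, 'n) chart = "'a set \<times> ('a \<Rightarrow> complex^'n)"

record ('a, 'n) mfd =
  mtop :: "'a topology"
  atlas :: "('a, 'n) chart set"

definition points :: "('a, 'n) mfd \<Rightarrow> 'a set"
  where "points M = topspace (mtop M)"

definition chart_inv :: "('a, 'n) chart \<Rightarrow> complex^'n \<Rightarrow> 'a"
  where "chart_inv c = inv_into (fst c) (snd c)"

definition complex_manifold :: "('a, 'n::finite) mfd \<Rightarrow> bool"
  where "complex_manifold M \<longleftrightarrow>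
    Hausdorff_space (mtop M) \<and> second_countable (mtop M) \<and>
    (\<Union>c\<in>atlas M. fst c) = points M \<and>
    (\<forall>c\<in>atlas M. openin (mtop M) (fst c) \<and> open (snd c ` fst c) \<and>
       homeomorphic_map (subtopology (mtop M) (fst c)) (top_of_set (snd c ` fst c)) (snd c)) \<and>
    (\<forall>c\<in>atlas M. \<forall>d\<in>atlas M. holo_on (snd d \<circ> chart_inv c) (snd c ` (fst c \<inter> fst d)))"

definition open_submfd :: "('a, 'n) mfd \<Rightarrow> 'a set \<Rightarrow> ('a, 'n) mfd"
  where "open_submfd M S =
    \<lparr>mtop = subtopology (mtop M) S, atlas = (\<lambda>c. (fst c \<inter> S, snd c)) ` atlas M\<rparr>"

definition prod_chart :: "('a, 'n::finite) chart \<Rightarrow> ('b, 'm::finite) chart \<Rightarrow> ('a \<times> 'b, 'n + 'm) chart"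
  where "prod_chart c d =
    (fst c \<times> fst d,
     \<lambda>(x, y). \<chi> k. case k of Inl i \<Rightarrow> snd c x $ i | Inr j \<Rightarrow> snd d y $ j)"

definition prod_mfd :: "('a, 'n::finite) mfd \<Rightarrow> ('b, 'm::finite) mfd \<Rightarrow> ('a \<times> 'b, 'n + 'm) mfd"
  where "prod_mfd M N =
    \<lparr>mtop = prod_topology (mtop M) (mtop N),
     atlas = {prod_chart c d |c d. c \<in> atlas M \<and> d \<in> atlas N}\<rparr>"

definition holo_map :: "('a, 'n::finite) mfd \<Rightarrow> ('b, 'm::finite) mfd \<Rightarrow> ('a \<Rightarrow> 'b) \<Rightarrow> bool"
  where "holo_map M N f \<longleftrightarrow>
    continuous_map (mtop M) (mtop N) f \<and>
    (\<forall>c\<in>atlas M. \<forall>d\<in>atlas N.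
       holo_on (snd d \<circ> f \<circ> chart_inv c) (snd c ` {p \<in> fst c. f p \<in> fst d}))"


section \<open>Holomorphic tangent vectors\<close>

text \<open>A tangent vector at \<open>p\<close> is the family of its coordinate vectors with respect to all charts
  around \<open>p\<close>; it is 0 by convention at all other indices, so that vectors are equal iff their
  coordinates are.\<close>

type_synonym ('a, 'n) tvec = "('a, 'n) chart \<Rightarrow> complex^'n"

definition tangent_space :: "('a, 'n::finite) mfd \<Rightarrow> 'a \<Rightarrow> ('a, 'n) tvec set"
  where "tangent_space M p = {v.
    (\<forall>c\<in>atlas M. \<forall>d\<in>atlas M. p \<in> fst c \<inter> fst d \<longrightarrow>
       v d = frechet_derivative (snd d \<circ> chart_inv c) (at (snd c p)) (v c)) \<and>
    (\<forall>c. c \<notin> atlas M \<or> p \<notin> fst c \<longrightarrow> v c = 0)}"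

text \<open>The tangent vector at the point with coordinates \<open>z\<close> in the chart \<open>c\<close> whose coordinate
  vector in \<open>c\<close> is \<open>w\<close>.\<close>

definition coord_tvec :: "('a, 'n::finite) mfd \<Rightarrow> ('a, 'n) chart \<Rightarrow> complex^'n \<Rightarrow> complex^'n \<Rightarrow> ('a, 'n) tvec"
  where "coord_tvec M c z w = (\<lambda>d.
    if d \<in> atlas M \<and> chart_inv c z \<in> fst d
    then frechet_derivative (snd d \<circ> chart_inv c) (at z) w else 0)"

text \<open>The differential at \<open>p\<close> of a map \<open>f\<close> from \<open>M\<close> to \<open>N\<close>. On \<^term>\<open>tangent_space M p\<close> it does
  not depend on the choice of the chart \<open>c\<close>.\<close>

definition differential ::
    "('a, 'n::finite) mfd \<Rightarrow> ('b, 'm::finite) mfd \<Rightarrow> ('a \<Rightarrow> 'b) \<Rightarrow> 'a \<Rightarrow> ('a, 'n) tvec \<Rightarrow> ('b, 'm) tvec"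
  where "differential M N f p v = (\<lambda>d.
    if d \<in> atlas N \<and> f p \<in> fst d
    then let c = (SOME c. c \<in> atlas M \<and> p \<in> fst c)
         in frechet_derivative (snd d \<circ> f \<circ> chart_inv c) (at (snd c p)) (v c)
    else 0)"


section \<open>Automorphisms and Lie groups acting on a manifold\<close>

text \<open>Self-maps of \<open>X\<close> are extensional functions on \<^term>\<open>points X\<close>, as in \<^const>\<open>BijGroup\<close>.\<close>

definition Aut :: "('a, 'n::finite) mfd \<Rightarrow> ('a \<Rightarrow> 'a) set"
  where "Aut X = {f \<in> Bij (points X).
    holo_map X X f \<and> holo_map X X (inv_into (points X) f)}"

text \<open>The compact-open topology on \<open>Aut X\<close>, which for compact \<open>X\<close> is the topology underlying its
  structure of complex Lie group.\<close>

definition Aut_topology :: "('a, 'n::finite) mfd \<Rightarrow> ('a \<Rightarrow> 'a) topology"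
  where "Aut_topology X = topology_generated_by
    {{f \<in> Aut X. f ` K \<subseteq> U} |K U. compactin (mtop X) K \<and> openin (mtop X) U}"

definition Aut0 :: "('a, 'n::finite) mfd \<Rightarrow> ('a \<Rightarrow> 'a) set"
  where "Aut0 X = connected_component_of_set (Aut_topology X) (\<lambda>x\<in>points X. x)"

definition complex_lie_group :: "('g, 'b) monoid_scheme \<Rightarrow> ('g, 'm::finite) mfd \<Rightarrow> bool"
  where "complex_lie_group H G \<longleftrightarrow>
    group H \<and> carrier H = points G \<and> complex_manifold G \<and>
    holo_map (prod_mfd G G) G (\<lambda>(f, h). f \<otimes>\<^bsub>H\<^esub> h) \<and>
    holo_map G G (\<lambda>f. inv\<^bsub>H\<^esub> f)"

text \<open>The group under composition formed by the points of \<open>G\<close>, a manifold of self-maps of \<open>X\<close>.\<close>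

abbreviation grp_of :: "('a, 'n) mfd \<Rightarrow> ('a \<Rightarrow> 'a, 'm) mfd \<Rightarrow> ('a \<Rightarrow> 'a) monoid"
  where "grp_of X G \<equiv> (BijGroup (points X))\<lparr>carrier := points G\<rparr>"

text \<open>A Lie group \<open>G \<subseteq> Aut\<^sup>0(X)\<close>. The inclusion is to be a morphism of complex Lie groups, which
  says that the action of \<open>G\<close> on \<open>X\<close> is holomorphic. The topology of \<open>G\<close> is its own Lie group
  topology: it may be finer than the one induced from \<open>Aut X\<close> (\<open>G\<close> need not be closed).\<close>

definition lie_subgroup_Aut0 :: "('a, 'n::finite) mfd \<Rightarrow> ('a \<Rightarrow> 'a, 'm::finite) mfd \<Rightarrow> bool"
  where "lie_subgroup_Aut0 X G \<longleftrightarrow>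
    points G \<subseteq> Aut0 X \<and> subgroup (points G) (BijGroup (points X)) \<and>
    complex_lie_group (grp_of X G) G \<and>
    holo_map (prod_mfd G X) X (\<lambda>(f, x). f x)"

definition divisorial :: "('a, 'n::finite) mfd \<Rightarrow> ('a \<Rightarrow> 'a, 'm::finite) mfd \<Rightarrow> bool"
  where "divisorial X G \<longleftrightarrow>
    CARD('m) = CARD('n) \<and>
    (\<exists>x\<in>points X. openin (mtop X) ((\<lambda>f. f x) ` points G))"

text \<open>The Lie algebra of \<open>G\<close> (the tangent space at the identity) as a space of vector fields on
  \<open>X\<close>: \<open>v\<close> corresponds to the field whose value at \<open>x\<close> is the image of \<open>v\<close> under the differential
  of the orbit map of \<open>x\<close>. Vector fields are 0 outside \<^term>\<open>points X\<close>.\<close>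

definition fundamental_field ::
    "('a, 'n::finite) mfd \<Rightarrow> ('a \<Rightarrow> 'a, 'm::finite) mfd \<Rightarrow> ('a \<Rightarrow> 'a, 'm) tvec \<Rightarrow> 'a \<Rightarrow> ('a, 'n) tvec"
  where "fundamental_field X G v x =
    (if x \<in> points X then differential G X (\<lambda>f. f x) (\<lambda>y\<in>points X. y) v else (\<lambda>_. 0))"

definition lie_algebra ::
    "('a, 'n::finite) mfd \<Rightarrow> ('a \<Rightarrow> 'a, 'm::finite) mfd \<Rightarrow> ('a \<Rightarrow> ('a, 'n) tvec) set"
  where "lie_algebra X G = fundamental_field X G ` tangent_space G (\<lambda>y\<in>points X. y)"

definition field_basis ::
    "('k::finite \<Rightarrow> 'a \<Rightarrow> ('a, 'n::finite) tvec) \<Rightarrow> ('a \<Rightarrow> ('a, 'n) tvec) set \<Rightarrow> bool"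
  where "field_basis s V \<longleftrightarrow>
    (\<forall>i. s i \<in> V) \<and>
    (\<forall>\<xi>\<in>V. \<exists>!a::'k \<Rightarrow> complex. \<forall>p c. \<xi> p c = (\<Sum>i\<in>UNIV. a i *s s i p c))"

text \<open>The section \<open>s\<^sup>1 \<and> \<dots> \<and> s\<^sup>n\<close> of the anticanonical bundle, in the trivialization
  \<open>\<partial>/\<partial>z\<^sub>1 \<and> \<dots> \<and> \<partial>/\<partial>z\<^sub>n\<close> given by the chart \<open>c\<close>. The numbering of the coordinates and of the fields
  by the same index type fixes the sign.\<close>

definition wedge_section :: "('n::finite \<Rightarrow> 'a \<Rightarrow> ('a, 'n) tvec) \<Rightarrow> 'a \<Rightarrow> ('a, 'n) chart \<Rightarrow> complex"
  where "wedge_section s p c = det (\<chi> i j. s j p c $ i)"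

text \<open>The support of the divisor of zeros of a section \<open>\<sigma>\<close> of a line bundle trivialized by each
  chart.\<close>

definition zero_divisor_support :: "('a, 'n::finite) mfd \<Rightarrow> ('a \<Rightarrow> ('a, 'n) chart \<Rightarrow> complex) \<Rightarrow> 'a set"
  where "zero_divisor_support X \<sigma> = {p. \<exists>c\<in>atlas X. p \<in> fst c \<and> \<sigma> p c = 0}"


section \<open>Hermitian metrics\<close>

type_synonym ('a, 'n) metric = "'a \<Rightarrow> ('a, 'n) tvec \<Rightarrow> ('a, 'n) tvec \<Rightarrow> complex"

text \<open>The matrix \<open>g(\<partial>/\<partial>z\<^sub>i, \<partial>/\<partial>z\<^sub>j)\<close> at the point with coordinates \<open>z\<close> in the chart \<open>c\<close>.\<close>

definition metric_matrix ::
    "('a, 'n::finite) mfd \<Rightarrow> ('a, 'n) metric \<Rightarrow> ('a, 'n) chart \<Rightarrow> complex^'n \<Rightarrow> complex^'n^'n"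
  where "metric_matrix M g c z =
    (\<chi> i j. g (chart_inv c z) (coord_tvec M c z (axis i 1)) (coord_tvec M c z (axis j 1)))"

definition hermitian_metric :: "('a, 'n::finite) mfd \<Rightarrow> ('a, 'n) metric \<Rightarrow> bool"
  where "hermitian_metric M g \<longleftrightarrow>
    (\<forall>p\<in>points M.
       (\<forall>u\<in>tangent_space M p. \<forall>v\<in>tangent_space M p. \<forall>w\<in>tangent_space M p. \<forall>a.
          g p (\<lambda>c. a *s u c + v c) w = a * g p u w + g p v w) \<and>
       (\<forall>u\<in>tangent_space M p. \<forall>v\<in>tangent_space M p. g p v u = cnj (g p u v)) \<and>
       (\<forall>u\<in>tangent_space M p. u \<noteq> (\<lambda>_. 0) \<longrightarrow> 0 < Re (g p u u))) \<and>
    (\<forall>c\<in>atlas M. \<forall>i j. smooth_on (\<lambda>z. metric_matrix M g c z $ i $ j) (snd c ` fst c))"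

text \<open>The coefficient of \<open>dz\<^sub>i \<and> dz\<^sub>j\<close>-bar in \<open>Ric(g) = (i/2\<pi>) \<partial>\<partial>\<close>-bar \<open>log det g\<close>.\<close>

definition ricci ::
    "('a, 'n::finite) mfd \<Rightarrow> ('a, 'n) metric \<Rightarrow> ('a, 'n) chart \<Rightarrow> complex^'n \<Rightarrow> 'n \<Rightarrow> 'n \<Rightarrow> complex"
  where "ricci M g c z i j =
    \<i> / (2 * complex_of_real pi) *
    wirtinger i (wirtinger_bar j (\<lambda>w. complex_of_real (ln (Re (det (metric_matrix M g c w)))))) z"

definition ricci_flat :: "('a, 'n::finite) mfd \<Rightarrow> ('a, 'n) metric \<Rightarrow> bool"
  where "ricci_flat M g \<longleftrightarrow>
    (\<forall>c\<in>atlas M. \<forall>z\<in>snd c ` fst c. \<forall>i j. ricci M g c z i j = 0)"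

text \<open>The fundamental form \<open>\<omega> = - Im g\<close>, a real 2-form, expressed in the chart \<open>c\<close>, and its
  exterior derivative evaluated on constant vector fields.\<close>

definition fundamental_form ::
    "('a, 'n::finite) mfd \<Rightarrow> ('a, 'n) metric \<Rightarrow> ('a, 'n) chart \<Rightarrow>
     complex^'n \<Rightarrow> complex^'n \<Rightarrow> complex^'n \<Rightarrow> real"
  where "fundamental_form M g c z u v =
    - Im (g (chart_inv c z) (coord_tvec M c z u) (coord_tvec M c z v))"

definition ext_deriv2 ::
    "('v::real_normed_vector \<Rightarrow> 'v \<Rightarrow> 'v \<Rightarrow> real) \<Rightarrow> 'v \<Rightarrow> 'v \<Rightarrow> 'v \<Rightarrow> 'v \<Rightarrow> real"
  where "ext_deriv2 \<omega> z u v w =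
    frechet_derivative (\<lambda>y. \<omega> y v w) (at z) u
    - frechet_derivative (\<lambda>y. \<omega> y u w) (at z) v
    + frechet_derivative (\<lambda>y. \<omega> y u v) (at z) w"

definition kaehler :: "('a, 'n::finite) mfd \<Rightarrow> ('a, 'n) metric \<Rightarrow> bool"
  where "kaehler M g \<longleftrightarrow>
    (\<forall>c\<in>atlas M. \<forall>z\<in>snd c ` fst c. \<forall>u v w. ext_deriv2 (fundamental_form M g c) z u v w = 0)"

definition invariant_metric :: "('a \<Rightarrow> 'a) set \<Rightarrow> ('a, 'n::finite) mfd \<Rightarrow> ('a, 'n) metric \<Rightarrow> bool"
  where "invariant_metric F M g \<longleftrightarrow>
    (\<forall>f\<in>F. f ` points M \<subseteq> points M \<and>
       (\<forall>p\<in>points M. \<forall>u\<in>tangent_space M p. \<forall>v\<in>tangent_space M p.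
          g (f p) (differential M M f p u) (differential M M f p v) = g p u v))"


section \<open>Completeness\<close>

definition pw_C1_path :: "('a, 'n::finite) mfd \<Rightarrow> (real \<Rightarrow> 'a) \<Rightarrow> bool"
  where "pw_C1_path M \<gamma> \<longleftrightarrow>
    pathin (mtop M) \<gamma> \<and>
    (\<forall>c\<in>atlas M. \<forall>a b. 0 \<le> a \<and> b \<le> 1 \<and> \<gamma> ` {a..b} \<subseteq> fst c \<longrightarrow>
       (snd c \<circ> \<gamma>) piecewise_C1_differentiable_on {a..b})"

definition velocity :: "('a, 'n::finite) mfd \<Rightarrow> (real \<Rightarrow> 'a) \<Rightarrow> real \<Rightarrow> ('a, 'n) tvec"
  where "velocity M \<gamma> t = (\<lambda>c.
    if c \<in> atlas M \<and> \<gamma> t \<in> fst c then vector_derivative (snd c \<circ> \<gamma>) (at t) else 0)"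

definition path_len :: "('a, 'n::finite) mfd \<Rightarrow> ('a, 'n) metric \<Rightarrow> (real \<Rightarrow> 'a) \<Rightarrow> ennreal"
  where "path_len M g \<gamma> =
    (\<integral>\<^sup>+t\<in>{0..1}. ennreal (sqrt (Re (g (\<gamma> t) (velocity M \<gamma> t) (velocity M \<gamma> t)))) \<partial>lborel)"

text \<open>The distance is \<open>\<infinity>\<close> between different connected components.\<close>

definition metric_dist :: "('a, 'n::finite) mfd \<Rightarrow> ('a, 'n) metric \<Rightarrow> 'a \<Rightarrow> 'a \<Rightarrow> ennreal"
  where "metric_dist M g p q =
    (INF \<gamma> \<in> {\<gamma>. pw_C1_path M \<gamma> \<and> \<gamma> 0 = p \<and> \<gamma> 1 = q}. path_len M g \<gamma>)"

definition complete_metric :: "('a, 'n::finite) mfd \<Rightarrow> ('a, 'n) metric \<Rightarrow> bool"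
  where "complete_metric M g \<longleftrightarrow>
    (\<forall>x::nat \<Rightarrow> 'a. range x \<subseteq> points M \<and>
       (\<forall>e>0. \<exists>N. \<forall>k\<ge>N. \<forall>l\<ge>N. metric_dist M g (x k) (x l) < e) \<longrightarrow>
       (\<exists>p\<in>points M. (\<lambda>k. metric_dist M g (x k) p) \<longlonglongrightarrow> 0))"

end

theory Submission
  imports Defs "HOL-Complex_Analysis.Cauchy_Integral_Formula"
begin

text \<open>The fields \<open>s\<^sub>i\<close> form a holomorphic frame of the tangent bundle outside the divisor \<open>D\<close>; let \<open>g\<close> be the
  hermitian metric for which this frame is unitary. If \<open>S\<close> is the matrix of the frame in a chart, then
  \<open>det g = |det S|\<^sup>-\<^sup>2\<close>, whose logarithm is pluriharmonic, so \<open>g\<close> is Ricci-flat.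

  Completeness needs no flows. Translations multiply \<open>det S\<close> by holomorphic factors without zeros, hence
  \<open>d(det S)(s\<^sub>i) / det S\<close> is bounded on compact subsets of \<open>X\<close>, even near \<open>D\<close>. Along a path of length \<open>\<epsilon>\<close>
  the logarithm of \<open>|det S|\<close> therefore changes by at most a multiple of \<open>\<epsilon>\<close>, and a Cauchy sequence, which has
  a cluster point in the compact space \<open>X\<close>, stays away from \<open>D\<close>.

  If \<open>G\<close> is abelian, then its elements preserve the fields \<open>s\<^sub>i\<close>, hence also \<open>g\<close>. The fields commute, the dual
  coframe is closed, and so is the fundamental form of \<open>g\<close>.\<close>

section \<open>Holomorphic functions of several variables\<close>

text \<open>Why the factor is holomorphic even across D: for h in G near 1, the differential at h of
  the orbit map of x is compared with the frame in two ways, through left translation with the frame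
  at x pushed forward by h, and through right translation with the frame at h x. Taking determinants
  and eliminating the orbit map gives det S(h x) = H(h, x) det S(x), where H consists of the
  Jacobian of h and of translations of G only and does not see where the frame degenerates.
  Differentiated at h = 1, the identity exhibits det S as a factor of its own derivatives along the
  frame.

  In the abelian case the group variable again replaces flows. The invariance of a field under h,
  differentiated at h = 1 along a second field, is a mixed second derivative of the action, and the
  symmetry of second derivatives is the vanishing of the bracket. The regularity this needs is drawn
  from Cauchy's formula on complex lines.\<close>

abbreviation dd :: "('v::real_normed_vector \<Rightarrow> 'w::real_normed_vector) \<Rightarrow> 'v \<Rightarrow> 'v \<Rightarrow> 'w"
  where "dd f z \<equiv> frechet_derivative f (at z)"

lemma dd_eq: "(f has_derivative D) (at z) \<Longrightarrow> dd f z = D"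
  using frechet_derivative_at by metis

lemma differentiable_dd: "f differentiable (at z) \<Longrightarrow> (f has_derivative dd f z) (at z)"
  using frechet_derivative_works by blast

lemma differentiable_transform:
  assumes "f differentiable (at z)" "open S" "z \<in> S" "\<And>x. x \<in> S \<Longrightarrow> f x = g x"
  shows "g differentiable (at z)" "dd g z = dd f z"
proof -
  have "(g has_derivative dd f z) (at z)"
    using has_derivative_transform_within_open[OF differentiable_dd[OF assms(1)] assms(2,3)] assms(4)
    by blast
  then show "g differentiable (at z)" "dd g z = dd f z"
    by (auto simp: dd_eq differentiable_def)
qed

text \<open>\<open>frechet_derivative\<close> is a choice from the set of all derivatives, and
  locally equal functions share this set; the equation thus holds even where no derivative
  exists.\<close>

lemma dd_cong:
  assumes "open S" "z \<in> S" "\<And>x. x \<in> S \<Longrightarrow> f x = g x"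
  shows "dd f z = dd g z"
proof -
  have "(f has_derivative D) (at z) \<longleftrightarrow> (g has_derivative D) (at z)" for D
    using has_derivative_transform_within_open[OF _ assms(1,2)] assms(3) by metis
  then show ?thesis by (simp add: frechet_derivative_def)
qed

text \<open>Reduces complex scalars to real ones and multiplication by \<open>\<i>\<close>, as
  derivatives are a priori only real linear.\<close>

lemma vscale_decomp: "a *s v = Re a *\<^sub>R v + Im a *\<^sub>R (\<i> *s (v::complex^'n))"
  by (simp add: vec_eq_iff complex_eq_iff)

lemma bounded_linear_vscale_left: "bounded_linear (\<lambda>a. a *s (v::complex^'n::finite))"
proof -
  have "linear (\<lambda>a. a *s (v::complex^'n))"
    by (auto intro!: linearI simp: vec_eq_iff algebra_simps)
  then show ?thesis by (simp add: linear_conv_bounded_linear)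
qed

lemma vec_eq_sum_axis: "(x::'a::comm_ring_1^'n::finite) = (\<Sum>i\<in>UNIV. x $ i *s axis i 1)"
  by (simp add: vec_eq_iff axis_def if_distrib cong: if_cong)

lemma has_derivative_vec:
  fixes f :: "'v::real_normed_vector \<Rightarrow> complex^'n::finite"
  assumes "\<And>i. ((\<lambda>x. f x $ i) has_derivative (\<lambda>h. D h $ i)) F"
  shows "(f has_derivative D) F"
proof -
  have "((\<lambda>x. \<Sum>i\<in>UNIV. f x $ i *s axis i 1) has_derivative (\<lambda>h. \<Sum>i\<in>UNIV. D h $ i *s axis i 1)) F"
    by (intro has_derivative_sum bounded_linear.has_derivative[OF bounded_linear_vscale_left] assms)
  then show ?thesis unfolding vec_eq_sum_axis[symmetric] .
qed

lemma has_derivative_vec_iff: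
  fixes f :: "'v::real_normed_vector \<Rightarrow> complex^'n::finite"
  shows "(f has_derivative D) F \<longleftrightarrow> (\<forall>i. ((\<lambda>x. f x $ i) has_derivative (\<lambda>h. D h $ i)) F)"
  using has_derivative_vec bounded_linear.has_derivative[OF bounded_linear_vec_nth] by blast

lemma dd_vec_nth:
  fixes f :: "'v::real_normed_vector \<Rightarrow> complex^'n::finite"
  assumes "f differentiable (at z)"
  shows "dd (\<lambda>x. f x $ i) z v = dd f z v $ i"
  using differentiable_dd[OF assms] has_derivative_vec_iff dd_eq by metis

text \<open>Commutation with \<open>\<i>\<close> suffices because a derivative is real linear;
  \<open>hol_dd_scale\<close> recovers all complex scalars. Scalar values make products and
  quotients available.\<close>

definition hol :: "(complex^'n::finite \<Rightarrow> complex) \<Rightarrow> (complex^'n) set \<Rightarrow> bool"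
  where "hol f S \<longleftrightarrow> (\<forall>z\<in>S. \<exists>D. (f has_derivative D) (at z) \<and> (\<forall>v. D (\<i> *s v) = \<i> * D v))"

lemma hol_differentiable: "hol f S \<Longrightarrow> z \<in> S \<Longrightarrow> f differentiable (at z)"
  unfolding hol_def differentiable_def by blast

lemma hol_has_derivative: "hol f S \<Longrightarrow> z \<in> S \<Longrightarrow> (f has_derivative dd f z) (at z)"
  by (simp add: differentiable_dd hol_differentiable)

lemma complex_linearI:
  assumes "bounded_linear D" "\<And>v::complex^'n::finite. D (\<i> *s v) = \<i> * D v"
  shows "D (a *s v) = a * (D v :: complex)"
proof -
  interpret bounded_linear D by fact
  have "D (a *s v) = Re a *\<^sub>R D v + Im a *\<^sub>R (\<i> * D v)"
    by (subst vscale_decomp) (simp add: add scaleR assms)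
  also have "\<dots> = a * D v" by (simp add: complex_eq_iff)
  finally show ?thesis .
qed

lemma hol_dd_scale:
  assumes "hol f S" "z \<in> S"
  shows "dd f z (a *s v) = a * dd f z v"
proof -
  obtain D where D: "(f has_derivative D) (at z)" "\<And>v. D (\<i> *s v) = \<i> * D v"
    using assms unfolding hol_def by blast
  then show ?thesis
    using complex_linearI[OF has_derivative_bounded_linear[OF D(1)] D(2)] by (simp add: dd_eq[OF D(1)])
qed

lemma holI:
  assumes "\<And>z. z \<in> S \<Longrightarrow> (f has_derivative D z) (at z)" "\<And>z v. z \<in> S \<Longrightarrow> D z (\<i> *s v) = \<i> * D z v"
  shows "hol f S"
  using assms unfolding hol_def by blast

lemma hol_subset: "hol f S \<Longrightarrow> T \<subseteq> S \<Longrightarrow> hol f T"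
  unfolding hol_def by blast

lemma hol_cong:
  assumes "open S" "\<And>x. x \<in> S \<Longrightarrow> f x = g x" "hol f S"
  shows "hol g S"
proof (rule holI)
  fix z assume z: "z \<in> S"
  show "(g has_derivative dd f z) (at z)"
    using has_derivative_transform_within_open[OF hol_has_derivative[OF assms(3) z] assms(1) z] assms(2)
    by blast
  show "dd f z (\<i> *s v) = \<i> * dd f z v" for v using hol_dd_scale assms(3) z by blast
qed

lemma hol_continuous_on: "hol f S \<Longrightarrow> continuous_on S f"
  by (meson continuous_at_imp_continuous_on differentiable_imp_continuous_within hol_differentiable)

section \<open>Sums, products, quotients and composites of holomorphic functions\<close>

lemma hol_const: "hol (\<lambda>z. c) S"
  by (rule holI[where D="\<lambda>z v. 0"]) auto

lemma hol_add: "hol f S \<Longrightarrow> hol g S \<Longrightarrow> hol (\<lambda>z. f z + g z) S"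
  by (rule holI[where D="\<lambda>z v. dd f z v + dd g z v"])
    (auto intro!: derivative_intros hol_has_derivative simp: hol_dd_scale algebra_simps)

lemma hol_mult: "hol f S \<Longrightarrow> hol g S \<Longrightarrow> hol (\<lambda>z. f z * g z) S"
proof (rule holI[where D="\<lambda>z v. f z * dd g z v + dd f z v * g z"])
  fix z v assume "hol f S" "hol g S" and z: "z \<in> S"
  then show "((\<lambda>z. f z * g z) has_derivative (\<lambda>v. f z * dd g z v + dd f z v * g z)) (at z)"
    by (intro has_derivative_mult hol_has_derivative)
  show "f z * dd g z (\<i> *s v) + dd f z (\<i> *s v) * g z = \<i> * (f z * dd g z v + dd f z v * g z)"
    using hol_dd_scale[OF \<open>hol f S\<close> z] hol_dd_scale[OF \<open>hol g S\<close> z] by (simp add: algebra_simps)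
qed

lemma hol_inverse:
  assumes "hol f S" "\<And>z. z \<in> S \<Longrightarrow> f z \<noteq> 0"
  shows "hol (\<lambda>z. inverse (f z)) S"
proof (rule holI[where D="\<lambda>z v. - (inverse (f z) * dd f z v * inverse (f z))"])
  fix z v assume z: "z \<in> S"
  show "((\<lambda>z. inverse (f z)) has_derivative (\<lambda>v. - (inverse (f z) * dd f z v * inverse (f z)))) (at z)"
    using assms z by (intro Deriv.has_derivative_inverse hol_has_derivative)
  show "- (inverse (f z) * dd f z (\<i> *s v) * inverse (f z)) = \<i> * - (inverse (f z) * dd f z v * inverse (f z))"
    by (simp add: hol_dd_scale[OF assms(1) z])
qed

lemma hol_divide:
  assumes "hol f S" "hol g S" "\<And>z. z \<in> S \<Longrightarrow> g z \<noteq> 0"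
  shows "hol (\<lambda>z. f z / g z) S"
  unfolding divide_inverse using assms by (intro hol_mult hol_inverse)

lemma hol_sum: "(\<And>i. i \<in> I \<Longrightarrow> hol (f i) S) \<Longrightarrow> hol (\<lambda>z. \<Sum>i\<in>I. f i z) S"
  by (induction I rule: infinite_finite_induct) (auto intro: hol_const hol_add)

lemma hol_prod: "(\<And>i. i \<in> I \<Longrightarrow> hol (f i) S) \<Longrightarrow> hol (\<lambda>z. \<Prod>i\<in>I. f i z) S"
  by (induction I rule: infinite_finite_induct) (auto intro: hol_const hol_mult)

lemma hol_det:
  assumes "\<And>i j. hol (\<lambda>z. A z $ i $ j) S"
  shows "hol (\<lambda>z. det (A z)) S"
  unfolding det_def by (intro hol_sum hol_mult hol_const hol_prod assms)

lemma hol_compose: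
  assumes f: "hol f T" and g: "\<And>z. z \<in> S \<Longrightarrow> \<exists>D. (g has_derivative D) (at z) \<and> (\<forall>v. D (\<i> *s v) = \<i> *s D v)"
    and sub: "\<And>z. z \<in> S \<Longrightarrow> g z \<in> T"
  shows "hol (\<lambda>z. f (g z)) S"
  unfolding hol_def
proof
  fix z assume z: "z \<in> S"
  obtain D where D: "(g has_derivative D) (at z)" "\<And>v. D (\<i> *s v) = \<i> *s D v"
    using g[OF z] by metis
  have "((\<lambda>z. f (g z)) has_derivative (\<lambda>v. dd f (g z) (D v))) (at z)"
    by (rule has_derivative_compose[OF D(1) hol_has_derivative[OF f sub[OF z]]])
  moreover have "dd f (g z) (D (\<i> *s v)) = \<i> * dd f (g z) (D v)" for v
    unfolding D(2) by (rule hol_dd_scale[OF f sub[OF z]])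
  ultimately show "\<exists>D. ((\<lambda>z. f (g z)) has_derivative D) (at z) \<and> (\<forall>v. D (\<i> *s v) = \<i> * D v)"
    by (intro exI[of _ "\<lambda>v. dd f (g z) (D v)"] conjI allI)
qed

lemma holo_on_iff_hol: "holo_on f S \<longleftrightarrow> (\<forall>i. hol (\<lambda>z. f z $ i) S)"
proof
  assume f: "holo_on f S"
  show "\<forall>i. hol (\<lambda>z. f z $ i) S"
  proof
    fix i
    have "\<exists>D'. ((\<lambda>z. f z $ i) has_derivative D') (at z) \<and> (\<forall>v. D' (\<i> *s v) = \<i> * D' v)" if zS: "z \<in> S" for z
    proof -
      obtain D where D: "(f has_derivative D) (at z)" "\<forall>a v. D (a *s v) = a *s D v"
        using f[unfolded holo_on_def, rule_format, OF zS] by blast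
      have "((\<lambda>z. f z $ i) has_derivative (\<lambda>h. D h $ i)) (at z)"
        using D(1) unfolding has_derivative_vec_iff by (rule spec)
      moreover have "\<forall>v. D (\<i> *s v) $ i = \<i> * D v $ i"
        using D(2) by simp
      ultimately
      show ?thesis by (intro exI[of _ "\<lambda>h. D h $ i"] conjI)
    qed
    then show "hol (\<lambda>z. f z $ i) S" unfolding hol_def by simp
  qed
next
  assume f: "\<forall>i. hol (\<lambda>z. f z $ i) S"
  show "holo_on f S"
    unfolding holo_on_def
  proof
    fix z assume z: "z \<in> S"
    let ?D = "\<lambda>v. \<chi> i. dd (\<lambda>z. f z $ i) z v"
    have "(f has_derivative ?D) (at z)"
    proof (rule has_derivative_vec)
      fix i
      have "hol (\<lambda>z. f z $ i) S" using f by blast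
      from hol_has_derivative[OF this z]
      show "((\<lambda>z. f z $ i) has_derivative (\<lambda>h. ?D h $ i)) (at z)" by simp
    qed
    moreover have "?D (a *s v) = a *s ?D v" for a v
    proof -
      have "dd (\<lambda>z. f z $ i) z (a *s v) = a * dd (\<lambda>z. f z $ i) z v" for i
        by (rule hol_dd_scale[OF _ z]) (use f in blast)
      then show ?thesis by (simp add: vec_eq_iff)
    qed
    ultimately show "\<exists>D. (f has_derivative D) (at z) \<and> (\<forall>a v. D (a *s v) = a *s D v)"
      by (intro exI[of _ ?D] conjI allI)
  qed
qed

lemma holo_on_differentiable: "holo_on f S \<Longrightarrow> z \<in> S \<Longrightarrow> f differentiable (at z)"
  unfolding holo_on_def differentiable_def by blast

lemma holo_on_has_derivative: "holo_on f S \<Longrightarrow> z \<in> S \<Longrightarrow> (f has_derivative dd f z) (at z)"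
  by (simp add: differentiable_dd holo_on_differentiable)

lemma holo_on_dd_scale: "holo_on f S \<Longrightarrow> z \<in> S \<Longrightarrow> dd f z (a *s v) = a *s dd f z v"
proof -
  assume "holo_on f S" "z \<in> S"
  then obtain D where "(f has_derivative D) (at z)" "\<And>a v. D (a *s v) = a *s D v"
    unfolding holo_on_def by blast
  then show ?thesis by (simp add: dd_eq)
qed

section \<open>Cauchy's formula, and the continuity, holomorphy and symmetry of derivatives\<close>

lemma Cauchy_directional:
  assumes f: "hol f S" and disc: "\<And>\<zeta>. norm \<zeta> \<le> 1 \<Longrightarrow> z + \<zeta> *s v \<in> S"
  shows "((\<lambda>t. f (z + exp (2 * of_real pi * \<i> * of_real t) *s v) * exp (- (2 * of_real pi * \<i> * of_real t)))
           has_integral dd f z v) {0..1}"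
proof -
  \<comment> \<open>\<open>f\<close> is restricted to the complex line through \<open>z\<close> in
    direction \<open>v\<close>, where the one-variable formula for the first derivative applies. The
    result expresses \<open>dd f z v\<close> by values of \<open>f\<close> alone, which is how
    derivatives inherit the regularity of \<open>f\<close>.\<close>
  let ?g = "\<lambda>\<zeta>. f (z + \<zeta> *s v)"
  have der: "(?g has_field_derivative dd f (z + \<zeta> *s v) v) (at \<zeta>)" if "norm \<zeta> \<le> 1" for \<zeta>
  proof -
    have "((\<lambda>\<zeta>. z + \<zeta> *s v) has_derivative (\<lambda>h. h *s v)) (at \<zeta>)"
      by (auto intro!: derivative_eq_intros bounded_linear.has_derivative[OF bounded_linear_vscale_left])
    from has_derivative_compose[OF this hol_has_derivative[OF f disc[OF that]]]
    show ?thesis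
      unfolding has_field_derivative_def hol_dd_scale[OF f disc[OF that]] mult_commute_abs .
  qed
  have hol: "?g holomorphic_on cball 0 1"
    unfolding holomorphic_on_def field_differentiable_def
  proof
    fix \<zeta> :: complex assume "\<zeta> \<in> cball 0 1"
    then have "norm \<zeta> \<le> 1" by simp
    from has_field_derivative_at_within[OF der[OF this]]
    have "(?g has_field_derivative dd f (z + \<zeta> *s v) v) (at \<zeta> within cball 0 1)" .
    then show "\<exists>f'. (?g has_field_derivative f') (at \<zeta> within cball 0 1)" by blast
  qed
  have "((\<lambda>u. ?g u / (u - 0) ^ (Suc 1)) has_contour_integral ((2 * pi * \<i>) / (fact 1) * (deriv ^^ 1) ?g 0))
          (circlepath 0 1)"
    by (rule Cauchy_has_contour_integral_higher_derivative_circlepath)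
       (rule holomorphic_on_imp_continuous_on[OF hol], rule holomorphic_on_subset[OF hol ball_subset_cball], simp)
  moreover have "deriv ?g 0 = dd f z v"
    using DERIV_imp_deriv[OF der[of 0]] by simp
  ultimately have "((\<lambda>u. ?g u / u ^ 2) has_contour_integral (2 * pi * \<i> * dd f z v)) (circlepath 0 1)"
    by (simp add: numeral_2_eq_2)
  then have "((\<lambda>t. ?g (exp (2 * of_real pi * \<i> * of_real t)) / (exp (2 * of_real pi * \<i> * of_real t))^2
       * (2 * of_real pi * \<i> * exp (2 * of_real pi * \<i> * of_real t))) has_integral (2 * pi * \<i> * dd f z v)) {0..1}"
    unfolding has_contour_integral_def
  proof (rule has_integral_eq[rotated])
    fix t :: real assume "t \<in> {0..1}"
    then have "vector_derivative (circlepath 0 1) (at t within {0..1}) = 2 * of_real pi * \<i> * exp (2 * of_real pi * \<i> * of_real t)"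
      using vector_derivative_circlepath01[of t 0 1] by simp
    moreover have "circlepath 0 1 t = exp (2 * of_real pi * \<i> * of_real t)"
      unfolding circlepath by simp
    ultimately show "?g (circlepath 0 1 t) / (circlepath 0 1 t)^2 * vector_derivative (circlepath 0 1) (at t within {0..1}) =
       ?g (exp (2 * of_real pi * \<i> * of_real t)) / (exp (2 * of_real pi * \<i> * of_real t))^2
       * (2 * of_real pi * \<i> * exp (2 * of_real pi * \<i> * of_real t))" by (simp only:)
  qed
  then have "((\<lambda>t. (1 / (2 * of_real pi * \<i>)) * (?g (exp (2 * of_real pi * \<i> * of_real t)) / (exp (2 * of_real pi * \<i> * of_real t))^2
       * (2 * of_real pi * \<i> * exp (2 * of_real pi * \<i> * of_real t)))) has_integral (1 / (2 * of_real pi * \<i>)) * (2 * pi * \<i> * dd f z v)) {0..1}"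
    by (rule has_integral_mult_right)
  moreover have "(1 / (2 * of_real pi * \<i>)) * (2 * pi * \<i> * dd f z v) = dd f z v" by simp
  \<comment> \<open>On the unit circle the velocity 2 pi i exp(x) cancels one factor of the squared
    denominator, and the prefactor cancels 2 pi i; exp(-x) remains.\<close>
  moreover have eq: "(1 / (2 * of_real pi * \<i>)) * (a / (exp x)^2 * (2 * of_real pi * \<i> * exp x)) = a * exp (- x)" for a x
  proof -
    have *: "(1 / c) * (a / e^2 * (c * e)) = a / e" if "c \<noteq> 0" "e \<noteq> 0" for c e :: complex
      using that by (simp add: power2_eq_square)
    show ?thesis unfolding exp_minus divide_inverse[symmetric] by (rule *) simp_all
  qed
  ultimately show ?thesis unfolding eq by simp
qed

text \<open>Cauchy's formula needs unit discs in direction \<open>v\<close> inside \<open>S\<close>.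
  Shrinking \<open>v\<close> by one \<rho> for all \<open>z\<close> near \<open>z0\<close> provides
  them, and the real linearity of the derivative undoes the shrinking.\<close>

lemma disc_subset_of_open:
  fixes S :: "(complex^'n::finite) set"
  assumes "open S" "z0 \<in> S"
  obtains r \<rho> :: real where "r > 0" "\<rho> > 0" "\<And>z \<zeta>. z \<in> cball z0 r \<Longrightarrow> norm \<zeta> \<le> 1 \<Longrightarrow> z + \<zeta> *s (\<rho> *\<^sub>R v) \<in> S"
proof -
  obtain R where R: "R > 0" "cball z0 R \<subseteq> S" using assms open_contains_cball by blast
  \<comment> \<open>The summand 1 keeps the denominator positive when \<open>v\<close> is 0; half of
    the radius is left to the motion of \<open>z\<close>.\<close>
  define \<rho> where "\<rho> = (R/2) / (1 + onorm (\<lambda>a. a *s v))"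
  have pos: "0 \<le> onorm (\<lambda>a. a *s v)" by (rule onorm_pos_le[OF bounded_linear_vscale_left])
  have \<rho>: "\<rho> > 0" using R pos by (simp add: \<rho>_def add_nonneg_pos)
  have "z + \<zeta> *s (\<rho> *\<^sub>R v) \<in> S" if z: "z \<in> cball z0 (R/2)" and \<zeta>: "norm \<zeta> \<le> 1" for z \<zeta>
  proof -
    have "\<zeta> *s (\<rho> *\<^sub>R v) = \<rho> *\<^sub>R (\<zeta> *s v)" by (simp add: vec_eq_iff)
    then have "norm (\<zeta> *s (\<rho> *\<^sub>R v)) = \<rho> * norm (\<zeta> *s v)"
      using \<rho> by simp
    also have "\<dots> \<le> \<rho> * (onorm (\<lambda>a. a *s v) * norm \<zeta>)"
      using \<rho> onorm[OF bounded_linear_vscale_left, of \<zeta> v] by simp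
    also have "\<dots> \<le> \<rho> * (1 + onorm (\<lambda>a. a *s v))"
      using \<rho> pos \<zeta> by (intro mult_left_mono) (auto intro: order_trans[OF mult_left_mono[OF \<zeta> pos]])
    also have "\<dots> = R/2" using pos unfolding \<rho>_def by (simp add: field_split_simps)
    finally have "norm (\<zeta> *s (\<rho> *\<^sub>R v)) \<le> R/2" .
    then have "dist z0 (z + \<zeta> *s (\<rho> *\<^sub>R v)) \<le> R"
      using z by (simp add: dist_norm) norm
    then show ?thesis using R by auto
  qed
  with R \<rho> show thesis by (intro that[of "R/2" \<rho>]) auto
qed

lemma has_derivative_dd_scaleR:
  assumes "f differentiable (at z)"
  shows "dd f z (r *\<^sub>R v) = r *\<^sub>R dd f z v"
  using assms by (simp add: linear_cmul linear_frechet_derivative)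

text \<open>A parameter integral of a jointly continuous function is continuous in the
  parameter.\<close>

lemma hol_dd_continuous_on:
  assumes f: "hol f S" and S: "open S"
  shows "continuous_on S (\<lambda>z. dd f z v)"
proof -
  have "continuous (at z0) (\<lambda>z. dd f z v)" if z0: "z0 \<in> S" for z0
  proof -
    obtain r \<rho> where r: "r > 0" "\<rho> > 0"
      and disc: "\<And>z \<zeta>. z \<in> cball z0 r \<Longrightarrow> norm \<zeta> \<le> 1 \<Longrightarrow> z + \<zeta> *s (\<rho> *\<^sub>R v) \<in> S"
      using disc_subset_of_open[OF S z0] by metis
    let ?F = "\<lambda>z t::real. f (z + exp (2 * of_real pi * \<i> * of_real t) *s (\<rho> *\<^sub>R v)) * exp (- (2 * of_real pi * \<i> * of_real t))"
    have eq: "integral {0..1} (?F z) = \<rho> *\<^sub>R dd f z v" if "z \<in> cball z0 r" for z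
    proof -
      have "z \<in> S" using disc[OF that, of 0] by simp
      then show ?thesis
        using integral_unique[OF Cauchy_directional[OF f disc[OF that]]]
          has_derivative_dd_scaleR[OF hol_differentiable[OF f]] by simp
    qed
    have "continuous_on (cball z0 r) (\<lambda>z. integral {0..1} (?F z))"
      unfolding cbox_interval[symmetric]
      apply (rule integral_continuous_on_param)
      unfolding split_beta
      apply (intro continuous_intros continuous_on_compose2[OF hol_continuous_on[OF f]]
          bounded_linear.continuous_on[OF bounded_linear_vscale_left])
      apply (auto intro!: disc)
      done
    then have "continuous_on (ball z0 r) (\<lambda>z. (1/\<rho>) *\<^sub>R integral {0..1} (?F z))"
      by (intro continuous_intros) (auto elim: continuous_on_subset)
    then have "continuous_on (ball z0 r) (\<lambda>z. dd f z v)"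
      by (rule continuous_on_eq) (use r eq in \<open>simp del: mult_cancel_right\<close>)
    then show ?thesis using r by (simp add: continuous_on_eq_continuous_at)
  qed
  then show ?thesis by (simp add: continuous_at_imp_continuous_on)
qed

text \<open>Differentiation under the integral in Cauchy's formula. The derivative is kept as an
  integral because this form shows both its complex linearity in \<open>u\<close> and the symmetry
  of second derivatives.\<close>

lemma hol_dd_has_derivative_integral:
  assumes f: "hol f S" and S: "open S" and z0: "z0 \<in> S" and r: "r > 0" "\<rho> > 0"
    and disc: "\<And>z \<zeta>. z \<in> cball z0 r \<Longrightarrow> norm \<zeta> \<le> 1 \<Longrightarrow> z + \<zeta> *s (\<rho> *\<^sub>R v) \<in> S"
  shows "((\<lambda>z. dd f z v) has_derivative
    (\<lambda>u. (1/\<rho>) *\<^sub>R integral {0..1} (\<lambda>t. dd f (z0 + exp (2 * of_real pi * \<i> * of_real t) *s (\<rho> *\<^sub>R v)) u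
        * exp (- (2 * of_real pi * \<i> * of_real t))))) (at z0)"
proof -
  define e where "e = (\<lambda>t. exp (2 * of_real pi * \<i> * complex_of_real t))"
  define w where "w = (\<lambda>t. exp (- (2 * of_real pi * \<i> * complex_of_real t)))"
  have e1: "norm (e t) \<le> 1" for t by (simp add: e_def)
  have ec: "continuous_on UNIV e" unfolding e_def by (intro continuous_intros)
  have wc: "continuous_on UNIV w" unfolding w_def by (intro continuous_intros)
  note ce = continuous_on_compose2[OF ec] continuous_on_compose2[OF wc]
  define U where "U = ball z0 r"
  have U: "convex U" "open U" "z0 \<in> U" using r by (auto simp: U_def)
  have inS: "z + e t *s (\<rho> *\<^sub>R v) \<in> S" if "z \<in> U" for z t
    using disc[OF _ e1] that by (simp add: U_def)
  \<comment> \<open>The Leibniz rule wants the derivatives as bounded linear operators depending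
    continuously on \<open>(z, t)\<close>; in finite dimension this is continuity in each fixed
    direction.\<close>
  define fx where "fx = (\<lambda>z t. Blinfun (\<lambda>u. dd f (z + e t *s (\<rho> *\<^sub>R v)) u * w t))"
  have fx: "blinfun_apply (fx z t) = (\<lambda>u. dd f (z + e t *s (\<rho> *\<^sub>R v)) u * w t)" if "z \<in> U" for z t
    unfolding fx_def
    by (rule bounded_linear_Blinfun_apply)
      (intro bounded_linear_mult_const has_derivative_bounded_linear[OF hol_has_derivative[OF f inS[OF that]]])
  have cont_arg: "continuous_on (U \<times> cbox 0 1) (\<lambda>x. fst x + e (snd x) *s (\<rho> *\<^sub>R v))"
    by (intro continuous_intros ce subset_UNIV bounded_linear.continuous_on[OF bounded_linear_vscale_left])
  have contw: "continuous_on (cbox 0 1) (\<lambda>t. dd f (z + e t *s (\<rho> *\<^sub>R v)) u * w t)" if "z \<in> U" for z u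
    by (intro continuous_intros ce subset_UNIV continuous_on_compose2[OF hol_dd_continuous_on[OF f S]]
        bounded_linear.continuous_on[OF bounded_linear_vscale_left]) (use inS that in auto)
  have cont: "continuous_on (U \<times> cbox 0 1) (\<lambda>(z, t). fx z t)"
  proof (rule continuous_on_blinfun_componentwise)
    fix i :: "complex^'a"
    have "continuous_on (U \<times> cbox 0 1) (\<lambda>x. dd f (fst x + e (snd x) *s (\<rho> *\<^sub>R v)) i * w (snd x))"
      by (intro continuous_intros ce subset_UNIV continuous_on_compose2[OF hol_dd_continuous_on[OF f S] cont_arg]) (use inS in auto)
    then show "continuous_on (U \<times> cbox 0 1) (\<lambda>x. blinfun_apply (case x of (z, t) \<Rightarrow> fx z t) i)"
      by (rule continuous_on_eq) (auto simp: fx)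
  qed
  have "((\<lambda>z. integral (cbox 0 1) (\<lambda>t. f (z + e t *s (\<rho> *\<^sub>R v)) * w t)) has_derivative
      integral (cbox 0 1) (fx z0)) (at z0 within U)"
  proof (rule leibniz_rule[OF _ _ cont U(3,1)])
    fix z t assume z: "z \<in> U"
    have "((\<lambda>z. z + e t *s (\<rho> *\<^sub>R v)) has_derivative (\<lambda>h. h)) (at z within U)"
      by (auto intro!: derivative_eq_intros)
    from has_derivative_compose[OF this hol_has_derivative[OF f inS[OF z]]]
    show "((\<lambda>z. f (z + e t *s (\<rho> *\<^sub>R v)) * w t) has_derivative blinfun_apply (fx z t)) (at z within U)"
      unfolding fx[OF z] by (rule has_derivative_mult_left)
  next
    fix z assume z: "z \<in> U"
    show "(\<lambda>t. f (z + e t *s (\<rho> *\<^sub>R v)) * w t) integrable_on cbox 0 1"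
      by (intro integrable_continuous continuous_intros ce subset_UNIV continuous_on_compose2[OF hol_continuous_on[OF f]]
        bounded_linear.continuous_on[OF bounded_linear_vscale_left]) (use inS z in auto)
  qed
  then have der: "((\<lambda>z. (1/\<rho>) *\<^sub>R integral (cbox 0 1) (\<lambda>t. f (z + e t *s (\<rho> *\<^sub>R v)) * w t)) has_derivative
      (\<lambda>u. (1/\<rho>) *\<^sub>R blinfun_apply (integral (cbox 0 1) (fx z0)) u)) (at z0)"
    unfolding at_within_open[OF U(3,2)] by (rule has_derivative_scaleR_right)
  have eq: "(1/\<rho>) *\<^sub>R integral (cbox 0 1) (\<lambda>t. f (z + e t *s (\<rho> *\<^sub>R v)) * w t) = dd f z v" if "z \<in> U" for z
  proof -
    have z: "z \<in> cball z0 r" "z \<in> S" using that disc[of z 0] by (auto simp: U_def)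
    show ?thesis
      using integral_unique[OF Cauchy_directional[OF f disc[OF z(1)]]] r
        has_derivative_dd_scaleR[OF hol_differentiable[OF f z(2)]] by (simp add: e_def w_def)
  qed
  have "((\<lambda>z. dd f z v) has_derivative
      (\<lambda>u. (1/\<rho>) *\<^sub>R blinfun_apply (integral (cbox 0 1) (fx z0)) u)) (at z0)"
    by (rule has_derivative_transform_within_open[OF der U(2,3) eq])
  moreover have "blinfun_apply (integral (cbox 0 1) (fx z0)) u
      = integral {0..1} (\<lambda>t. dd f (z0 + e t *s (\<rho> *\<^sub>R v)) u * w t)" for u
  proof -
    have "continuous_on (cbox 0 1) (fx z0)"
      by (rule continuous_on_blinfun_componentwise) (simp only: fx[OF U(3)] contw[OF U(3)])
    then have "fx z0 integrable_on cbox 0 1" by (rule integrable_continuous)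
    from blinfun_apply_integral[OF this] show ?thesis by (simp add: fx[OF U(3)])
  qed
  ultimately show ?thesis by (simp add: e_def w_def)
qed

lemma hol_dd:
  assumes f: "hol f S" and S: "open S"
  shows "hol (\<lambda>z. dd f z v) S"
  unfolding hol_def
proof
  fix z0 assume z0: "z0 \<in> S"
  obtain r \<rho> where r: "r > 0" "\<rho> > 0"
    and disc: "\<And>z \<zeta>. z \<in> cball z0 r \<Longrightarrow> norm \<zeta> \<le> 1 \<Longrightarrow> z + \<zeta> *s (\<rho> *\<^sub>R v) \<in> S"
    using disc_subset_of_open[OF S z0] by metis
  let ?h = "\<lambda>u t. dd f (z0 + exp (2 * of_real pi * \<i> * of_real t) *s (\<rho> *\<^sub>R v)) u
        * exp (- (2 * of_real pi * \<i> * complex_of_real t))"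
  have "?h (\<i> *s u) = (\<lambda>t. \<i> * ?h u t)" for u
    using disc[of z0] r by (auto simp: hol_dd_scale[OF f])
  then have "(1/\<rho>) *\<^sub>R integral {0..1} (?h (\<i> *s u)) = \<i> * ((1/\<rho>) *\<^sub>R integral {0..1} (?h u))" for u
    by (simp only: integral_mult_right mult_scaleR_right)
  with hol_dd_has_derivative_integral[OF f S z0 r disc]
  show "\<exists>D. ((\<lambda>z. dd f z v) has_derivative D) (at z0) \<and> (\<forall>u. D (\<i> *s u) = \<i> * D u)" by blast
qed

text \<open>The integral obtained by differentiating in direction \<open>u\<close> is, up to the
  factor \<rho>, Cauchy's formula for the holomorphic function \<open>\<lambda>z. dd f z u\<close>
  in direction \<open>v\<close>.\<close>

lemma hol_dd_commute:
  assumes f: "hol f S" and S: "open S" and z0: "z0 \<in> S"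
  shows "dd (\<lambda>z. dd f z v) z0 u = dd (\<lambda>z. dd f z u) z0 v"
proof -
  obtain r \<rho> where r: "r > 0" "\<rho> > 0"
    and disc: "\<And>z \<zeta>. z \<in> cball z0 r \<Longrightarrow> norm \<zeta> \<le> 1 \<Longrightarrow> z + \<zeta> *s (\<rho> *\<^sub>R v) \<in> S"
    using disc_subset_of_open[OF S z0] by metis
  have z0': "z0 \<in> cball z0 r" using r by simp
  have "dd (\<lambda>z. dd f z v) z0 u = (1/\<rho>) *\<^sub>R dd (\<lambda>z. dd f z u) z0 (\<rho> *\<^sub>R v)"
    using fun_cong[OF dd_eq[OF hol_dd_has_derivative_integral[OF f S z0 r disc]], of u]
      integral_unique[OF Cauchy_directional[OF hol_dd[OF f S] disc[OF z0']], of u] by (simp only:)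
  then show ?thesis
    using has_derivative_dd_scaleR[OF hol_differentiable[OF hol_dd[OF f S] z0]] r by simp
qed

lemma hol_vec_dd:
  assumes "\<And>i. hol (\<lambda>z. f z $ i) S" "open S"
  shows "hol (\<lambda>z. dd f z v $ i) S"
proof (rule hol_cong[OF assms(2)])
  show "hol (\<lambda>z. dd (\<lambda>x. f x $ i) z v) S" by (rule hol_dd[OF assms])
  show "dd (\<lambda>x. f x $ i) z v = dd f z v $ i" if "z \<in> S" for z
  proof (rule dd_vec_nth)
    have "holo_on f S" unfolding holo_on_iff_hol using assms by blast
    then show "f differentiable (at z)" using that by (rule holo_on_differentiable)
  qed
qed

section \<open>Derivatives of matrices and of hermitian forms\<close>

lemma hol_dd_sum:
  assumes "hol f S" "z \<in> S"
  shows "dd f z (\<Sum>m\<in>A. a m *s w m) = (\<Sum>m\<in>A. a m * dd f z (w m))"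
proof -
  have "linear (dd f z)" using hol_differentiable[OF assms] linear_frechet_derivative by blast
  then show ?thesis by (simp add: linear_sum hol_dd_scale[OF assms])
qed

lemma matrix_inv_works:
  fixes A :: "complex^'n::finite^'n"
  assumes "det A \<noteq> 0"
  shows "A ** matrix_inv A = mat 1" "matrix_inv A ** A = mat 1"
proof -
  have "\<exists>B. A ** B = mat 1 \<and> B ** A = mat 1"
    using assms by (simp add: invertible_det_nz[symmetric] invertible_def)
  then have "A ** matrix_inv A = mat 1 \<and> matrix_inv A ** A = mat 1"
    unfolding matrix_inv_def by (rule someI_ex)
  then show "A ** matrix_inv A = mat 1" "matrix_inv A ** A = mat 1" by auto
qed

lemma matrix_vector_mult_axis: "(B *v axis l 1) $ k = (B $ k $ l :: complex)"
  by (simp add: matrix_vector_mult_def axis_def if_distrib cong: if_cong)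

text \<open>Cramer's rule writes the entries as quotients of polynomials in the entries of
  \<open>A\<close>, so that inversion preserves holomorphy.\<close>

lemma matrix_inv_entry:
  fixes A :: "complex^'n::finite^'n"
  assumes "det A \<noteq> 0"
  shows "matrix_inv A $ k $ l = det (\<chi> i j. if j = k then axis l 1 $ i else A $ i $ j) / det A"
proof -
  have "A *v (matrix_inv A *v axis l 1) = axis l 1"
    by (simp add: matrix_vector_mul_assoc matrix_inv_works[OF assms])
  then have "(matrix_inv A *v axis l 1) $ k = det (\<chi> i j. if j = k then axis l 1 $ i else A $ i $ j) / det A"
    unfolding cramer[OF assms] by simp
  then show ?thesis by (simp add: matrix_vector_mult_axis)
qed

lemma hol_matrix_inv:
  fixes A :: "complex^'k::finite \<Rightarrow> complex^'n::finite^'n"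
  assumes A: "\<And>i j. hol (\<lambda>z. A z $ i $ j) S" and S: "open S" and nz: "\<And>z. z \<in> S \<Longrightarrow> det (A z) \<noteq> 0"
  shows "hol (\<lambda>z. matrix_inv (A z) $ k $ l) S"
proof (rule hol_cong[OF S])
  have "hol (\<lambda>z. (\<chi> i j. if j = k then axis l 1 $ i else A z $ i $ j) $ i $ j) S" for i j
    by (cases "j = k") (simp_all add: hol_const A)
  then show "hol (\<lambda>z. det (\<chi> i j. if j = k then axis l 1 $ i else A z $ i $ j) / det (A z)) S"
    by (intro hol_divide hol_det A nz)
qed (simp add: matrix_inv_entry nz)

lemma hol_matrix_vector_mult:
  assumes "\<And>i j. hol (\<lambda>z. A z $ i $ j) S"
  shows "hol (\<lambda>z. (A z *v v) $ k) S"
  unfolding matrix_vector_mult_def by (simp, intro hol_sum hol_mult assms hol_const)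

section \<open>Closure properties of the classes C^k\<close>

lemma Ck_on_cong:
  assumes "open S" "\<And>x. x \<in> S \<Longrightarrow> f x = g x" "Ck_on k f S"
  shows "Ck_on k g S"
  using assms(2,3)
proof (induction k arbitrary: f g)
  case 0
  then show ?case using continuous_on_cong[of S S f g] by simp
next
  case (Suc k)
  have f: "\<And>x. x \<in> S \<Longrightarrow> f differentiable (at x)" and f': "\<And>v. Ck_on k (\<lambda>x. dd f x v) S"
    using Suc.prems(2) by simp_all
  have "dd f x v = dd g x v" if "x \<in> S" for x v
    using dd_cong[OF assms(1) that Suc.prems(1)] by simp
  then have "Ck_on k (\<lambda>x. dd g x v) S" for v
    by (intro Suc.IH[OF _ f'[of v]])
  moreover have "g differentiable (at x)" if "x \<in> S" for x
    by (rule differentiable_transform(1)[OF f[OF that] assms(1) that Suc.prems(1)])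
  ultimately show ?case by simp
qed

text \<open>Feeds the product rule: there the undifferentiated factors reappear next to derivatives
  and must count as regular of the lower order.\<close>

lemma Ck_on_Suc_imp: "Ck_on (Suc k) f S \<Longrightarrow> Ck_on k f S"
proof (induction k arbitrary: f)
  case 0
  then show ?case
    by (simp add: continuous_at_imp_continuous_on differentiable_imp_continuous_within)
next
  case (Suc k)
  have "Ck_on k (\<lambda>x. dd f x v) S" for v using Suc.prems by (intro Suc.IH) simp
  then show ?case using Suc.prems by simp
qed

lemma Ck_on_add:
  assumes S: "open S" and "Ck_on k f S" "Ck_on k g S"
  shows "Ck_on k (\<lambda>x. f x + g x) S"
  using assms(2,3)
proof (induction k arbitrary: f g)
  case 0
  then show ?case by (simp add: continuous_on_add)
next
  case (Suc k)
  have f: "f differentiable (at x)" and g: "g differentiable (at x)" if "x \<in> S" for x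
    using Suc.prems that by simp_all
  have der: "((\<lambda>x. f x + g x) has_derivative (\<lambda>v. dd f x v + dd g x v)) (at x)" if "x \<in> S" for x
    by (intro has_derivative_add differentiable_dd f g that)
  have "Ck_on k (\<lambda>x. dd (\<lambda>x. f x + g x) x v) S" for v
  proof (rule Ck_on_cong[OF S])
    show "Ck_on k (\<lambda>x. dd f x v + dd g x v) S" using Suc.prems by (intro Suc.IH) simp_all
    show "dd f x v + dd g x v = dd (\<lambda>x. f x + g x) x v" if "x \<in> S" for x
      unfolding dd_eq[OF der[OF that]] ..
  qed
  moreover have "(\<lambda>x. f x + g x) differentiable (at x)" if "x \<in> S" for x
    using der[OF that] differentiable_def by blast
  ultimately show ?case by simp
qed

lemma Ck_on_const: "Ck_on k (\<lambda>x. c) S"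
  by (induction k arbitrary: c) (simp_all add: continuous_on_const)

lemma Ck_on_sum:
  assumes "open S" "\<And>i. i \<in> I \<Longrightarrow> Ck_on k (f i) S"
  shows "Ck_on k (\<lambda>x. \<Sum>i\<in>I. f i x) S"
  using assms(2) by (induction I rule: infinite_finite_induct) (auto intro: Ck_on_const Ck_on_add[OF assms(1)])

lemma Ck_on_mult:
  fixes f g :: "'v::real_normed_vector \<Rightarrow> complex"
  assumes S: "open S" and "Ck_on k f S" "Ck_on k g S"
  shows "Ck_on k (\<lambda>x. f x * g x) S"
  using assms(2,3)
proof (induction k arbitrary: f g)
  case 0
  then show ?case by (simp add: continuous_on_mult)
next
  case (Suc k)
  have f: "f differentiable (at x)" and g: "g differentiable (at x)" if "x \<in> S" for x
    using Suc.prems that by simp_all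
  have der: "((\<lambda>x. f x * g x) has_derivative (\<lambda>v. f x * dd g x v + dd f x v * g x)) (at x)" if "x \<in> S" for x
    by (intro has_derivative_mult differentiable_dd f g that)
  have "Ck_on k (\<lambda>x. dd (\<lambda>x. f x * g x) x v) S" for v
  proof (rule Ck_on_cong[OF S])
    have "Ck_on k f S" "Ck_on k g S" using Suc.prems Ck_on_Suc_imp by blast+
    moreover have "Ck_on k (\<lambda>x. dd f x v) S" "Ck_on k (\<lambda>x. dd g x v) S" using Suc.prems by simp_all
    ultimately show "Ck_on k (\<lambda>x. f x * dd g x v + dd f x v * g x) S"
      by (intro Ck_on_add[OF S] Suc.IH)
    show "f x * dd g x v + dd f x v * g x = dd (\<lambda>x. f x * g x) x v" if "x \<in> S" for x
      unfolding dd_eq[OF der[OF that]] ..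
  qed
  moreover have "(\<lambda>x. f x * g x) differentiable (at x)" if "x \<in> S" for x
    using der[OF that] differentiable_def by blast
  ultimately show ?case by simp
qed

lemma has_derivative_cnj: "(f has_derivative D) F \<Longrightarrow> ((\<lambda>x. cnj (f x)) has_derivative (\<lambda>v. cnj (D v))) F"
  by (rule bounded_linear.has_derivative[OF bounded_linear_cnj])

lemma Ck_on_cnj:
  assumes S: "open S" and "Ck_on k f S"
  shows "Ck_on k (\<lambda>x. cnj (f x)) S"
  using assms(2)
proof (induction k arbitrary: f)
  case 0
  then show ?case by (simp add: continuous_on_cnj)
next
  case (Suc k)
  have f: "f differentiable (at x)" if "x \<in> S" for x
    using Suc.prems that by simp
  note der = has_derivative_cnj[OF differentiable_dd[OF f]]
  have "Ck_on k (\<lambda>x. dd (\<lambda>x. cnj (f x)) x v) S" for v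
  proof (rule Ck_on_cong[OF S])
    show "Ck_on k (\<lambda>x. cnj (dd f x v)) S" using Suc.prems by (intro Suc.IH) simp
    show "cnj (dd f x v) = dd (\<lambda>x. cnj (f x)) x v" if "x \<in> S" for x
      unfolding dd_eq[OF der[OF that]] ..
  qed
  moreover have "(\<lambda>x. cnj (f x)) differentiable (at x)" if "x \<in> S" for x
    using der[OF that] differentiable_def by blast
  ultimately show ?case by simp
qed

lemma hol_Ck_on:
  assumes "open S" "hol f S"
  shows "Ck_on k f S"
  using assms(2)
proof (induction k arbitrary: f)
  case 0
  then show ?case by (simp add: hol_continuous_on)
next
  case (Suc k)
  then show ?case using hol_dd[OF _ assms(1)] hol_differentiable by auto
qed

lemma axis_eq_vscale: "axis j a = a *s axis j (1::complex)"
  by (simp add: vec_eq_iff axis_def)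

text \<open>Logarithmic differentiation without a branch of the complex logarithm. It yields both
  the pluriharmonicity behind Ricci-flatness and the length estimate behind completeness.\<close>

lemma has_derivative_ln_cmod:
  assumes "(f has_derivative D) (at z)" "f z \<noteq> 0"
  shows "((\<lambda>w. ln ((cmod (f w))\<^sup>2)) has_derivative (\<lambda>v. 2 * Re (D v / f z))) (at z)"
proof -
  have "((\<lambda>w. ln ((Re (f w))\<^sup>2 + (Im (f w))\<^sup>2)) has_derivative
      (\<lambda>v. (2 * Re (f z) * Re (D v) + 2 * Im (f z) * Im (D v)) / ((Re (f z))\<^sup>2 + (Im (f z))\<^sup>2))) (at z)"
  proof -
    have pos: "(Re (f z))\<^sup>2 + (Im (f z))\<^sup>2 > 0"
      using assms(2) by (simp add: complex_neq_0)
    have "((\<lambda>w. ln ((r w)\<^sup>2 + (i w)\<^sup>2)) has_derivative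
        (\<lambda>v. (2 * r z * r' v + 2 * i z * i' v) / ((r z)\<^sup>2 + (i z)\<^sup>2))) (at z)"
      if "(r has_derivative r') (at z)" "(i has_derivative i') (at z)" "(r z)\<^sup>2 + (i z)\<^sup>2 > 0" for r i :: "_ \<Rightarrow> real" and r' i'
    proof -
      have "((\<lambda>w. (r w)\<^sup>2 + (i w)\<^sup>2) has_derivative (\<lambda>v. 2 * r z * r' v + 2 * i z * i' v)) (at z)"
        by (auto intro!: derivative_eq_intros that(1,2) simp: algebra_simps)
      from has_derivative_compose[OF this DERIV_ln_divide[OF that(3), unfolded has_field_derivative_def]]
      show ?thesis by simp
    qed
    from this[OF bounded_linear.has_derivative[OF bounded_linear_Re assms(1)]
        bounded_linear.has_derivative[OF bounded_linear_Im assms(1)] pos]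
    show ?thesis .
  qed
  moreover have "(2 * Re (f z) * Re d + 2 * Im (f z) * Im d) / ((Re (f z))\<^sup>2 + (Im (f z))\<^sup>2) = 2 * Re (d / f z)" for d
    by (simp add: Re_divide add_divide_distrib algebra_simps)
  ultimately show ?thesis by (simp add: cmod_power2)
qed

text \<open>Locally the function is - log f - cnj (log f); the first summand is holomorphic and is
  annihilated, the second contributes the conjugate of df/f.\<close>

lemma wirtinger_bar_ln_cmod:
  assumes f: "hol f S" and z: "z \<in> S" "f z \<noteq> 0"
  shows "wirtinger_bar j (\<lambda>w. complex_of_real (- ln ((cmod (f w))\<^sup>2))) z = - cnj (dd f z (axis j 1) / f z)"
proof -
  have "((\<lambda>w. complex_of_real (- ln ((cmod (f w))\<^sup>2))) has_derivative
      (\<lambda>v. complex_of_real (- (2 * Re (dd f z v / f z))))) (at z)"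
    by (intro has_derivative_of_real has_derivative_minus has_derivative_ln_cmod hol_has_derivative[OF f] z)
  note der = dd_eq[OF this]
  define q where "q = dd f z (axis j 1) / f z"
  then have q: "dd f z (axis j 1) = q * f z" using z(2) by simp
  have e: "\<i> * (q * f z) / f z = \<i> * q" "q * f z / f z = q" using z(2) by simp_all
  show ?thesis
    unfolding wirtinger_bar_def der axis_eq_vscale[of j \<i>] hol_dd_scale[OF f z(1)] q e
    by (simp add: complex_eq_iff)
qed

lemma wirtinger_cong:
  assumes "open S" "z \<in> S" "\<And>x. x \<in> S \<Longrightarrow> f x = g x"
  shows "wirtinger i f z = wirtinger i g z" "wirtinger_bar i f z = wirtinger_bar i g z"
  by (simp_all add: wirtinger_def wirtinger_bar_def dd_cong[OF assms])

lemma wirtinger_cnj_hol: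
  assumes f: "hol f S" and z: "z \<in> S"
  shows "wirtinger i (\<lambda>w. - cnj (f w)) z = 0"
proof -
  have "((\<lambda>w. - cnj (f w)) has_derivative (\<lambda>v. - cnj (dd f z v))) (at z)"
    by (intro has_derivative_minus has_derivative_cnj hol_has_derivative[OF f] z)
  then show ?thesis
    unfolding wirtinger_def axis_eq_vscale[of i \<i>]
    by (simp add: dd_eq hol_dd_scale[OF f z])
qed

text \<open>What the bar derivative leaves is antiholomorphic and is annihilated by the other
  derivative. The sign in the hypothesis on \<open>h\<close> fits det g = |det S|^-2.\<close>

lemma ln_cmod_pluriharmonic:
  assumes f: "hol f S" and S: "open S" and nz: "\<And>w. w \<in> S \<Longrightarrow> f w \<noteq> 0"
    and h: "\<And>w. w \<in> S \<Longrightarrow> h w = complex_of_real (- ln ((cmod (f w))\<^sup>2))" and z: "z \<in> S"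
  shows "wirtinger i (wirtinger_bar j h) z = 0"
proof -
  have "wirtinger_bar j h w = - cnj (dd f w (axis j 1) / f w)" if "w \<in> S" for w
    using wirtinger_cong(2)[OF S that h] wirtinger_bar_ln_cmod[OF f that nz[OF that]] by simp
  then have "wirtinger i (wirtinger_bar j h) z = wirtinger i (\<lambda>w. - cnj (dd f w (axis j 1) / f w)) z"
    by (rule wirtinger_cong(1)[OF S z])
  also have "\<dots> = 0"
    by (rule wirtinger_cnj_hol[OF _ z]) (intro hol_divide hol_dd f S nz)
  finally show ?thesis .
qed

section \<open>Closed forms and the exterior derivative of a hermitian form\<close>

lemma vec_eq_mult_columns: "A *v a = (\<Sum>m\<in>UNIV. a $ m *s (\<chi> i. (A $ i $ m :: complex)))"
  by (simp add: vec_eq_iff matrix_vector_mult_def mult.commute)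

lemma has_derivative_bilinear_cnj:
  fixes p q :: "'v::real_normed_vector \<Rightarrow> complex^'n::finite"
  assumes "\<And>k. ((\<lambda>y. p y $ k) has_derivative p' k) (at z)" "\<And>k. ((\<lambda>y. q y $ k) has_derivative q' k) (at z)"
  shows "((\<lambda>y. - Im (\<Sum>k\<in>UNIV. p y $ k * cnj (q y $ k))) has_derivative
    (\<lambda>u. - Im (\<Sum>k\<in>UNIV. p z $ k * cnj (q' k u) + p' k u * cnj (q z $ k)))) (at z)"
  by (intro has_derivative_minus bounded_linear.has_derivative[OF bounded_linear_Im] has_derivative_sum
      has_derivative_mult has_derivative_cnj assms)

text \<open>The rows of \<open>T\<close> are 1-forms \<theta>_k, and \<open>sym\<close> says that
  they are closed. For the form - Im (sum of \<theta>_k(u) cnj \<theta>_k(v)) the product rule gives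
  six terms per \<open>k\<close>: two pairs cancel by closedness, and the last two terms are
  conjugate to each other, so that their sum has no imaginary part.\<close>

lemma ext_deriv2_hermitian_eq_0:
  fixes T :: "complex^'n::finite \<Rightarrow> complex^'n^'m::finite"
  assumes T: "\<And>k l. hol (\<lambda>y. T y $ k $ l) S" and S: "open S" and z: "z \<in> S"
    and om: "\<And>y u v. y \<in> S \<Longrightarrow> om y u v = - Im (\<Sum>k\<in>UNIV. (T y *v u) $ k * cnj ((T y *v v) $ k))"
    and sym: "\<And>u v k. dd (\<lambda>y. (T y *v v) $ k) z u = dd (\<lambda>y. (T y *v u) $ k) z v"
  shows "ext_deriv2 om z u v w = 0"
proof -
  define B where "B u v k = dd (\<lambda>y. (T y *v v) $ k) z u" for u v k
  have der: "((\<lambda>y. (T y *v v) $ k) has_derivative (\<lambda>u. B u v k)) (at z)" for v k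
    unfolding B_def by (rule hol_has_derivative[OF hol_matrix_vector_mult[OF T] z])
  have om': "dd (\<lambda>y. om y v w) z u
      = - Im (\<Sum>k\<in>UNIV. (T z *v v) $ k * cnj (B u w k) + B u v k * cnj ((T z *v w) $ k))" for u v w
  proof -
    have "dd (\<lambda>y. om y v w) z = dd (\<lambda>y. - Im (\<Sum>k\<in>UNIV. (T y *v v) $ k * cnj ((T y *v w) $ k))) z"
      by (rule dd_cong[OF S z]) (rule om)
    then have "dd (\<lambda>y. om y v w) z u = dd (\<lambda>y. - Im (\<Sum>k\<in>UNIV. (T y *v v) $ k * cnj ((T y *v w) $ k))) z u"
      by (rule fun_cong)
    also have "\<dots> = - Im (\<Sum>k\<in>UNIV. (T z *v v) $ k * cnj (B u w k) + B u v k * cnj ((T z *v w) $ k))"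
      unfolding dd_eq[OF has_derivative_bilinear_cnj[OF der der]] ..
    finally show ?thesis .
  qed
  have "B u v k = B v u k" for u v k unfolding B_def by (rule sym)
  note Bsym = this[of v u] this[of w u] this[of w v]
  show ?thesis
    unfolding ext_deriv2_def om' Bsym
    by (simp add: sum.distrib sum_subtractf algebra_simps)
qed

text \<open>If the columns of \<open>A\<close> are commuting vector fields, then the rows of the inverse matrix are closed
  forms.\<close>

lemma dd_matrix_inv_symmetric:
  fixes A :: "complex^'n::finite \<Rightarrow> complex^'n^'n"
  assumes A: "\<And>i j. hol (\<lambda>y. A y $ i $ j) S" and S: "open S" and nz: "\<And>y. y \<in> S \<Longrightarrow> det (A y) \<noteq> 0"
    and z: "z \<in> S"
    and comm: "\<And>i l m. dd (\<lambda>y. A y $ i $ l) z (\<chi> i. A z $ i $ m) = dd (\<lambda>y. A y $ i $ m) z (\<chi> i. A z $ i $ l)"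
  shows "dd (\<lambda>y. (matrix_inv (A y) *v v) $ k) z u = dd (\<lambda>y. (matrix_inv (A y) *v u) $ k) z v"
proof -
  let ?T = "\<lambda>y. matrix_inv (A y)"
  have T: "hol (\<lambda>y. ?T y $ k $ l) S" for k l by (rule hol_matrix_inv[OF A S nz])
  define B where "B u v = (\<chi> k. dd (\<lambda>y. (?T y *v v) $ k) z u)" for u v
  have der: "((\<lambda>y. (?T y *v v) $ k) has_derivative (\<lambda>u. B u v $ k)) (at z)" for v k
    unfolding B_def by (simp, rule hol_has_derivative[OF hol_matrix_vector_mult[OF T] z])
  have AT: "A y *v (?T y *v v) = v" if "y \<in> S" for y v
    by (simp add: matrix_vector_mul_assoc matrix_inv_works[OF nz[OF that]])
  define E where "E u a i = (\<Sum>l\<in>UNIV. dd (\<lambda>y. A y $ i $ l) z u * a $ l)" for u i and a :: "complex^'n"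
  \<comment> \<open>Comes from differentiating \<open>AT\<close>, whose right side is constant in
    \<open>y\<close>.\<close>
  have AB: "(A z *v B u v) $ i = - E u (?T z *v v) i" for u v i
  proof -
    have d1: "((\<lambda>y. \<Sum>l\<in>UNIV. A y $ i $ l * (?T y *v v) $ l) has_derivative
      (\<lambda>u. \<Sum>l\<in>UNIV. A z $ i $ l * B u v $ l + dd (\<lambda>y. A y $ i $ l) z u * (?T z *v v) $ l)) (at z)"
      by (intro has_derivative_sum has_derivative_mult der hol_has_derivative[OF A z])
    have d2: "((\<lambda>y. \<Sum>l\<in>UNIV. A y $ i $ l * (?T y *v v) $ l) has_derivative (\<lambda>u. 0)) (at z)"
    proof (rule has_derivative_transform_within_open[OF has_derivative_const S z])
      fix y assume "y \<in> S"
      from AT[OF this] have "(A y *v (?T y *v v)) $ i = v $ i" by simp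
      then show "v $ i = (\<Sum>l\<in>UNIV. A y $ i $ l * (?T y *v v) $ l)"
        unfolding matrix_vector_mult_def[of "A y"] by simp
    qed
    have "(\<Sum>l\<in>UNIV. A z $ i $ l * B u v $ l + dd (\<lambda>y. A y $ i $ l) z u * (?T z *v v) $ l) = 0"
      by (rule fun_cong[OF has_derivative_unique[OF d1 d2]])
    then show ?thesis
      unfolding E_def matrix_vector_mult_def[of "A z"] by (simp add: sum.distrib eq_neg_iff_add_eq_0)
  qed
  \<comment> \<open>\<open>comm\<close> compares only the columns of \<open>A\<close>; this bilinear
    expansion extends the symmetry to the directions \<open>A z *v a\<close>, and these are all
    directions since \<open>A z\<close> is invertible.\<close>
  have E: "E (A z *v a) b i = (\<Sum>l\<in>UNIV. \<Sum>m\<in>UNIV. a $ m * b $ l * dd (\<lambda>y. A y $ i $ l) z (\<chi> i. A z $ i $ m))" for a b i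
    unfolding E_def vec_eq_mult_columns[of "A z"] hol_dd_sum[OF A z]
    by (simp add: sum_distrib_left sum_distrib_right mult_ac)
  have "E (A z *v a) b i = E (A z *v b) a i" for a b i
    unfolding E by (subst sum.swap) (simp add: comm mult_ac)
  from this[of "?T z *v u" "?T z *v v"] have "E u (?T z *v v) i = E v (?T z *v u) i" for i
    by (simp add: AT[OF z])
  then have "A z *v B u v = A z *v B v u" by (simp add: vec_eq_iff AB)
  then have "?T z *v (A z *v B u v) = ?T z *v (A z *v B v u)" by simp
  then have "B u v = B v u"
    by (simp add: matrix_vector_mul_assoc matrix_inv_works[OF nz[OF z]])
  then show ?thesis by (simp add: B_def vec_eq_iff)
qed

section \<open>Charts\<close>

lemma tangent_space_trans:
  assumes "v \<in> tangent_space X p" "c \<in> atlas X" "d \<in> atlas X" "p \<in> fst c" "p \<in> fst d"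
  shows "v d = dd (snd d \<circ> chart_inv c) (snd c p) (v c)"
  using assms unfolding tangent_space_def by blast

locale cplx_mfd =
  fixes X :: "('a, 'n::finite) mfd"
  assumes cm: "complex_manifold X"
begin

lemma chart_openin: "c \<in> atlas X \<Longrightarrow> openin (mtop X) (fst c)"
  and coords_open: "c \<in> atlas X \<Longrightarrow> open (snd c ` fst c)"
  and chart_homeo: "c \<in> atlas X \<Longrightarrow>
    homeomorphic_map (subtopology (mtop X) (fst c)) (top_of_set (snd c ` fst c)) (snd c)"
  using cm unfolding complex_manifold_def by blast+

lemma transition_holo:
  "c \<in> atlas X \<Longrightarrow> d \<in> atlas X \<Longrightarrow> holo_on (snd d \<circ> chart_inv c) (snd c ` (fst c \<inter> fst d))"
  using cm unfolding complex_manifold_def by blast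

lemma chart_sub: "c \<in> atlas X \<Longrightarrow> fst c \<subseteq> points X"
  using chart_openin openin_subset unfolding points_def by blast

lemma ex_chart: "p \<in> points X \<Longrightarrow> \<exists>c. c \<in> atlas X \<and> p \<in> fst c"
  using cm unfolding complex_manifold_def by blast

lemma chart_inj: "c \<in> atlas X \<Longrightarrow> inj_on (snd c) (fst c)"
  using homeomorphic_imp_injective_map[OF chart_homeo, of c] openin_subset[OF chart_openin, of c]
  by (simp add: Int_absorb1)

lemma chart_inv_left: "c \<in> atlas X \<Longrightarrow> p \<in> fst c \<Longrightarrow> chart_inv c (snd c p) = p"
  by (simp add: chart_inv_def chart_inj)

lemma chart_inv_right: "z \<in> snd c ` fst c \<Longrightarrow> snd c (chart_inv c z) = z"
  by (simp add: chart_inv_def f_inv_into_f)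

lemma chart_inv_in: "z \<in> snd c ` fst c \<Longrightarrow> chart_inv c z \<in> fst c"
  by (simp add: chart_inv_def inv_into_into)

lemma open_coords:
  assumes c: "c \<in> atlas X" and U: "openin (mtop X) U"
  shows "open (snd c ` (fst c \<inter> U))"
proof -
  have "openin (top_of_set (snd c ` fst c)) (snd c ` (fst c \<inter> U))"
    using homeomorphic_imp_open_map[OF chart_homeo[OF c]] U
    unfolding open_map_def by (metis openin_subtopology_Int2)
  then show ?thesis using coords_open[OF c] openin_open_eq by blast
qed

lemma open_preimage:
  assumes c: "c \<in> atlas X" and V: "open V"
  shows "openin (mtop X) {p \<in> fst c. snd c p \<in> V}"
proof -
  have "continuous_map (subtopology (mtop X) (fst c)) (top_of_set (snd c ` fst c)) (snd c)"
    by (rule homeomorphic_imp_continuous_map[OF chart_homeo[OF c]])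
  then have "continuous_map (subtopology (mtop X) (fst c)) euclidean (snd c)"
    using continuous_map_in_subtopology by blast
  from openin_continuous_map_preimage[OF this, of V] V
  have "openin (subtopology (mtop X) (fst c)) {p \<in> fst c. snd c p \<in> V}"
    using openin_subset[OF chart_openin[OF c]] by (simp add: topspace_subtopology_subset del: topspace_subtopology)
  then show ?thesis using chart_openin[OF c] openin_trans_full by blast
qed

lemma chart_inv_continuous:
  assumes c: "c \<in> atlas X"
  shows "continuous_map (top_of_set (snd c ` fst c)) (mtop X) (chart_inv c)"
  unfolding continuous_map_def
proof (intro conjI allI impI)
  show "chart_inv c \<in> topspace (top_of_set (snd c ` fst c)) \<rightarrow> topspace (mtop X)"
    using chart_inv_in[of _ c] chart_sub[OF c] by (auto simp: points_def simp del: image_iff)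
  fix U assume U: "openin (mtop X) U"
  have "{z \<in> topspace (top_of_set (snd c ` fst c)). chart_inv c z \<in> U} = snd c ` (fst c \<inter> U)"
    using chart_inv_left[OF c] by auto
  then show "openin (top_of_set (snd c ` fst c)) {z \<in> topspace (top_of_set (snd c ` fst c)). chart_inv c z \<in> U}"
    using open_subset[OF _ open_coords[OF c U]] by (simp add: image_mono)
qed

lemma transition_derivative:
  assumes "c \<in> atlas X" "d \<in> atlas X" "p \<in> fst c" "p \<in> fst d"
  shows "((snd d \<circ> chart_inv c) has_derivative dd (snd d \<circ> chart_inv c) (snd c p)) (at (snd c p))"
    and "linear (dd (snd d \<circ> chart_inv c) (snd c p))"
    and "dd (snd d \<circ> chart_inv c) (snd c p) (a *s v) = a *s dd (snd d \<circ> chart_inv c) (snd c p) v"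
proof -
  have p: "snd c p \<in> snd c ` (fst c \<inter> fst d)" using assms by blast
  note h = transition_holo[OF assms(1,2)]
  show "((snd d \<circ> chart_inv c) has_derivative dd (snd d \<circ> chart_inv c) (snd c p)) (at (snd c p))"
    by (rule holo_on_has_derivative[OF h p])
  show "linear (dd (snd d \<circ> chart_inv c) (snd c p))"
    by (rule linear_frechet_derivative[OF holo_on_differentiable[OF h p]])
  show "dd (snd d \<circ> chart_inv c) (snd c p) (a *s v) = a *s dd (snd d \<circ> chart_inv c) (snd c p) v"
    by (rule holo_on_dd_scale[OF h p])
qed

lemma transition_self:
  assumes "c \<in> atlas X" "p \<in> fst c"
  shows "dd (snd c \<circ> chart_inv c) (snd c p) v = v"
proof -
  have "dd (snd c \<circ> chart_inv c) (snd c p) = dd (\<lambda>z. z) (snd c p)"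
    by (rule dd_cong[OF coords_open[OF assms(1)]]) (use assms chart_inv_right[of _ c] in \<open>simp_all del: image_iff\<close>)
  also have "\<dots> = (\<lambda>v. v)" by (rule dd_eq) (rule has_derivative_ident)
  finally show ?thesis by simp
qed

text \<open>Near \<open>z\<close>, \<open>snd e \<circ> f\<close> is the transition map from
  \<open>d\<close> to \<open>e\<close> after \<open>snd d \<circ> f\<close>. The source of
  \<open>f\<close> is any normed space, so the rule serves coordinate changes, orbit maps and real
  paths alike.\<close>

lemma dd_through_chart:
  fixes f :: "'v::real_normed_vector \<Rightarrow> 'a"
  assumes d: "d \<in> atlas X" "e \<in> atlas X" and z: "f z \<in> fst d" "f z \<in> fst e"
    and S: "open S" "z \<in> S" "\<And>w. w \<in> S \<Longrightarrow> f w \<in> fst d"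
    and diff: "(snd d \<circ> f) differentiable (at z)"
  shows "((snd e \<circ> f) has_derivative (\<lambda>v. dd (snd e \<circ> chart_inv d) (snd d (f z)) (dd (snd d \<circ> f) z v))) (at z)"
proof -
  have "((\<lambda>w. (snd e \<circ> chart_inv d) ((snd d \<circ> f) w)) has_derivative
      (\<lambda>v. dd (snd e \<circ> chart_inv d) (snd d (f z)) (dd (snd d \<circ> f) z v))) (at z)"
    using has_derivative_compose[OF differentiable_dd[OF diff], of "snd e \<circ> chart_inv d"]
      transition_derivative(1)[OF d z] by simp
  then show ?thesis
    by (rule has_derivative_transform_within_open[OF _ S(1,2)]) (use S(3) chart_inv_left[OF d(1)] in auto)
qed

end

lemma linear_lin_comb:
  assumes "linear D" "\<And>(a::complex) v. D (a *s v) = a *s D v"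
  shows "D (\<Sum>m\<in>A. a m *s w m) = (\<Sum>m\<in>A. a m *s D (w m))"
  using assms by (simp add: linear_sum)

abbreviation restr :: "'a set \<Rightarrow> ('a, 'n) chart \<Rightarrow> ('a, 'n) chart"
  where "restr Y c \<equiv> (fst c \<inter> Y, snd c)"

lemma det_eq_0_ker:
  fixes A :: "complex^'n::finite^'n"
  shows "det A = 0 \<longleftrightarrow> (\<exists>a. a \<noteq> 0 \<and> A *v a = 0)"
  using invertible_det_nz[of A] invertible_left_inverse[of A] matrix_left_invertible_ker[of A] by blast

section \<open>The metric for which a holomorphic frame is unitary\<close>

text \<open>Independence of the fields is not part of the axioms: it fails on the zero divisor of
  their wedge, and \<open>Y\<close> is the open set where it holds.\<close>

locale hol_frame = cplx_mfd X for X :: "('a, 'n::finite) mfd" +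
  fixes s :: "'n \<Rightarrow> 'a \<Rightarrow> ('a, 'n) tvec"
  assumes s_trans: "\<lbrakk>c \<in> atlas X; d \<in> atlas X; p \<in> fst c; p \<in> fst d\<rbrakk> \<Longrightarrow>
      s j p d = dd (snd d \<circ> chart_inv c) (snd c p) (s j p c)"
    and s_hol: "c \<in> atlas X \<Longrightarrow> hol (\<lambda>z. s j (chart_inv c z) c $ i) (snd c ` fst c)"
begin

section \<open>The frame matrix and the complement of the divisor\<close>

definition frame_matrix :: "('a, 'n) chart \<Rightarrow> complex^'n \<Rightarrow> complex^'n^'n"
  where "frame_matrix c z = (\<chi> i j. s j (chart_inv c z) c $ i)"

definition Y :: "'a set"
  where "Y = points X - zero_divisor_support X (wedge_section s)"

abbreviation M :: "('a, 'n) mfd"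
  where "M \<equiv> open_submfd X Y"

lemma frame_matrix_at: "c \<in> atlas X \<Longrightarrow> p \<in> fst c \<Longrightarrow> frame_matrix c (snd c p) = (\<chi> i j. s j p c $ i)"
  by (simp add: frame_matrix_def chart_inv_left)

lemma frame_matrix_hol: "c \<in> atlas X \<Longrightarrow> hol (\<lambda>z. frame_matrix c z $ i $ j) (snd c ` fst c)"
  using s_hol by (simp add: frame_matrix_def)

lemma frame_matrix_mult:
  "c \<in> atlas X \<Longrightarrow> p \<in> fst c \<Longrightarrow> frame_matrix c (snd c p) *v a = (\<Sum>m\<in>UNIV. a $ m *s s m p c)"
  by (simp add: vec_eq_mult_columns frame_matrix_at)

lemma frame_matrix_trans:
  assumes "c \<in> atlas X" "d \<in> atlas X" "p \<in> fst c" "p \<in> fst d"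
  shows "frame_matrix d (snd d p) *v a = dd (snd d \<circ> chart_inv c) (snd c p) (frame_matrix c (snd c p) *v a)"
  unfolding frame_matrix_mult[OF assms(1,3)] frame_matrix_mult[OF assms(2,4)]
    linear_lin_comb[OF transition_derivative(2,3)[OF assms]] s_trans[OF assms] ..

text \<open>A linear relation among the frame vectors persists under a change of chart with the same
  coefficients; kernel vectors thus replace the Jacobian factor of the transition.\<close>

lemma frame_matrix_singular:
  assumes "c \<in> atlas X" "d \<in> atlas X" "p \<in> fst c" "p \<in> fst d" "det (frame_matrix c (snd c p)) = 0"
  shows "det (frame_matrix d (snd d p)) = 0"
proof -
  obtain a where a: "a \<noteq> 0" "frame_matrix c (snd c p) *v a = 0"
    using assms(5) unfolding det_eq_0_ker by blast
  then have "frame_matrix d (snd d p) *v a = 0"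
    unfolding frame_matrix_trans[OF assms(1-4)] by (simp add: linear_0[OF transition_derivative(2)[OF assms(1-4)]])
  with a show ?thesis unfolding det_eq_0_ker by blast
qed

text \<open>The divisor asks for some chart in which the determinant vanishes; by the previous lemma
  every chart around \<open>p\<close> gives the same answer.\<close>

lemma Y_iff:
  assumes "c \<in> atlas X" "p \<in> fst c"
  shows "p \<in> Y \<longleftrightarrow> det (frame_matrix c (snd c p)) \<noteq> 0"
proof -
  have "wedge_section s p d = det (frame_matrix d (snd d p))" if "d \<in> atlas X" "p \<in> fst d" for d
    by (simp add: wedge_section_def frame_matrix_at that)
  then have "p \<in> zero_divisor_support X (wedge_section s) \<longleftrightarrow>
      (\<exists>d\<in>atlas X. p \<in> fst d \<and> det (frame_matrix d (snd d p)) = 0)"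
    by (auto simp: zero_divisor_support_def)
  then show ?thesis
    using frame_matrix_singular[OF _ assms(1) _ assms(2)] assms chart_sub unfolding Y_def by blast
qed

lemma coords_Y:
  assumes "c \<in> atlas X"
  shows "snd c ` (fst c \<inter> Y) = {z \<in> snd c ` fst c. det (frame_matrix c z) \<noteq> 0}"
  using Y_iff[OF assms] by blast

lemma coords_Y_open:
  assumes "c \<in> atlas X"
  shows "open (snd c ` (fst c \<inter> Y))"
proof -
  have "continuous_on (snd c ` fst c) (\<lambda>z. det (frame_matrix c z))"
    by (rule hol_continuous_on[OF hol_det[OF frame_matrix_hol[OF assms]]])
  from continuous_open_preimage[OF this coords_open[OF assms] open_Compl[OF closed_singleton]]
  have "open (snd c ` fst c \<inter> (\<lambda>z. det (frame_matrix c z)) -` (- {0}))" .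
  moreover have "snd c ` fst c \<inter> (\<lambda>z. det (frame_matrix c z)) -` (- {0}) = snd c ` (fst c \<inter> Y)"
    unfolding coords_Y[OF assms] by blast
  ultimately show ?thesis by simp
qed

lemma atlas_M: "atlas M = restr Y ` atlas X"
  by (simp add: open_submfd_def)

lemma points_M: "points M = Y"
  by (auto simp: open_submfd_def points_def Y_def)

lemma chart_inv_restr:
  assumes "c \<in> atlas X" "p \<in> fst c" "p \<in> Y"
  shows "chart_inv (restr Y c) (snd c p) = p"
  unfolding chart_inv_def using assms
  by (simp add: inv_into_f_f inj_on_subset[OF chart_inj])

text \<open>The inverses of a chart and of its restriction agree over \<open>Y\<close> only, but the
  coordinates of \<open>Y\<close> form an open set, so the derivatives there agree.\<close>

lemma dd_restr:
  assumes "c \<in> atlas X" "p \<in> fst c" "p \<in> Y"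
  shows "dd (f \<circ> chart_inv (restr Y c)) (snd c p) = dd (f \<circ> chart_inv c) (snd c p)"
  by (rule dd_cong[OF coords_Y_open[OF assms(1)]])
    (use assms in \<open>auto simp: chart_inv_restr chart_inv_left\<close>)

lemma tangent_M_trans:
  assumes "u \<in> tangent_space M p" "c \<in> atlas X" "d \<in> atlas X" "p \<in> fst c" "p \<in> fst d" "p \<in> Y"
  shows "u (restr Y d) = dd (snd d \<circ> chart_inv c) (snd c p) (u (restr Y c))"
proof -
  have "u (restr Y d) = dd (snd (restr Y d) \<circ> chart_inv (restr Y c)) (snd (restr Y c) p) (u (restr Y c))"
    by (rule tangent_space_trans[OF assms(1)]) (use assms in \<open>simp_all add: atlas_M\<close>)
  then show ?thesis by (simp add: dd_restr assms)
qed

section \<open>Components in the frame, and the metric\<close>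

definition cht :: "'a \<Rightarrow> ('a, 'n) chart"
  where "cht p = (SOME c. c \<in> atlas X \<and> p \<in> fst c)"

lemma cht:
  assumes "p \<in> points X"
  shows "cht p \<in> atlas X" "p \<in> fst (cht p)"
  using someI_ex[OF ex_chart[OF assms]] unfolding cht_def by simp_all

lemma Y_points: "p \<in> Y \<Longrightarrow> p \<in> points X"
  by (simp add: Y_def)

text \<open>The components of \<open>u\<close> in the frame at \<open>p\<close>, computed in one
  fixed chart; by \<open>coef_eq\<close> every chart gives the same.\<close>

definition coef :: "'a \<Rightarrow> ('a, 'n) tvec \<Rightarrow> complex^'n"
  where "coef p u = matrix_inv (frame_matrix (cht p) (snd (cht p) p)) *v u (restr Y (cht p))"

definition frame_metric :: "('a, 'n) metric"
  where "frame_metric p u v = (\<Sum>k\<in>UNIV. coef p u $ k * cnj (coef p v $ k))"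

lemma frame_inv:
  assumes "c \<in> atlas X" "p \<in> fst c" "p \<in> Y"
  shows "matrix_inv (frame_matrix c (snd c p)) *v (frame_matrix c (snd c p) *v a) = a"
    and "frame_matrix c (snd c p) *v (matrix_inv (frame_matrix c (snd c p)) *v a) = a"
  using assms by (simp_all add: matrix_vector_mul_assoc matrix_inv_works Y_iff[symmetric])

text \<open>Frame and tangent vectors change by the same linear map, so the coefficients do not
  change.\<close>

lemma coef_eq:
  assumes u: "u \<in> tangent_space M p" and p: "p \<in> Y" and c: "c \<in> atlas X" "p \<in> fst c"
  shows "coef p u = matrix_inv (frame_matrix c (snd c p)) *v u (restr Y c)"
proof -
  define a where "a = coef p u"
  note d = cht[OF Y_points[OF p]]
  have "u (restr Y (cht p)) = frame_matrix (cht p) (snd (cht p) p) *v a"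
    unfolding a_def coef_def frame_inv(2)[OF d p] ..
  then have "u (restr Y c) = frame_matrix c (snd c p) *v a"
    unfolding tangent_M_trans[OF u d(1) c(1) d(2) c(2) p] frame_matrix_trans[OF d(1) c(1) d(2) c(2)] by simp
  then have "matrix_inv (frame_matrix c (snd c p)) *v u (restr Y c) = a"
    by (simp add: frame_inv(1)[OF c p])
  then show ?thesis by (simp add: a_def)
qed

lemma coord_tvec_M:
  assumes c: "c \<in> atlas X" "p \<in> fst c" and p: "p \<in> Y"
  shows "coord_tvec M (restr Y c) (snd c p) w \<in> tangent_space M p"
    and "coord_tvec M (restr Y c) (snd c p) w (restr Y c) = w"
proof -
  let ?v = "coord_tvec M (restr Y c) (snd c p) w"
  have v: "?v (restr Y d) = dd (snd d \<circ> chart_inv c) (snd c p) w" if "d \<in> atlas X" "p \<in> fst d" for d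
    using that p by (simp add: coord_tvec_def atlas_M chart_inv_restr[OF c p] dd_restr[OF c p])
  show "?v (restr Y c) = w"
    unfolding v[OF c] by (rule transition_self[OF c])
  \<comment> \<open>Compatibility of the entries is the chain rule for the transitions from
    \<open>c\<close> through \<open>d\<close> to \<open>e\<close>.\<close>
  show "?v \<in> tangent_space M p"
    unfolding tangent_space_def
  proof (intro CollectI conjI ballI allI impI)
    fix d' e' assume "d' \<in> atlas M" "e' \<in> atlas M" and pd: "p \<in> fst d' \<inter> fst e'"
    then obtain d e where d: "d \<in> atlas X" "d' = restr Y d" and e: "e \<in> atlas X" "e' = restr Y e"
      unfolding atlas_M by blast
    have pde: "p \<in> fst d" "p \<in> fst e" using pd d e by auto
    have "((snd e \<circ> chart_inv c) has_derivative
        (\<lambda>v. dd (snd e \<circ> chart_inv d) (snd d (chart_inv c (snd c p))) (dd (snd d \<circ> chart_inv c) (snd c p) v)))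
        (at (snd c p))"
    proof (rule dd_through_chart[OF d(1) e(1)])
      show "open (snd c ` (fst c \<inter> fst d))" by (rule open_coords[OF c(1) chart_openin[OF d(1)]])
      show "(snd d \<circ> chart_inv c) differentiable (at (snd c p))"
        using transition_derivative(1)[OF c(1) d(1) c(2) pde(1)] differentiable_def by blast
    qed (use c pde chart_inv_left[OF c(1)] in auto)
    from dd_eq[OF this]
    show "?v e' = dd (snd e' \<circ> chart_inv d') (snd d' p) (?v d')"
      using d e by (simp add: v pde dd_restr[OF d(1) pde(1) p] chart_inv_left[OF c])
  next
    fix d' assume "d' \<notin> atlas M \<or> p \<notin> fst d'"
    then show "?v d' = 0" by (auto simp: coord_tvec_def chart_inv_restr[OF c p])
  qed
qed

lemma frame_metric_coord:
  assumes c: "c \<in> atlas X" "p \<in> fst c" and p: "p \<in> Y"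
  shows "frame_metric p (coord_tvec M (restr Y c) (snd c p) u) (coord_tvec M (restr Y c) (snd c p) v) =
    (\<Sum>k\<in>UNIV. (matrix_inv (frame_matrix c (snd c p)) *v u) $ k * cnj ((matrix_inv (frame_matrix c (snd c p)) *v v) $ k))"
  unfolding frame_metric_def coef_eq[OF coord_tvec_M(1)[OF c p] p c] coord_tvec_M(2)[OF c p] ..

lemma metric_matrix_frame:
  assumes c: "c \<in> atlas X" and z: "z \<in> snd c ` (fst c \<inter> Y)"
  shows "metric_matrix M frame_metric (restr Y c) z $ i $ j =
    (\<Sum>k\<in>UNIV. matrix_inv (frame_matrix c z) $ k $ i * cnj (matrix_inv (frame_matrix c z) $ k $ j))"
proof -
  obtain p where p: "p \<in> fst c" "p \<in> Y" "z = snd c p" using z by blast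
  show ?thesis
    unfolding p(3) metric_matrix_def
    by (simp add: chart_inv_restr[OF c p(1,2)] frame_metric_coord[OF c p(1,2)] matrix_vector_mult_axis)
qed

lemma frame_matrix_inv_hol:
  assumes c: "c \<in> atlas X"
  shows "hol (\<lambda>z. matrix_inv (frame_matrix c z) $ k $ l) (snd c ` (fst c \<inter> Y))"
  by (rule hol_matrix_inv[OF hol_subset[OF frame_matrix_hol[OF c]] coords_Y_open[OF c]])
    (auto simp: coords_Y[OF c] simp del: image_iff)

lemma hermitian_frame_metric: "hermitian_metric M frame_metric"
  unfolding hermitian_metric_def points_M
proof (intro conjI ballI allI impI)
  fix p u v w a
  show "frame_metric p (\<lambda>c. a *s u c + v c) w = a * frame_metric p u w + frame_metric p v w"
    unfolding frame_metric_def coef_def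
    by (simp add: matrix_vector_right_distrib vector_scalar_commute sum_distrib_left sum.distrib algebra_simps)
  show "frame_metric p v u = cnj (frame_metric p u v)"
    unfolding frame_metric_def by (simp add: mult.commute)
next
  fix p u assume p: "p \<in> Y" and u: "u \<in> tangent_space M p" "u \<noteq> (\<lambda>_. 0)"
  note c = cht[OF Y_points[OF p]]
  have "coef p u \<noteq> 0"
  proof
    assume "coef p u = 0"
    then have "u (restr Y (cht p)) = frame_matrix (cht p) (snd (cht p) p) *v 0"
      using frame_inv(2)[OF c p, of "u (restr Y (cht p))"] by (simp add: coef_def)
    then have 0: "u (restr Y (cht p)) = 0" by simp
    \<comment> \<open>Charts around \<open>p\<close> receive the zero through the transition map;
      all other indices carry 0 by convention.\<close>
    have "u d' = 0" for d'
    proof (cases "d' \<in> atlas M \<and> p \<in> fst d'")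
      case True
      then obtain d where d: "d \<in> atlas X" "d' = restr Y d" "p \<in> fst d" unfolding atlas_M by auto
      show ?thesis
        unfolding d(2) tangent_M_trans[OF u(1) c(1) d(1) c(2) d(3) p] 0
        by (rule linear_0[OF transition_derivative(2)[OF c(1) d(1) c(2) d(3)]])
    next
      case False
      then show ?thesis using u(1) unfolding tangent_space_def by blast
    qed
    then show False using u(2) by blast
  qed
  then obtain k where k: "coef p u $ k \<noteq> 0" by (metis vec_eq_iff zero_index)
  have "Re (frame_metric p u u) = (\<Sum>k\<in>UNIV. (cmod (coef p u $ k))\<^sup>2)"
    unfolding frame_metric_def by (simp add: cmod_power2) (simp add: power2_eq_square)
  also have "\<dots> > 0" by (rule sum_pos2[of _ k]) (use k in auto)
  finally show "0 < Re (frame_metric p u u)" .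
next
  fix c' i j assume "c' \<in> atlas M"
  then obtain c where c: "c \<in> atlas X" "c' = restr Y c" unfolding atlas_M by blast
  note op = coords_Y_open[OF c(1)]
  have "Ck_on n (\<lambda>z. metric_matrix M frame_metric (restr Y c) z $ i $ j) (snd c ` (fst c \<inter> Y))" for n
  proof (rule Ck_on_cong[OF op])
    show "Ck_on n (\<lambda>z. \<Sum>k\<in>UNIV. matrix_inv (frame_matrix c z) $ k $ i * cnj (matrix_inv (frame_matrix c z) $ k $ j))
        (snd c ` (fst c \<inter> Y))"
      by (intro Ck_on_sum Ck_on_mult Ck_on_cnj op hol_Ck_on frame_matrix_inv_hol c(1))
  qed (simp add: metric_matrix_frame c(1) del: image_iff)
  then show "smooth_on (\<lambda>z. metric_matrix M frame_metric c' z $ i $ j) (snd c' ` fst c')"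
    unfolding smooth_on_def c(2) by simp
qed

lemma det_cnj: "det (\<chi> i j. cnj (B $ i $ j)) = cnj (det (B :: complex^'k::finite^'k))"
  by (simp add: det_def)

lemma det_metric_matrix:
  assumes c: "c \<in> atlas X" and z: "z \<in> snd c ` (fst c \<inter> Y)"
  shows "det (metric_matrix M frame_metric (restr Y c) z) = complex_of_real (inverse ((cmod (det (frame_matrix c z)))\<^sup>2))"
proof -
  let ?A = "frame_matrix c z" let ?T = "matrix_inv ?A"
  have nz: "det ?A \<noteq> 0" using z unfolding coords_Y[OF c] by blast
  have "det ?A * det ?T = 1"
    using matrix_inv_works(1)[OF nz] by (simp add: det_mul[symmetric])
  then have dT: "det ?T = inverse (det ?A)" by (rule inverse_unique[symmetric])
  \<comment> \<open>The Gram matrix of the coordinate fields, whose components in the frame are the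
    columns of \<open>?T\<close>.\<close>
  have "metric_matrix M frame_metric (restr Y c) z = transpose ?T ** (\<chi> i j. cnj (?T $ i $ j))"
    by (simp add: vec_eq_iff metric_matrix_frame[OF c z] matrix_matrix_mult_def transpose_def)
  then have "det (metric_matrix M frame_metric (restr Y c) z) = inverse (det ?A * cnj (det ?A))"
    by (simp add: det_mul det_transpose det_cnj dT)
  then show ?thesis by (simp add: complex_mult_cnj cmod_power2)
qed

lemma ricci_flat_frame_metric: "ricci_flat M frame_metric"
  unfolding ricci_flat_def
proof (intro ballI allI)
  fix c' z i j assume "c' \<in> atlas M" and z: "z \<in> snd c' ` fst c'"
  then obtain c where c: "c \<in> atlas X" "c' = restr Y c" unfolding atlas_M by blast
  have z: "z \<in> snd c ` (fst c \<inter> Y)" using z c by simp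
  let ?h = "\<lambda>w. complex_of_real (ln (Re (det (metric_matrix M frame_metric (restr Y c) w))))"
  have "wirtinger i (wirtinger_bar j ?h) z = 0"
  proof (rule ln_cmod_pluriharmonic[OF _ coords_Y_open[OF c(1)] _ _ z])
    show "hol (\<lambda>w. det (frame_matrix c w)) (snd c ` (fst c \<inter> Y))"
      by (rule hol_det[OF hol_subset[OF frame_matrix_hol[OF c(1)]]]) blast
    fix w assume w: "w \<in> snd c ` (fst c \<inter> Y)"
    then show nz: "det (frame_matrix c w) \<noteq> 0" unfolding coords_Y[OF c(1)] by blast
    show "?h w = complex_of_real (- ln ((cmod (det (frame_matrix c w)))\<^sup>2))"
      unfolding det_metric_matrix[OF c(1) w] Re_complex_of_real using nz by (subst ln_inverse) simp_all
  qed
  then show "ricci M frame_metric c' z i j = 0" unfolding ricci_def c(2) by simp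
qed

text \<open>\<open>comm\<close> is the coordinate form of the vanishing of the bracket of two frame
  fields. The rows of the inverse frame matrix are the dual coframe.\<close>

lemma kaehler_frame_metric:
  assumes comm: "\<And>c z i l m. c \<in> atlas X \<Longrightarrow> z \<in> snd c ` fst c \<Longrightarrow>
    dd (\<lambda>y. frame_matrix c y $ i $ l) z (\<chi> i. frame_matrix c z $ i $ m) =
    dd (\<lambda>y. frame_matrix c y $ i $ m) z (\<chi> i. frame_matrix c z $ i $ l)"
  shows "kaehler M frame_metric"
  unfolding kaehler_def
proof (intro ballI allI)
  fix c' z u v w assume "c' \<in> atlas M" and z: "z \<in> snd c' ` fst c'"
  then obtain c where c: "c \<in> atlas X" "c' = restr Y c" unfolding atlas_M by blast
  have z: "z \<in> snd c ` (fst c \<inter> Y)" using z c by simp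
  show "ext_deriv2 (fundamental_form M frame_metric c') z u v w = 0"
    unfolding c(2)
  proof (rule ext_deriv2_hermitian_eq_0[OF frame_matrix_inv_hol[OF c(1)] coords_Y_open[OF c(1)] z])
    fix y u v assume "y \<in> snd c ` (fst c \<inter> Y)"
    then obtain p where p: "p \<in> fst c" "p \<in> Y" "y = snd c p" by blast
    show "fundamental_form M frame_metric (restr Y c) y u v =
      - Im (\<Sum>k\<in>UNIV. (matrix_inv (frame_matrix c y) *v u) $ k * cnj ((matrix_inv (frame_matrix c y) *v v) $ k))"
      unfolding p(3) fundamental_form_def chart_inv_restr[OF c(1) p(1,2)] frame_metric_coord[OF c(1) p(1,2)] ..
  next
    fix u v k
    show "dd (\<lambda>y. (matrix_inv (frame_matrix c y) *v v) $ k) z u =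
          dd (\<lambda>y. (matrix_inv (frame_matrix c y) *v u) $ k) z v"
    proof (rule dd_matrix_inv_symmetric[OF _ coords_Y_open[OF c(1)] _ z])
      show "hol (\<lambda>y. frame_matrix c y $ i $ j) (snd c ` (fst c \<inter> Y))" for i j
        by (rule hol_subset[OF frame_matrix_hol[OF c(1)]]) blast
      show "det (frame_matrix c y) \<noteq> 0" if "y \<in> snd c ` (fst c \<inter> Y)" for y
        using that unfolding coords_Y[OF c(1)] by blast
      show "dd (\<lambda>y. frame_matrix c y $ i $ l) z (\<chi> i. frame_matrix c z $ i $ m) =
        dd (\<lambda>y. frame_matrix c y $ i $ m) z (\<chi> i. frame_matrix c z $ i $ l)" for i l m
        by (rule comm[OF c(1)]) (use z in blast)
    qed
  qed
qed

end

section \<open>Completeness\<close>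

lemma norm_vec_le_sum: "norm x \<le> (\<Sum>i\<in>UNIV. norm (x $ i))"
  unfolding norm_vec_def by (rule L2_set_le_sum) simp

lemma norm_matrix_vector_le:
  fixes A :: "complex^'n::finite^'m::finite"
  shows "norm (A *v a) \<le> (\<Sum>i\<in>UNIV. \<Sum>j\<in>UNIV. cmod (A $ i $ j)) * norm a"
proof -
  have "norm (A *v a) \<le> (\<Sum>i\<in>UNIV. cmod (\<Sum>j\<in>UNIV. A $ i $ j * a $ j))"
    using norm_vec_le_sum[of "A *v a"] by (simp add: matrix_vector_mult_def)
  also have "\<dots> \<le> (\<Sum>i\<in>UNIV. \<Sum>j\<in>UNIV. cmod (A $ i $ j) * norm a)"
    by (intro sum_mono order_trans[OF norm_sum])
      (simp add: norm_mult mult_left_mono Finite_Cartesian_Product.norm_nth_le)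
  finally show ?thesis by (simp add: sum_distrib_right)
qed

lemma matrix_bounded_on_compact:
  fixes A :: "'z::topological_space \<Rightarrow> complex^'n::finite^'m::finite"
  assumes "compact C" "\<And>i j. continuous_on C (\<lambda>z. A z $ i $ j)"
  obtains K where "K > 0" "\<And>z a. z \<in> C \<Longrightarrow> norm (A z *v a) \<le> K * norm a"
proof -
  let ?f = "\<lambda>z. \<Sum>i\<in>UNIV. \<Sum>j\<in>UNIV. cmod (A z $ i $ j)"
  have "compact (?f ` C)"
    by (rule compact_continuous_image[OF _ assms(1)]) (intro continuous_intros assms(2))
  then obtain K where K: "K > 0" "\<And>x. x \<in> ?f ` C \<Longrightarrow> norm x \<le> K"
    using compact_imp_bounded bounded_pos by metis
  have "norm (A z *v a) \<le> K * norm a" if "z \<in> C" for z a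
  proof -
    have "?f z \<le> K" using K(2)[of "?f z"] that by simp
    then show ?thesis using norm_matrix_vector_le[of "A z" a] mult_right_mono[of "?f z" K "norm a"] by simp
  qed
  with K(1) show thesis by (rule that)
qed

lemma continuous_on_vecI:
  fixes f :: "'a::topological_space \<Rightarrow> complex^'n::finite"
  assumes "\<And>i. continuous_on S (\<lambda>x. f x $ i)"
  shows "continuous_on S f"
  using continuous_on_vec_lambda[of S "\<lambda>i x. f x $ i", OF assms] by simp

text \<open>Point and direction both vary with \<open>t\<close>; expanding the direction in the
  standard basis leaves derivatives in fixed directions.\<close>

lemma continuous_on_dd_apply:
  assumes f: "hol f S" and S: "open S" and g: "continuous_on T g" "\<And>t. t \<in> T \<Longrightarrow> g t \<in> S"
    and h: "continuous_on T h"
  shows "continuous_on T (\<lambda>t. dd f (g t) (h t))"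
proof -
  have "continuous_on T (\<lambda>t. \<Sum>i\<in>UNIV. h t $ i * dd f (g t) (axis i 1))"
    by (intro continuous_on_sum continuous_on_mult continuous_on_component h
        continuous_on_compose2[OF hol_dd_continuous_on[OF f S] g(1)]) (use g(2) in blast)
  then show ?thesis
  proof (rule continuous_on_eq)
    show "(\<Sum>i\<in>UNIV. h t $ i * dd f (g t) (axis i 1)) = dd f (g t) (h t)" if "t \<in> T" for t
      using hol_dd_sum[OF f g(2)[OF that], of "\<lambda>i. h t $ i" "\<lambda>i. axis i 1" UNIV]
      by (simp add: vec_eq_sum_axis[symmetric])
  qed
qed

text \<open>The common core of the two estimates along a path: it is applied to the coordinates of
  the path and to log |det S|^2 along it. The length over all of \<open>{0..1}\<close> bounds the
  displacement over any subinterval.\<close>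

lemma displacement_le_length:
  fixes \<phi> :: "real \<Rightarrow> 'e::euclidean_space" and sp :: "real \<Rightarrow> real"
  assumes ab: "0 \<le> a" "a \<le> b" "b \<le> 1" and cont: "continuous_on {a..b} \<phi>" and S: "finite S"
    and der: "\<And>t. t \<in> {a<..<b} - S \<Longrightarrow> (\<phi> has_vector_derivative \<phi>' t) (at t)"
    and cont': "continuous_on ({a<..<b} - S) \<phi>'"
    and bound: "\<And>t. t \<in> {a<..<b} - S \<Longrightarrow> norm (\<phi>' t) \<le> K * sp t" and K: "0 < K"
    and L: "(\<integral>\<^sup>+t\<in>{0..1}. ennreal (sp t) \<partial>lborel) < ennreal \<epsilon>" and \<epsilon>: "0 \<le> \<epsilon>"
  shows "norm (\<phi> b - \<phi> a) \<le> K * \<epsilon>"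
proof -
  \<comment> \<open>Extended by 0 over the exceptional points and beyond the interval, the
    derivative becomes a Borel function on the line.\<close>
  define \<psi> where "\<psi> = (\<lambda>t. indicator ({a<..<b} - S) t *\<^sub>R \<phi>' t)"
  have meas: "\<psi> \<in> borel_measurable borel"
    unfolding \<psi>_def
    by (rule borel_measurable_continuous_on_indicator[OF _ cont']) (simp add: finite_imp_closed[OF S] borel_closed sets.Diff)
  \<comment> \<open>Measurability is known for \<psi> but not for \<open>sp\<close>. Hence
    \<open>K\<close> is divided off on the side of \<psi>, and \<open>sp\<close> enters through
    monotonicity alone.\<close>
  have "(\<integral>\<^sup>+t. ennreal (norm (\<psi> t) / K) \<partial>lborel) \<le> (\<integral>\<^sup>+t\<in>{0..1}. ennreal (sp t) \<partial>lborel)"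
  proof (rule nn_integral_mono)
    fix t
    show "ennreal (norm (\<psi> t) / K) \<le> ennreal (sp t) * indicator {0..1} t"
    proof (cases "t \<in> {a<..<b} - S")
      case True
      then have "norm (\<psi> t) / K \<le> sp t" "t \<in> {0..1}"
        using bound[OF True] K ab by (simp_all add: \<psi>_def divide_le_eq mult.commute)
      then show ?thesis by (simp add: ennreal_leI)
    qed (simp add: \<psi>_def)
  qed
  then have "(\<integral>\<^sup>+t. ennreal (norm (\<psi> t) / K) \<partial>lborel) < ennreal \<epsilon>" using L by simp
  moreover have "(\<integral>\<^sup>+t. ennreal (norm (\<psi> t)) \<partial>lborel) = ennreal K * (\<integral>\<^sup>+t. ennreal (norm (\<psi> t) / K) \<partial>lborel)"
  proof -
    have "(\<integral>\<^sup>+t. ennreal (norm (\<psi> t)) \<partial>lborel) = (\<integral>\<^sup>+t. ennreal K * ennreal (norm (\<psi> t) / K) \<partial>lborel)"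
      using K by (intro nn_integral_cong) (simp add: ennreal_mult[symmetric])
    also have "\<dots> = ennreal K * (\<integral>\<^sup>+t. ennreal (norm (\<psi> t) / K) \<partial>lborel)"
      using meas by (intro nn_integral_cmult measurable_compose[OF _ measurable_ennreal]
          borel_measurable_divide borel_measurable_norm borel_measurable_const) simp_all
    finally show ?thesis .
  qed
  ultimately have nn: "(\<integral>\<^sup>+t. ennreal (norm (\<psi> t)) \<partial>lborel) \<le> ennreal (K * \<epsilon>)"
    using K \<epsilon> by (simp add: ennreal_mult mult_left_mono)
  then have "(\<integral>\<^sup>+t. ennreal (norm (\<psi> t)) \<partial>lborel) < \<infinity>"
    by (rule le_less_trans) simp
  then have int: "integrable lborel \<psi>"
    using meas by (intro integrableI_bounded) simp_all
  have "(\<psi> has_integral (\<phi> b - \<phi> a)) {a..b}"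
    by (rule fundamental_theorem_of_calculus_interior_strong[OF S ab(2) _ cont])
      (use der in \<open>simp add: \<psi>_def\<close>)
  then have "(\<psi> has_integral (\<phi> b - \<phi> a)) UNIV"
    by (rule has_integral_on_superset) (auto simp: \<psi>_def indicator_def)
  then have "\<phi> b - \<phi> a = integral\<^sup>L lborel \<psi>"
    by (rule has_integral_unique[OF _ has_integral_integral_lborel[OF int]])
  then have "norm (\<phi> b - \<phi> a) \<le> (\<integral>t. norm (\<psi> t) \<partial>lborel)"
    by (simp add: integral_norm_bound)
  then have "ennreal (norm (\<phi> b - \<phi> a)) \<le> ennreal (\<integral>t. norm (\<psi> t) \<partial>lborel)"
    by (rule ennreal_leI)
  also have "\<dots> = (\<integral>\<^sup>+t. ennreal (norm (\<psi> t)) \<partial>lborel)"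
    by (rule nn_integral_eq_integral[symmetric]) (use int in auto)
  also note nn
  finally show ?thesis using K \<epsilon> by (simp add: ennreal_le_iff)
qed

context hol_frame
begin

text \<open>The derivative in one chart determines those in all others, so that the speed of a path
  can be computed in a single chart.\<close>

lemma velocity_eq_coord_tvec:
  assumes c: "c \<in> atlas X" and S: "open S" "t \<in> S" "\<And>u. u \<in> S \<Longrightarrow> \<gamma> u \<in> fst c" and Y: "\<gamma> t \<in> Y"
    and der: "((snd c \<circ> \<gamma>) has_vector_derivative D) (at t)"
  shows "velocity M \<gamma> t = coord_tvec M (restr Y c) (snd c (\<gamma> t)) D"
proof
  fix d'
  have ct: "\<gamma> t \<in> fst c" using S by blast
  show "velocity M \<gamma> t d' = coord_tvec M (restr Y c) (snd c (\<gamma> t)) D d'"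
  proof (cases "d' \<in> atlas M \<and> \<gamma> t \<in> fst d'")
    case True
    then obtain d where d: "d \<in> atlas X" "d' = restr Y d" "\<gamma> t \<in> fst d" unfolding atlas_M by auto
    let ?L = "dd (snd d \<circ> chart_inv c) (snd c (\<gamma> t))"
    have lin: "linear ?L" by (rule transition_derivative(2)[OF c d(1) ct d(3)])
    have ddD: "dd (snd c \<circ> \<gamma>) t = (\<lambda>h. h *\<^sub>R D)"
      using der unfolding has_vector_derivative_def by (rule dd_eq)
    have "((snd d \<circ> \<gamma>) has_derivative (\<lambda>v. ?L (dd (snd c \<circ> \<gamma>) t v))) (at t)"
      by (rule dd_through_chart[where f=\<gamma> and z=t, OF c d(1) ct d(3) S])
        (use der in \<open>simp_all add: has_vector_derivative_def differentiableI\<close>)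
    then have "((snd d \<circ> \<gamma>) has_vector_derivative ?L D) (at t)"
      unfolding has_vector_derivative_def ddD linear_cmul[OF lin] .
    then have "vector_derivative (snd d \<circ> \<gamma>) (at t) = ?L D" by (rule vector_derivative_at)
    moreover have "dd (snd d \<circ> chart_inv (restr Y c)) (snd c (\<gamma> t)) D = ?L D"
      by (simp add: dd_restr[OF c ct Y])
    ultimately show ?thesis
      using True d by (simp add: velocity_def coord_tvec_def chart_inv_restr[OF c ct Y])
  next
    case False
    then show ?thesis by (auto simp: velocity_def coord_tvec_def chart_inv_restr[OF c ct Y])
  qed
qed

lemma norm_vec_power2: "(norm (x::complex^'k::finite))\<^sup>2 = (\<Sum>i\<in>UNIV. (cmod (x $ i))\<^sup>2)"
  by (simp add: norm_vec_def L2_set_def sum_nonneg)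

lemma speed_coord:
  assumes c: "c \<in> atlas X" "p \<in> fst c" and p: "p \<in> Y"
  shows "sqrt (Re (frame_metric p (coord_tvec M (restr Y c) (snd c p) u) (coord_tvec M (restr Y c) (snd c p) u))) =
    norm (matrix_inv (frame_matrix c (snd c p)) *v u)"
proof -
  have "Re (\<Sum>k\<in>UNIV. x $ k * cnj (x $ k)) = (norm x)\<^sup>2" for x :: "complex^'n"
    unfolding norm_vec_power2 by (simp add: cmod_power2) (simp add: power2_eq_square)
  then show ?thesis unfolding frame_metric_coord[OF assms] by simp
qed

text \<open>The constant \<open>K\<close> does not deteriorate near the zero divisor.\<close>

lemma short_path_estimate_inside:
  assumes c: "c \<in> atlas X" and \<gamma>: "pw_C1_path M \<gamma>" and t: "0 \<le> t" "t \<le> 1"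
    and inY: "\<And>u. u \<in> {0..1} \<Longrightarrow> \<gamma> u \<in> Y"
    and inC: "\<And>u. u \<in> {0..t} \<Longrightarrow> \<gamma> u \<in> fst c \<and> snd c (\<gamma> u) \<in> C"
    and K: "K > 0" "\<And>z a. z \<in> C \<Longrightarrow> norm (frame_matrix c z *v a) \<le> K * norm a"
      "\<And>z a. z \<in> C \<Longrightarrow> cmod (dd (\<lambda>z. det (frame_matrix c z)) z (frame_matrix c z *v a))
         \<le> K * norm a * cmod (det (frame_matrix c z))"
    and len: "path_len M frame_metric \<gamma> < ennreal \<epsilon>" and \<epsilon>: "0 \<le> \<epsilon>"
  shows "norm (snd c (\<gamma> t) - snd c (\<gamma> 0)) \<le> K * \<epsilon>"
    and "\<bar>ln ((cmod (det (frame_matrix c (snd c (\<gamma> t)))))\<^sup>2) - ln ((cmod (det (frame_matrix c (snd c (\<gamma> 0)))))\<^sup>2)\<bar>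
      \<le> 2 * K * \<epsilon>"
proof -
  define \<zeta> where "\<zeta> = snd c \<circ> \<gamma>"
  define \<sigma> where "\<sigma> = (\<lambda>z. det (frame_matrix c z))"
  have \<sigma>h: "hol \<sigma> (snd c ` fst c)" unfolding \<sigma>_def by (rule hol_det[OF frame_matrix_hol[OF c]])
  have pw: "\<zeta> piecewise_C1_differentiable_on {0..t}"
  proof -
    have "restr Y c \<in> atlas M" "\<gamma> ` {0..t} \<subseteq> fst (restr Y c)"
      using c inC inY t by (auto simp: atlas_M)
    then have "(snd (restr Y c) \<circ> \<gamma>) piecewise_C1_differentiable_on {0..t}"
      using \<gamma> t unfolding pw_C1_path_def by blast
    then show ?thesis by (simp add: \<zeta>_def)
  qed
  then obtain S D where cont: "continuous_on {0..t} \<zeta>" and S: "finite S"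
    and D: "\<And>x. x \<in> {0..t} - S \<Longrightarrow> (\<zeta> has_vector_derivative D x) (at x)" "continuous_on ({0..t} - S) D"
    unfolding piecewise_C1_differentiable_on_def C1_differentiable_on_def by blast
  define sp where "sp u = sqrt (Re (frame_metric (\<gamma> u) (velocity M \<gamma> u) (velocity M \<gamma> u)))" for u
  have L: "(\<integral>\<^sup>+t\<in>{0..1}. ennreal (sp t) \<partial>lborel) < ennreal \<epsilon>"
    using len unfolding path_len_def sp_def .
  \<comment> \<open>The velocity is written in the frame; the norm of its components
    \<open>a\<close> is the speed.\<close>
  have sp: "\<exists>a. D u = frame_matrix c (\<zeta> u) *v a \<and> sp u = norm a" if u: "u \<in> {0<..<t} - S" for u
  proof -
    have u': "u \<in> {0..t}" "u \<in> {0..1}" "u \<in> {0..t} - S" using u t by auto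
    have gu: "\<gamma> u \<in> fst c" "\<gamma> u \<in> Y" using inC inY u' by blast+
    have "velocity M \<gamma> u = coord_tvec M (restr Y c) (snd c (\<gamma> u)) (D u)"
      by (rule velocity_eq_coord_tvec[OF c, of "{0<..<t}"])
        (use u inC gu D(1)[OF u'(3)] in \<open>auto simp: \<zeta>_def\<close>)
    then have "sp u = norm (matrix_inv (frame_matrix c (snd c (\<gamma> u))) *v D u)"
      unfolding sp_def using speed_coord[OF c gu] by simp
    moreover have "D u = frame_matrix c (\<zeta> u) *v (matrix_inv (frame_matrix c (snd c (\<gamma> u))) *v D u)"
      using frame_inv(2)[OF c gu] by (simp add: \<zeta>_def)
    ultimately show ?thesis by blast
  qed
  have \<zeta>C: "\<zeta> u \<in> C" "\<zeta> u \<in> snd c ` fst c" "\<sigma> (\<zeta> u) \<noteq> 0" if "u \<in> {0..t}" for u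
    using inC[OF that] Y_iff[OF c, of "\<gamma> u"] inY[of u] that t unfolding \<zeta>_def \<sigma>_def by auto
  have "norm (\<zeta> t - \<zeta> 0) \<le> K * \<epsilon>"
  proof (rule displacement_le_length[OF _ t(1,2) cont S _ _ _ K(1) L \<epsilon>])
    show "(\<zeta> has_vector_derivative D u) (at u)" if "u \<in> {0<..<t} - S" for u
      by (rule D(1)) (use that in auto)
    show "continuous_on ({0<..<t} - S) D"
      by (rule continuous_on_subset[OF D(2)]) auto
    show "norm (D u) \<le> K * sp u" if u: "u \<in> {0<..<t} - S" for u
    proof -
      have "u \<in> {0..t}" using u by auto
      then show ?thesis using sp[OF u] K(2)[OF \<zeta>C(1)[of u]] by auto
    qed
  qed simp
  then show "norm (snd c (\<gamma> t) - snd c (\<gamma> 0)) \<le> K * \<epsilon>" by (simp add: \<zeta>_def)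
  define \<phi> where "\<phi> u = ln ((cmod (\<sigma> (\<zeta> u)))\<^sup>2)" for u
  define \<phi>' where "\<phi>' u = 2 * Re (dd \<sigma> (\<zeta> u) (D u) / \<sigma> (\<zeta> u))" for u
  have c\<sigma>: "continuous_on {0..t} (\<lambda>u. \<sigma> (\<zeta> u))"
    by (rule continuous_on_compose2[OF hol_continuous_on[OF \<sigma>h] cont]) (use \<zeta>C(2) in blast)
  \<comment> \<open>The constant doubles because the logarithm is taken of a square.\<close>
  have "norm (\<phi> t - \<phi> 0) \<le> (2 * K) * \<epsilon>"
  proof (rule displacement_le_length[OF _ t(1,2) _ S _ _ _ _ L \<epsilon>])
    show "continuous_on {0..t} \<phi>"
      unfolding \<phi>_def by (intro continuous_intros c\<sigma>) (use \<zeta>C(3) in auto)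
    show "(\<phi> has_vector_derivative \<phi>' u) (at u)" if u: "u \<in> {0<..<t} - S" for u
    proof -
      have u': "u \<in> {0..t}" "u \<in> {0..t} - S" using u by auto
      have "((\<lambda>u. \<sigma> (\<zeta> u)) has_derivative (\<lambda>h. dd \<sigma> (\<zeta> u) (h *\<^sub>R D u))) (at u)"
        by (rule has_derivative_compose[OF D(1)[OF u'(2), unfolded has_vector_derivative_def]
            hol_has_derivative[OF \<sigma>h \<zeta>C(2)[OF u'(1)]]])
      moreover have "Re (h *\<^sub>R x / y) = h * Re (x / y)" for h x y
      proof -
        have "h *\<^sub>R x / y = h *\<^sub>R (x / y)" by (simp add: scaleR_conv_of_real)
        then show ?thesis by (simp only: scaleR_complex.sel)
      qed
      moreover note has_derivative_ln_cmod[OF calculation(1) \<zeta>C(3)[OF u'(1)]]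
      ultimately show ?thesis
        unfolding \<phi>_def \<phi>'_def has_vector_derivative_def
          has_derivative_dd_scaleR[OF hol_differentiable[OF \<sigma>h \<zeta>C(2)[OF u'(1)]]]
        by (simp add: mult_ac)
    qed
    show "continuous_on ({0<..<t} - S) \<phi>'"
      unfolding \<phi>'_def
    proof (intro continuous_on_mult continuous_on_const continuous_on_Re continuous_on_divide)
      show "continuous_on ({0<..<t} - S) (\<lambda>u. dd \<sigma> (\<zeta> u) (D u))"
      proof (rule continuous_on_dd_apply[OF \<sigma>h coords_open[OF c]])
        show "continuous_on ({0<..<t} - S) \<zeta>" by (rule continuous_on_subset[OF cont]) auto
        show "continuous_on ({0<..<t} - S) D" by (rule continuous_on_subset[OF D(2)]) auto
        show "\<zeta> u \<in> snd c ` fst c" if "u \<in> {0<..<t} - S" for u by (rule \<zeta>C(2)) (use that in auto)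
      qed
      show "continuous_on ({0<..<t} - S) (\<lambda>u. \<sigma> (\<zeta> u))" by (rule continuous_on_subset[OF c\<sigma>]) auto
      show "\<forall>u\<in>{0<..<t} - S. \<sigma> (\<zeta> u) \<noteq> 0" using \<zeta>C(3) by auto
    qed
    show "norm (\<phi>' u) \<le> 2 * K * sp u" if u: "u \<in> {0<..<t} - S" for u
    proof -
      have u': "u \<in> {0..t}" using u by auto
      obtain a where a: "D u = frame_matrix c (\<zeta> u) *v a" "sp u = norm a" using sp[OF u] by blast
      have "norm (\<phi>' u) \<le> 2 * cmod (dd \<sigma> (\<zeta> u) (D u) / \<sigma> (\<zeta> u))"
        unfolding \<phi>'_def by (simp add: abs_mult abs_Re_le_cmod del: times_divide_eq_right)
      \<comment> \<open>The bound on the derivative carries the factor |\<sigma>|, which cancels the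
        denominator however small \<sigma> is.\<close>
      also have "\<dots> \<le> 2 * (K * norm a)"
      proof -
        have "cmod (dd \<sigma> (\<zeta> u) (D u)) \<le> K * norm a * cmod (\<sigma> (\<zeta> u))"
          using K(3)[OF \<zeta>C(1)[OF u'], of a] unfolding a \<sigma>_def .
        then show ?thesis using \<zeta>C(3)[OF u'] by (simp add: norm_divide divide_le_eq)
      qed
      finally show ?thesis by (simp add: a)
    qed
  qed (use K in auto)
  then show "\<bar>ln ((cmod (det (frame_matrix c (snd c (\<gamma> t)))))\<^sup>2) - ln ((cmod (det (frame_matrix c (snd c (\<gamma> 0)))))\<^sup>2)\<bar>
      \<le> 2 * K * \<epsilon>"
    by (simp add: \<phi>_def \<sigma>_def \<zeta>_def)
qed

lemma path_in_Y: "pw_C1_path M \<gamma> \<Longrightarrow> u \<in> {0..1} \<Longrightarrow> \<gamma> u \<in> Y"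
  unfolding pw_C1_path_def pathin_def continuous_map_def by (auto simp: open_submfd_def)

lemma path_continuous:
  "pw_C1_path M \<gamma> \<Longrightarrow> continuous_map (top_of_set {0..1}) (mtop X) \<gamma>"
  unfolding pw_C1_path_def pathin_def by (simp add: open_submfd_def continuous_map_in_subtopology)

text \<open>First-exit argument. As long as a path of length below \<epsilon> stays in the
  coordinate ball of radius \<open>2 * r\<close>, the inside estimate confines it to the closed ball
  of radius \<open>r\<close> around its start. This ball lies in the open ball of radius
  \<open>2 * r\<close>, so the path never exits.\<close>

lemma short_path_estimate:
  assumes c: "c \<in> atlas X" and p: "p \<in> fst c" "dist z0 (snd c p) < r"
    and ball: "cball z0 (2 * r) \<subseteq> snd c ` fst c"
    and K: "K > 0" "\<And>z a. z \<in> cball z0 (2 * r) \<Longrightarrow> norm (frame_matrix c z *v a) \<le> K * norm a"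
      "\<And>z a. z \<in> cball z0 (2 * r) \<Longrightarrow> cmod (dd (\<lambda>z. det (frame_matrix c z)) z (frame_matrix c z *v a))
         \<le> K * norm a * cmod (det (frame_matrix c z))"
    and \<epsilon>: "0 \<le> \<epsilon>" "K * \<epsilon> \<le> r" and d: "metric_dist M frame_metric p q < ennreal \<epsilon>"
  shows "q \<in> fst c" "q \<in> Y" "norm (snd c q - snd c p) \<le> K * \<epsilon>"
    "\<bar>ln ((cmod (det (frame_matrix c (snd c q))))\<^sup>2) - ln ((cmod (det (frame_matrix c (snd c p))))\<^sup>2)\<bar> \<le> 2 * K * \<epsilon>"
proof -
  obtain \<gamma> where \<gamma>: "pw_C1_path M \<gamma>" "\<gamma> 0 = p" "\<gamma> 1 = q" and len: "path_len M frame_metric \<gamma> < ennreal \<epsilon>"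
    using d unfolding metric_dist_def INF_less_iff by blast
  note inY = path_in_Y[OF \<gamma>(1)]
  define U where "U = {x \<in> fst c. snd c x \<in> ball z0 (2 * r)}"
  have Uopen: "openin (mtop X) U" unfolding U_def by (rule open_preimage[OF c]) simp
  have r: "0 < r" using p(2) by (meson dist_pos_lt le_less_trans zero_le_dist)
  have pU: "p \<in> U" using p r by (simp add: U_def)
  have est: "norm (snd c (\<gamma> t) - snd c p) \<le> K * \<epsilon>"
    "\<bar>ln ((cmod (det (frame_matrix c (snd c (\<gamma> t)))))\<^sup>2) - ln ((cmod (det (frame_matrix c (snd c p))))\<^sup>2)\<bar> \<le> 2 * K * \<epsilon>"
    if t: "0 \<le> t" "t \<le> 1" and inU: "\<And>u. u \<in> {0..t} \<Longrightarrow> \<gamma> u \<in> U" for t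
  proof -
    have "\<gamma> u \<in> fst c \<and> snd c (\<gamma> u) \<in> cball z0 (2 * r)" if "u \<in> {0..t}" for u
      using inU[OF that] by (simp add: U_def)
    from short_path_estimate_inside[OF c \<gamma>(1) t inY this K len \<epsilon>(1)]
    show "norm (snd c (\<gamma> t) - snd c p) \<le> K * \<epsilon>"
      "\<bar>ln ((cmod (det (frame_matrix c (snd c (\<gamma> t)))))\<^sup>2) - ln ((cmod (det (frame_matrix c (snd c p))))\<^sup>2)\<bar> \<le> 2 * K * \<epsilon>"
      unfolding \<gamma>(2) by blast+
  qed
  \<comment> \<open>The times spent outside \<open>U\<close>. They form a closed set, so if there
    are any, there is a first one.\<close>
  define B where "B = {t \<in> {0..1}. \<gamma> t \<notin> U}"
  have "B = {}"
  proof (rule ccontr)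
    assume "B \<noteq> {}"
    have "openin (top_of_set {0..1}) {t \<in> {0..1}. \<gamma> t \<in> U}"
      using openin_continuous_map_preimage[OF path_continuous[OF \<gamma>(1)] Uopen] by simp
    from closedin_diff[OF closedin_topspace this]
    have "closedin (top_of_set {0..1}) ({0..1} - {t \<in> {0..1}. \<gamma> t \<in> U})" by simp
    moreover have "{0..1} - {t \<in> {0..1}. \<gamma> t \<in> U} = B" by (auto simp: B_def)
    ultimately have "closed B" by (simp add: closedin_closed_eq)
    have bdd: "bdd_below B" unfolding B_def by (rule bdd_belowI[of _ 0]) auto
    define \<tau> where "\<tau> = Inf B"
    have \<tau>B: "\<tau> \<in> B" unfolding \<tau>_def by (rule closed_contains_Inf[OF \<open>B \<noteq> {}\<close> bdd \<open>closed B\<close>])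
    have before: "\<gamma> u \<in> U" if "0 \<le> u" "u < \<tau>" for u
    proof (rule ccontr)
      assume "\<gamma> u \<notin> U"
      then have "u \<in> B" using that \<tau>B by (auto simp: B_def)
      then show False using cInf_lower[OF _ bdd] that unfolding \<tau>_def by fastforce
    qed
    have \<tau>: "0 < \<tau>" "\<tau> \<le> 1"
      using \<tau>B \<gamma>(2) pU unfolding B_def by (auto simp: less_le)
    define C where "C = cball (snd c p) r"
    have Csub: "C \<subseteq> ball z0 (2 * r)"
    proof
      fix z assume "z \<in> C"
      then show "z \<in> ball z0 (2 * r)"
        using p(2) dist_triangle[of z0 z "snd c p"] by (simp add: C_def)
    qed
    then have Cim: "C \<subseteq> snd c ` fst c" using ball ball_subset_cball by blast
    \<comment> \<open>At time \<tau> the path is not yet known to be in the chart. The points of the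
      chart with coordinates in \<open>C\<close> form a compact set, which is closed in the
      Hausdorff space \<open>X\<close> and therefore contains the limit
      \<open>\<gamma> \<tau>\<close>.\<close>
    have "compactin (mtop X) (chart_inv c ` C)"
    proof (rule image_compactin[OF _ chart_inv_continuous[OF c]])
      show "compactin (top_of_set (snd c ` fst c)) C"
        using Cim by (simp add: compactin_subtopology C_def)
    qed
    then have "closedin (mtop X) (chart_inv c ` C)"
      using compactin_imp_closedin cm unfolding complex_manifold_def by blast
    from closedin_continuous_map_preimage[OF path_continuous[OF \<gamma>(1)] this]
    have "closedin (top_of_set {0..1}) {t \<in> {0..1}. \<gamma> t \<in> chart_inv c ` C}" by simp
    then have cl: "closed {t \<in> {0..1}. \<gamma> t \<in> chart_inv c ` C}"
      by (simp add: closedin_closed_eq)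
    have "{0..<\<tau>} \<subseteq> {t \<in> {0..1}. \<gamma> t \<in> chart_inv c ` C}"
    proof
      fix t assume t: "t \<in> {0..<\<tau>}"
      then have "norm (snd c (\<gamma> t) - snd c p) \<le> K * \<epsilon>"
        using \<tau> before by (intro est(1)) auto
      then have "snd c (\<gamma> t) \<in> C" using \<epsilon>(2) by (simp add: C_def dist_norm norm_minus_commute)
      moreover have "\<gamma> t \<in> fst c" using before t by (simp add: U_def)
      ultimately show "t \<in> {t \<in> {0..1}. \<gamma> t \<in> chart_inv c ` C}"
        using t \<tau> chart_inv_left[OF c, of "\<gamma> t"] by (auto intro: rev_image_eqI)
    qed
    then have "closure {0..<\<tau>} \<subseteq> {t \<in> {0..1}. \<gamma> t \<in> chart_inv c ` C}"
      by (rule closure_minimal[OF _ cl])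
    moreover have "\<tau> \<in> closure {0..<\<tau>}" using \<tau>(1) by simp
    ultimately have "\<tau> \<in> {t \<in> {0..1}. \<gamma> t \<in> chart_inv c ` C}" by (rule subsetD)
    then obtain z where z: "z \<in> C" "\<gamma> \<tau> = chart_inv c z" by blast
    have "z \<in> snd c ` fst c" using z(1) Cim by blast
    note zi = chart_inv_in[OF this] chart_inv_right[OF this]
    have "z \<in> ball z0 (2 * r)" using Csub z(1) by blast
    then have "\<gamma> \<tau> \<in> U" unfolding U_def z(2) by (simp add: zi)
    then show False using \<tau>B by (simp add: B_def)
  qed
  then have inU: "\<gamma> u \<in> U" if "u \<in> {0..1}" for u using that unfolding B_def by blast
  show "q \<in> fst c" "q \<in> Y" using inU[of 1] inY[of 1] \<gamma>(3) by (auto simp: U_def)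
  show "norm (snd c q - snd c p) \<le> K * \<epsilon>"
    "\<bar>ln ((cmod (det (frame_matrix c (snd c q))))\<^sup>2) - ln ((cmod (det (frame_matrix c (snd c p))))\<^sup>2)\<bar> \<le> 2 * K * \<epsilon>"
    using est[of 1] inU \<gamma>(3) by auto
qed

text \<open>The straight coordinate segment is the test path; the inverse frame matrix controls its
  speed. Near a point of \<open>Y\<close> this turns convergence in coordinates into convergence in
  the metric.\<close>

lemma metric_dist_le_coord_dist:
  assumes c: "c \<in> atlas X" and p: "p \<in> fst c" "p \<in> Y" and q: "q \<in> fst c" "q \<in> Y"
    and C: "convex C" "C \<subseteq> snd c ` (fst c \<inter> Y)" "snd c p \<in> C" "snd c q \<in> C"
    and K: "\<And>z a. z \<in> C \<Longrightarrow> norm (matrix_inv (frame_matrix c z) *v a) \<le> K * norm a"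
  shows "metric_dist M frame_metric p q \<le> ennreal (K * norm (snd c q - snd c p))"
proof -
  \<comment> \<open>\<open>l\<close> runs over the whole real line, so that the derivatives at the
    end points 0 and 1 are two-sided, as \<open>velocity\<close> and \<open>pw_C1_path\<close>
    demand.\<close>
  define l where "l = (\<lambda>t::real. snd c p + t *\<^sub>R (snd c q - snd c p))"
  define \<gamma> where "\<gamma> = (\<lambda>t. chart_inv c (l t))"
  let ?v = "snd c q - snd c p"
  have lder: "(l has_vector_derivative ?v) (at t)" for t
    unfolding l_def has_vector_derivative_def by (auto intro!: derivative_eq_intros)
  have lcont: "continuous_on A l" for A unfolding l_def by (intro continuous_intros)
  have lC: "l t \<in> C" if "t \<in> {0..1}" for t
  proof -
    have "(1 - t) *\<^sub>R snd c p + t *\<^sub>R snd c q \<in> C"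
      using that by (intro convexD_alt[OF C(1,3,4)]) auto
    moreover have "l t = (1 - t) *\<^sub>R snd c p + t *\<^sub>R snd c q" by (simp add: l_def algebra_simps)
    ultimately show ?thesis by simp
  qed
  have l\<gamma>: "\<gamma> t \<in> fst c" "\<gamma> t \<in> Y" "snd c (\<gamma> t) = l t" if lt: "l t \<in> snd c ` (fst c \<inter> Y)" for t
  proof -
    obtain x where "x \<in> fst c" "x \<in> Y" "l t = snd c x" using lt by blast
    then show "\<gamma> t \<in> fst c" "\<gamma> t \<in> Y" "snd c (\<gamma> t) = l t" by (simp_all add: \<gamma>_def chart_inv_left[OF c])
  qed
  have in01: "l t \<in> snd c ` (fst c \<inter> Y)" if "t \<in> {0..1}" for t using lC[OF that] C(2) by blast
  have open_l: "open (l -` U)" if "open U" for U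
    using continuous_open_preimage[OF lcont open_UNIV that] by simp
  have "pw_C1_path M \<gamma>"
    unfolding pw_C1_path_def
  proof (intro conjI ballI allI impI)
    have "continuous_map (top_of_set {0..1}) (top_of_set (snd c ` fst c)) l"
    proof -
      have "l ` {0..1} \<subseteq> snd c ` fst c" using in01 by blast
      then show ?thesis
        using lcont by (simp add: continuous_map_in_subtopology image_subset_iff_funcset)
    qed
    from continuous_map_compose[OF this chart_inv_continuous[OF c]]
    have "continuous_map (top_of_set {0..1}) (mtop X) \<gamma>" by (simp add: \<gamma>_def o_def)
    then show "pathin (mtop M) \<gamma>"
      unfolding pathin_def using l\<gamma>(2)[OF in01] by (auto simp: open_submfd_def continuous_map_in_subtopology)
  next
    fix d' a b assume "d' \<in> atlas M" and ab: "0 \<le> a \<and> b \<le> 1 \<and> \<gamma> ` {a..b} \<subseteq> fst d'"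
    then obtain d where d: "d \<in> atlas X" "d' = restr Y d" unfolding atlas_M by blast
    let ?f = "snd d \<circ> chart_inv c" and ?S = "snd c ` (fst c \<inter> fst d)"
    note hf = transition_holo[OF c d(1)]
    have S: "open ?S" by (rule open_coords[OF c chart_openin[OF d(1)]])
    have lS: "l x \<in> ?S" if "x \<in> {a..b}" for x
    proof -
      have x: "x \<in> {0..1}" using that ab by auto
      have "\<gamma> x \<in> fst d" using that ab d(2) by auto
      then show ?thesis using l\<gamma>(1,3)[OF in01[OF x]] by (metis IntI imageI)
    qed
    have "(snd d' \<circ> \<gamma>) C1_differentiable_on {a..b}"
      unfolding C1_differentiable_on_def
    proof (intro exI conjI ballI)
      fix x assume x: "x \<in> {a..b}"
      have "((\<lambda>x. ?f (l x)) has_derivative (\<lambda>h. dd ?f (l x) (h *\<^sub>R ?v))) (at x)"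
        by (rule has_derivative_compose[OF lder[unfolded has_vector_derivative_def]
            holo_on_has_derivative[OF hf lS[OF x]]])
      then show "((snd d' \<circ> \<gamma>) has_vector_derivative dd ?f (l x) ?v) (at x)"
        unfolding has_vector_derivative_def has_derivative_dd_scaleR[OF holo_on_differentiable[OF hf lS[OF x]]]
        by (simp add: d(2) \<gamma>_def o_def)
    next
      show "continuous_on {a..b} (\<lambda>x. dd ?f (l x) ?v)"
      proof (rule continuous_on_vecI)
        fix i
        have "hol (\<lambda>z. ?f z $ i) ?S" for i using hf unfolding holo_on_iff_hol by blast
        from hol_continuous_on[OF hol_vec_dd[OF this S]]
        show "continuous_on {a..b} (\<lambda>x. dd ?f (l x) ?v $ i)"
          by (rule continuous_on_compose2[OF _ lcont]) (use lS in blast)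
      qed
    qed
    then show "(snd d' \<circ> \<gamma>) piecewise_C1_differentiable_on {a..b}" by (rule C1_differentiable_imp_piecewise)
  qed
  moreover have "\<gamma> 0 = p" "\<gamma> 1 = q" by (simp_all add: \<gamma>_def l_def chart_inv_left[OF c] p q)
  ultimately have "metric_dist M frame_metric p q \<le> path_len M frame_metric \<gamma>"
    unfolding metric_dist_def by (intro INF_lower) blast
  also have "\<dots> \<le> (\<integral>\<^sup>+t\<in>{0..1}. ennreal (K * norm ?v) \<partial>(lborel::real measure))"
    unfolding path_len_def
  proof (rule nn_integral_mono)
    fix t :: real
    show "ennreal (sqrt (Re (frame_metric (\<gamma> t) (velocity M \<gamma> t) (velocity M \<gamma> t)))) * indicator {0..1} t
      \<le> ennreal (K * norm ?v) * indicator {0..1} t"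
    proof (cases "t \<in> {0..1}")
      case True
      note t = in01[OF True]
      let ?S = "l -` (snd c ` (fst c \<inter> Y))"
      have "velocity M \<gamma> t = coord_tvec M (restr Y c) (snd c (\<gamma> t)) ?v"
      proof (rule velocity_eq_coord_tvec[OF c open_l[OF coords_Y_open[OF c]]])
        show "t \<in> ?S" using t by simp
        show "\<gamma> u \<in> fst c" if "u \<in> ?S" for u using l\<gamma>(1) that by simp
        show "\<gamma> t \<in> Y" by (rule l\<gamma>(2)[OF t])
        show "((snd c \<circ> \<gamma>) has_vector_derivative ?v) (at t)"
          unfolding has_vector_derivative_def
          by (rule has_derivative_transform_within_open[OF lder[unfolded has_vector_derivative_def]
                open_l[OF coords_Y_open[OF c]]]) (use t l\<gamma>(3) in simp_all)
      qed
      then have "sqrt (Re (frame_metric (\<gamma> t) (velocity M \<gamma> t) (velocity M \<gamma> t)))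
          = norm (matrix_inv (frame_matrix c (l t)) *v ?v)"
        using speed_coord[OF c l\<gamma>(1,2)[OF t]] l\<gamma>(3)[OF t] by simp
      also have "\<dots> \<le> K * norm ?v" by (rule K[OF lC[OF True]])
      finally show ?thesis using True by (simp add: ennreal_leI)
    qed simp
  qed
  also have "\<dots> = ennreal (K * norm ?v)"
    by (simp add: nn_integral_cmult_indicator)
  finally show ?thesis .
qed

text \<open>The estimate on the derivatives of the frame determinant along the frame says that its logarithm
  is Lipschitz for the frame metric, so that the zero divisor is infinitely far away.\<close>

lemma complete_frame_metric:
  assumes compact: "compact_space (mtop X)"
    and log_bound: "\<And>c z0. c \<in> atlas X \<Longrightarrow> z0 \<in> snd c ` fst c \<Longrightarrow> \<exists>r>0. \<exists>B. \<forall>z\<in>cball z0 r. \<forall>a.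
      cmod (dd (\<lambda>z. det (frame_matrix c z)) z (frame_matrix c z *v a)) \<le> B * norm a * cmod (det (frame_matrix c z))"
  shows "complete_metric M frame_metric"
  unfolding complete_metric_def
proof (intro allI impI, elim conjE)
  fix x :: "nat \<Rightarrow> 'a"
  assume "range x \<subseteq> points M" and cauchy: "\<forall>e>0. \<exists>N. \<forall>k\<ge>N. \<forall>l\<ge>N. metric_dist M frame_metric (x k) (x l) < e"
  then have xY: "x k \<in> Y" for k unfolding points_M by blast
  \<comment> \<open>A cluster point \<open>q\<close>. If there were none, the open sets that the
    sequence eventually avoids would cover \<open>X\<close>; a finite subcover and an index beyond
    all its thresholds, here their sum, give a contradiction.\<close>
  have "\<exists>q\<in>points X. \<forall>U. openin (mtop X) U \<and> q \<in> U \<longrightarrow> (\<forall>N. \<exists>k\<ge>N. x k \<in> U)"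
  proof (rule ccontr)
    assume "\<not> ?thesis"
    then have *: "\<forall>q\<in>points X. \<exists>U N. openin (mtop X) U \<and> q \<in> U \<and> (\<forall>k\<ge>N. x k \<notin> U)" by simp
    define \<U> where "\<U> = {U. openin (mtop X) U \<and> (\<exists>N. \<forall>k\<ge>N. x k \<notin> U)}"
    have "(\<forall>U\<in>\<U>. openin (mtop X) U) \<and> topspace (mtop X) \<subseteq> \<Union>\<U>"
      using * unfolding \<U>_def points_def by blast
    then obtain \<F> where F: "finite \<F>" "\<F> \<subseteq> \<U>" "topspace (mtop X) \<subseteq> \<Union>\<F>"
      using compact unfolding compact_space_alt by meson
    have "\<forall>U\<in>\<F>. \<exists>N. \<forall>k\<ge>N. x k \<notin> U" using F(2) unfolding \<U>_def by blast
    then obtain N where N: "\<And>U k. U \<in> \<F> \<Longrightarrow> k \<ge> N U \<Longrightarrow> x k \<notin> U" by metis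
    define m where "m = (\<Sum>U\<in>\<F>. N U)"
    have "x m \<in> topspace (mtop X)" using Y_points[OF xY[of m]] by (simp add: points_def)
    then obtain U where U: "U \<in> \<F>" "x m \<in> U" using F(3) by blast
    have "N U \<le> m" unfolding m_def by (rule member_le_sum[OF U(1) _ F(1)]) simp
    then show False using N U by blast
  qed
  then obtain q where qX: "q \<in> points X"
    and q: "\<And>U N. openin (mtop X) U \<Longrightarrow> q \<in> U \<Longrightarrow> \<exists>k\<ge>N. x k \<in> U" by blast
  obtain c where c: "c \<in> atlas X" "q \<in> fst c" using ex_chart[OF qX] by blast
  define z0 where "z0 = snd c q"
  have z0: "z0 \<in> snd c ` fst c" using c by (simp add: z0_def)
  define \<sigma> where "\<sigma> = (\<lambda>z. det (frame_matrix c z))"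
  have \<sigma>h: "hol \<sigma> (snd c ` fst c)" unfolding \<sigma>_def by (rule hol_det[OF frame_matrix_hol[OF c(1)]])
  obtain R0 where R0: "R0 > 0" "cball z0 R0 \<subseteq> snd c ` fst c"
    using coords_open[OF c(1)] z0 open_contains_cball by blast
  obtain R1 B where R1: "R1 > 0" and B: "\<And>z a. z \<in> cball z0 R1 \<Longrightarrow>
      cmod (dd \<sigma> z (frame_matrix c z *v a)) \<le> B * norm a * cmod (\<sigma> z)"
    using log_bound[OF c(1) z0] unfolding \<sigma>_def by blast
  \<comment> \<open>Half of the radius, since \<open>short_path_estimate\<close> works on the ball
    of radius \<open>2 * r\<close>.\<close>
  define r where "r = min R0 R1 / 2"
  have r: "r > 0" "cball z0 (2 * r) \<subseteq> cball z0 R0" "cball z0 (2 * r) \<subseteq> cball z0 R1"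
    using R0(1) R1 by (simp_all add: r_def subset_cball)
  then have ball: "cball z0 (2 * r) \<subseteq> snd c ` fst c" using R0(2) by blast
  have "continuous_on (cball z0 (2 * r)) (\<lambda>z. frame_matrix c z $ i $ j)" for i j
    by (rule continuous_on_subset[OF hol_continuous_on[OF frame_matrix_hol[OF c(1)]] ball])
  from matrix_bounded_on_compact[OF compact_cball this]
  obtain K0 where K0: "K0 > 0" "\<And>z a. z \<in> cball z0 (2 * r) \<Longrightarrow> norm (frame_matrix c z *v a) \<le> K0 * norm a"
    by metis
  define K where "K = max K0 B"
  have K: "K > 0" "K0 \<le> K" "B \<le> K" using K0(1) by (simp_all add: K_def)
  have K1: "norm (frame_matrix c z *v a) \<le> K * norm a" if "z \<in> cball z0 (2 * r)" for z a
    using K0(2)[OF that, of a] mult_right_mono[OF K(2), of "norm a"] by simp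
  have K2: "cmod (dd (\<lambda>z. det (frame_matrix c z)) z (frame_matrix c z *v a)) \<le> K * norm a * cmod (det (frame_matrix c z))"
    if "z \<in> cball z0 (2 * r)" for z a
    using B[of z a] that r(3) mult_right_mono[OF K(3), of "norm a * cmod (\<sigma> z)"] unfolding \<sigma>_def
    by (fastforce simp: mult.assoc)
  define V where "V e = {x \<in> fst c. snd c x \<in> ball z0 e}" for e
  have V: "openin (mtop X) (V e)" "q \<in> V e" if "e > 0" for e
    using open_preimage[OF c(1), of "ball z0 e"] c(2) that by (simp_all add: V_def z0_def)
  \<comment> \<open>The point \<open>q\<close> may still lie on the divisor: \<open>K\<close> is
    valid on a full ball around \<open>z0\<close>. One late term close to \<open>q\<close> controls
    all late terms.\<close>
  have key: "\<exists>k0 N. snd c (x k0) \<in> ball z0 e \<and> x k0 \<in> fst c \<and> (\<forall>l\<ge>N. x l \<in> fst c \<and> norm (snd c (x l) - snd c (x k0)) \<le> e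
      \<and> \<bar>ln ((cmod (\<sigma> (snd c (x l))))\<^sup>2) - ln ((cmod (\<sigma> (snd c (x k0))))\<^sup>2)\<bar> \<le> 2 * e)" if e: "0 < e" "e \<le> r" for e
  proof -
    define \<epsilon> where "\<epsilon> = e / K"
    have \<epsilon>: "0 < \<epsilon>" "K * \<epsilon> = e" using e K by (simp_all add: \<epsilon>_def)
    obtain N where N: "\<And>k l. k \<ge> N \<Longrightarrow> l \<ge> N \<Longrightarrow> metric_dist M frame_metric (x k) (x l) < ennreal \<epsilon>"
      using cauchy \<epsilon>(1) by (metis ennreal_less_zero_iff)
    obtain k0 where k0: "k0 \<ge> N" "x k0 \<in> V e" using q[OF V[OF e(1)]] by blast
    have k0': "x k0 \<in> fst c" "dist z0 (snd c (x k0)) < e" using k0(2) by (simp_all add: V_def)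
    have "x l \<in> fst c \<and> norm (snd c (x l) - snd c (x k0)) \<le> e
      \<and> \<bar>ln ((cmod (\<sigma> (snd c (x l))))\<^sup>2) - ln ((cmod (\<sigma> (snd c (x k0))))\<^sup>2)\<bar> \<le> 2 * e" if "l \<ge> N" for l
    proof -
      have d: "dist z0 (snd c (x k0)) < r" using k0'(2) e by simp
      have "0 \<le> \<epsilon>" "K * \<epsilon> \<le> r" using \<epsilon> e by simp_all
      note est = short_path_estimate[OF c(1) k0'(1) d ball K(1) K1 K2 this N[OF k0(1) that]]
      show ?thesis
        using est(1,3,4) unfolding \<sigma>_def \<epsilon>(2) mult.assoc by blast
    qed
    then show ?thesis using k0' by (intro exI[of _ k0] exI[of _ N]) auto
  qed
  have qY: "q \<in> Y"
  proof (rule ccontr)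
    assume "q \<notin> Y"
    then have \<sigma>0: "\<sigma> z0 = 0" using Y_iff[OF c] by (simp add: \<sigma>_def z0_def)
    obtain k0 N where k0: "x k0 \<in> fst c"
      "\<And>l. l \<ge> N \<Longrightarrow> x l \<in> fst c \<and> \<bar>ln ((cmod (\<sigma> (snd c (x l))))\<^sup>2) - ln ((cmod (\<sigma> (snd c (x k0))))\<^sup>2)\<bar> \<le> 2 * r"
      using key[OF r(1) order_refl] by blast
    \<comment> \<open>By the logarithmic estimate, |\<sigma>|^2 stays above this positive constant
      along the tail, which however returns arbitrarily close to the zero \<open>z0\<close> of
      \<sigma>.\<close>
    define \<delta> where "\<delta> = exp (ln ((cmod (\<sigma> (snd c (x k0))))\<^sup>2) - 2 * r)"
    have big: "\<delta> \<le> (cmod (\<sigma> (snd c (x l))))\<^sup>2" if "l \<ge> N" for l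
    proof -
      have "\<sigma> (snd c (x l)) \<noteq> 0" using Y_iff[OF c(1), of "x l"] xY k0(2)[OF that] by (simp add: \<sigma>_def)
      then have pos: "0 < (cmod (\<sigma> (snd c (x l))))\<^sup>2" by simp
      have "\<delta> \<le> exp (ln ((cmod (\<sigma> (snd c (x l))))\<^sup>2))"
        unfolding \<delta>_def using conjunct2[OF k0(2)[OF that]] by (simp add: abs_le_iff)
      then show ?thesis using pos by simp
    qed
    have "continuous (at z0) (\<lambda>z. (cmod (\<sigma> z))\<^sup>2)"
      by (intro continuous_intros) (meson \<sigma>h z0 hol_differentiable differentiable_imp_continuous_within)
    then have "\<forall>e>0. \<exists>d>0. \<forall>z. dist z z0 < d \<longrightarrow> dist ((cmod (\<sigma> z))\<^sup>2) ((cmod (\<sigma> z0))\<^sup>2) < e"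
      unfolding continuous_at_eps_delta .
    moreover have "\<delta> > 0" by (simp add: \<delta>_def)
    ultimately obtain d where d: "d > 0" "\<And>z. dist z z0 < d \<Longrightarrow> (cmod (\<sigma> z))\<^sup>2 < \<delta>"
      using \<sigma>0 by (force simp: dist_real_def)
    obtain l where "l \<ge> N" "x l \<in> V d" using q[OF V[OF d(1)]] by blast
    then show False using big[of l] d(2)[of "snd c (x l)"] by (simp add: V_def dist_commute)
  qed
  have z0Y: "z0 \<in> snd c ` (fst c \<inter> Y)" using qY c by (simp add: z0_def)
  obtain \<rho> where \<rho>: "\<rho> > 0" "cball z0 \<rho> \<subseteq> snd c ` (fst c \<inter> Y)"
    using coords_Y_open[OF c(1)] z0Y open_contains_cball by blast
  have "continuous_on (cball z0 \<rho>) (\<lambda>z. matrix_inv (frame_matrix c z) $ i $ j)" for i j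
    by (rule continuous_on_subset[OF hol_continuous_on[OF frame_matrix_inv_hol[OF c(1)]] \<rho>(2)])
  from matrix_bounded_on_compact[OF compact_cball this]
  obtain L where L: "L > 0" "\<And>z a. z \<in> cball z0 \<rho> \<Longrightarrow> norm (matrix_inv (frame_matrix c z) *v a) \<le> L * norm a"
    by metis
  have conv: "\<exists>N. \<forall>l\<ge>N. x l \<in> fst c \<and> norm (z0 - snd c (x l)) < e" if "e > 0" for e
  proof -
    \<comment> \<open>One half for the distance from \<open>z0\<close> to the chosen term, one for
      the distance from there to the later terms; \<open>r\<close> keeps \<open>key\<close>
      applicable.\<close>
    define e' where "e' = min r (e / 2)"
    have e': "0 < e'" "e' \<le> r" "2 * e' \<le> e" using r that by (simp_all add: e'_def min_def)
    obtain k0 N where k0: "snd c (x k0) \<in> ball z0 e'"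
      "\<And>l. l \<ge> N \<Longrightarrow> x l \<in> fst c \<and> norm (snd c (x l) - snd c (x k0)) \<le> e'"
      using key[OF e'(1,2)] by blast
    have "norm (z0 - snd c (x l)) < e" if "l \<ge> N" for l
      using k0(1) k0(2)[OF that] e'(3) norm_triangle_ineq[of "z0 - snd c (x k0)" "snd c (x k0) - snd c (x l)"]
      by (simp add: dist_norm norm_minus_commute)
    then show ?thesis using k0(2) by blast
  qed
  have "(\<lambda>k. metric_dist M frame_metric (x k) q) \<longlonglongrightarrow> 0"
  proof (rule tendsto_sandwich[OF _ _ tendsto_const])
    obtain N where N: "\<And>l. l \<ge> N \<Longrightarrow> x l \<in> fst c \<and> norm (z0 - snd c (x l)) < \<rho>" using conv[OF \<rho>(1)] by blast
    have "metric_dist M frame_metric (x k) q \<le> ennreal (L * norm (z0 - snd c (x k)))" if "k \<ge> N" for k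
      unfolding z0_def
      by (rule metric_dist_le_coord_dist[OF c(1) _ xY c(2) qY convex_cball \<rho>(2) _ _ L(2)])
        (use N[OF that] \<rho> in \<open>simp_all add: z0_def dist_norm\<close>)
    then show "\<forall>\<^sub>F k in sequentially. metric_dist M frame_metric (x k) q \<le> ennreal (L * norm (z0 - snd c (x k)))"
      unfolding eventually_sequentially by blast
    have "(\<lambda>k. norm (z0 - snd c (x k))) \<longlonglongrightarrow> 0"
      unfolding lim_sequentially using conv by (simp add: dist_real_def) meson
    then have "(\<lambda>k. L * norm (z0 - snd c (x k))) \<longlonglongrightarrow> L * 0" by (intro tendsto_intros)
    then show "(\<lambda>k. ennreal (L * norm (z0 - snd c (x k)))) \<longlonglongrightarrow> 0"
      using tendsto_ennrealI by fastforce
  qed simp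
  then show "\<exists>p\<in>points M. (\<lambda>k. metric_dist M frame_metric (x k) p) \<longlonglongrightarrow> 0"
    using qY unfolding points_M by blast
qed

end

section \<open>Holomorphic maps on products\<close>

definition vjoin :: "complex^'m::finite \<Rightarrow> complex^'n::finite \<Rightarrow> complex^('m + 'n)"
  where "vjoin w x = (\<chi> k. case k of Inl i \<Rightarrow> w $ i | Inr j \<Rightarrow> x $ j)"

definition vfst :: "complex^('m::finite + 'n::finite) \<Rightarrow> complex^'m"
  where "vfst u = (\<chi> i. u $ Inl i)"

definition vsnd :: "complex^('m::finite + 'n::finite) \<Rightarrow> complex^'n"
  where "vsnd u = (\<chi> j. u $ Inr j)"

lemma vfst_vjoin [simp]: "vfst (vjoin w x) = w"
  and vsnd_vjoin [simp]: "vsnd (vjoin w x) = x"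
  by (simp_all add: vfst_def vsnd_def vjoin_def vec_eq_iff)

lemma vjoin_eta [simp]: "vjoin (vfst u) (vsnd u) = u"
  by (simp add: vfst_def vsnd_def vjoin_def vec_eq_iff split: sum.split)

lemma vjoin_add: "vjoin (a + b) (c + d) = vjoin a c + vjoin b d"
  and vjoin_scale: "vjoin (k *s a) (k *s c) = k *s vjoin a c"
  by (simp_all add: vjoin_def vec_eq_iff split: sum.split)

lemma bounded_linear_vfst: "bounded_linear (vfst :: complex^('m::finite + 'n::finite) \<Rightarrow> _)"
proof -
  have "linear (vfst :: complex^('m::finite + 'n::finite) \<Rightarrow> _)"
    by (auto intro!: linearI simp: vec_eq_iff vfst_def)
  then show ?thesis by (simp add: linear_conv_bounded_linear)
qed

lemma bounded_linear_vsnd: "bounded_linear (vsnd :: complex^('m::finite + 'n::finite) \<Rightarrow> _)"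
proof -
  have "linear (vsnd :: complex^('m::finite + 'n::finite) \<Rightarrow> _)"
    by (auto intro!: linearI simp: vec_eq_iff vsnd_def)
  then show ?thesis by (simp add: linear_conv_bounded_linear)
qed

lemma has_derivative_vjoin:
  assumes "(f has_derivative f') (at z)" "(g has_derivative g') (at z)"
  shows "((\<lambda>z. vjoin (f z) (g z)) has_derivative (\<lambda>v. vjoin (f' v) (g' v))) (at z)"
proof (rule has_derivative_vec)
  show "((\<lambda>x. vjoin (f x) (g x) $ i) has_derivative (\<lambda>h. vjoin (f' h) (g' h) $ i)) (at z)" for i
    using bounded_linear.has_derivative[OF bounded_linear_vec_nth assms(1)]
      bounded_linear.has_derivative[OF bounded_linear_vec_nth assms(2)]
    by (cases i) (simp_all add: vjoin_def)
qed

lemma continuous_vjoin: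
  assumes "continuous_on A f" "continuous_on A g"
  shows "continuous_on A (\<lambda>z. vjoin (f z) (g z))"
proof (rule continuous_on_vecI)
  show "continuous_on A (\<lambda>z. vjoin (f z) (g z) $ k)" for k
    by (cases k) (simp_all add: vjoin_def continuous_on_component assms)
qed

lemma open_vjoin_slices:
  assumes "open U"
  shows "open {w. vjoin w x \<in> U}" "open {x. vjoin w x \<in> U}"
proof -
  have "open ((\<lambda>w. vjoin w x) -` U)" "open ((\<lambda>x. vjoin w x) -` U)"
    using continuous_open_preimage[OF continuous_vjoin[OF continuous_on_id continuous_on_const] open_UNIV assms]
      continuous_open_preimage[OF continuous_vjoin[OF continuous_on_const continuous_on_id] open_UNIV assms]
    by simp_all
  then show "open {w. vjoin w x \<in> U}" "open {x. vjoin w x \<in> U}" by (simp_all add: vimage_def)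
qed

lemma has_derivative_slice:
  assumes "(f has_derivative D) (at (vjoin w x))"
  shows "((\<lambda>w. f (vjoin w x)) has_derivative (\<lambda>v. D (vjoin v 0))) (at w)"
    and "((\<lambda>x. f (vjoin w x)) has_derivative (\<lambda>v. D (vjoin 0 v))) (at x)"
  using has_derivative_compose[OF has_derivative_vjoin[OF has_derivative_ident has_derivative_const] assms]
    has_derivative_compose[OF has_derivative_vjoin[OF has_derivative_const has_derivative_ident] assms]
  by simp_all

lemma hol_slice:
  assumes "hol f U"
  shows "hol (\<lambda>x. f (vjoin w x)) {x. vjoin w x \<in> U}" "hol (\<lambda>w. f (vjoin w x)) {w. vjoin w x \<in> U}"
proof -
  have 0: "vjoin 0 (\<i> *s v) = \<i> *s vjoin 0 v" "vjoin (\<i> *s v) 0 = \<i> *s vjoin v 0" for v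
    using vjoin_scale[of \<i> 0 v] vjoin_scale[of \<i> v 0] by simp_all
  show "hol (\<lambda>x. f (vjoin w x)) {x. vjoin w x \<in> U}"
    by (rule holI[where D="\<lambda>x v. dd f (vjoin w x) (vjoin 0 v)"])
      (simp_all add: has_derivative_slice hol_has_derivative[OF assms] 0 hol_dd_scale[OF assms])
  show "hol (\<lambda>w. f (vjoin w x)) {w. vjoin w x \<in> U}"
    by (rule holI[where D="\<lambda>w v. dd f (vjoin w x) (vjoin v 0)"])
      (simp_all add: has_derivative_slice hol_has_derivative[OF assms] 0 hol_dd_scale[OF assms])
qed

text \<open>The pair of inverse charts replaces the inverse of the product chart, so that each
  variable can be frozen or moved on its own; \<open>prod_chart_inv\<close> shows that both agree
  over the chart.\<close>

definition coord_map ::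
  "('a \<times> 'b \<Rightarrow> 'c) \<Rightarrow> ('a, 'm::finite) chart \<Rightarrow> ('b, 'n::finite) chart \<Rightarrow> ('c, 'k::finite) chart \<Rightarrow> complex^('m + 'n) \<Rightarrow> complex^'k"
  where "coord_map \<phi> a b c u = snd c (\<phi> (chart_inv a (vfst u), chart_inv b (vsnd u)))"

definition coord_dom ::
  "('a \<times> 'b \<Rightarrow> 'c) \<Rightarrow> ('a, 'm::finite) chart \<Rightarrow> ('b, 'n::finite) chart \<Rightarrow> ('c, 'k::finite) chart \<Rightarrow> (complex^('m + 'n)) set"
  where "coord_dom \<phi> a b c = {u. vfst u \<in> snd a ` fst a \<and> vsnd u \<in> snd b ` fst b \<and>
    \<phi> (chart_inv a (vfst u), chart_inv b (vsnd u)) \<in> fst c}"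

context
  fixes A :: "('a, 'm::finite) mfd" and B :: "('b, 'n::finite) mfd" and C :: "('c, 'k::finite) mfd"
    and \<phi> :: "'a \<times> 'b \<Rightarrow> 'c" and a b c
  assumes A: "complex_manifold A" and B: "complex_manifold B" and C: "complex_manifold C"
    and \<phi>: "holo_map (prod_mfd A B) C \<phi>"
    and a: "a \<in> atlas A" and b: "b \<in> atlas B" and c: "c \<in> atlas C"
begin

interpretation A: cplx_mfd A by (rule cplx_mfd.intro[OF A])
interpretation B: cplx_mfd B by (rule cplx_mfd.intro[OF B])
interpretation C: cplx_mfd C by (rule cplx_mfd.intro[OF C])

lemma coord_dom_open: "open (coord_dom \<phi> a b c)"
proof -
  define W where "W = {u::complex^('m + 'n). vfst u \<in> snd a ` fst a \<and> vsnd u \<in> snd b ` fst b}"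
  have cf: "continuous_on V vfst" and cs: "continuous_on V vsnd" for V :: "(complex^('m + 'n)) set"
    by (rule linear_continuous_on[OF bounded_linear_vfst], rule linear_continuous_on[OF bounded_linear_vsnd])
  have "W = (vfst -` (snd a ` fst a)) \<inter> (vsnd -` (snd b ` fst b))" by (auto simp: W_def)
  then have W: "open W"
    using continuous_open_preimage[OF cf open_UNIV A.coords_open[OF a]]
      continuous_open_preimage[OF cs open_UNIV B.coords_open[OF b]] by (simp add: open_Int)
  have "continuous_map (top_of_set W) (mtop A) (chart_inv a \<circ> vfst)"
    by (rule continuous_map_compose[OF _ A.chart_inv_continuous[OF a]])
      (use cf in \<open>auto simp: continuous_map_in_subtopology W_def\<close>)
  moreover have "continuous_map (top_of_set W) (mtop B) (chart_inv b \<circ> vsnd)"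
    by (rule continuous_map_compose[OF _ B.chart_inv_continuous[OF b]])
      (use cs in \<open>auto simp: continuous_map_in_subtopology W_def\<close>)
  ultimately have "continuous_map (top_of_set W) (prod_topology (mtop A) (mtop B)) (\<lambda>u. (chart_inv a (vfst u), chart_inv b (vsnd u)))"
    by (simp add: continuous_map_pairwise o_def)
  moreover have "continuous_map (prod_topology (mtop A) (mtop B)) (mtop C) \<phi>"
    using \<phi> by (simp add: holo_map_def prod_mfd_def)
  ultimately have "continuous_map (top_of_set W) (mtop C) (\<phi> \<circ> (\<lambda>u. (chart_inv a (vfst u), chart_inv b (vsnd u))))"
    by (rule continuous_map_compose)
  from openin_continuous_map_preimage[OF this C.chart_openin[OF c]]
  have "openin (top_of_set W) {u \<in> W. \<phi> (chart_inv a (vfst u), chart_inv b (vsnd u)) \<in> fst c}" by simp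
  then have "open {u \<in> W. \<phi> (chart_inv a (vfst u), chart_inv b (vsnd u)) \<in> fst c}"
    using W openin_open_eq by blast
  moreover have "{u \<in> W. \<phi> (chart_inv a (vfst u), chart_inv b (vsnd u)) \<in> fst c} = coord_dom \<phi> a b c"
    by (auto simp: W_def coord_dom_def)
  ultimately show ?thesis by simp
qed

lemma prod_chart_inv:
  assumes "h \<in> fst a" "p \<in> fst b"
  shows "chart_inv (prod_chart a b) (vjoin (snd a h) (snd b p)) = (h, p)"
proof -
  have eq: "snd (prod_chart a b) (h, p) = vjoin (snd a h) (snd b p)" for h p
    by (simp add: prod_chart_def vjoin_def)
  have "inj_on (snd (prod_chart a b)) (fst a \<times> fst b)"
  proof (rule inj_onI, clarify)
    fix h p h' p' assume "h \<in> fst a" "p \<in> fst b" "h' \<in> fst a" "p' \<in> fst b"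
      and "snd (prod_chart a b) (h, p) = snd (prod_chart a b) (h', p')"
    then show "h = h' \<and> p = p'"
      unfolding eq using A.chart_inj[OF a] B.chart_inj[OF b] by (metis inj_onD vfst_vjoin vsnd_vjoin)
  qed
  moreover have "fst (prod_chart a b) = fst a \<times> fst b" by (simp add: prod_chart_def)
  ultimately show ?thesis
    unfolding chart_inv_def eq[symmetric] using assms by (simp only: inv_into_f_f mem_Times_iff fst_conv snd_conv)
qed

lemma coord_map_holo: "holo_on (coord_map \<phi> a b c) (coord_dom \<phi> a b c)"
  unfolding holo_on_def
proof
  fix u assume u: "u \<in> coord_dom \<phi> a b c"
  let ?pc = "prod_chart a b"
  have pc: "?pc \<in> atlas (prod_mfd A B)" unfolding prod_mfd_def mfd.simps using a b by blast
  have ev: "chart_inv ?pc u = (chart_inv a (vfst u), chart_inv b (vsnd u)) \<and> u \<in> snd ?pc ` {p \<in> fst ?pc. \<phi> p \<in> fst c}"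
    if uD: "u \<in> coord_dom \<phi> a b c" for u
  proof -
    obtain h p where hp: "h \<in> fst a" "vfst u = snd a h" "p \<in> fst b" "vsnd u = snd b p"
      using uD unfolding coord_dom_def by blast
    have u: "u = vjoin (snd a h) (snd b p)" using vjoin_eta[of u] hp by simp
    have "\<phi> (h, p) \<in> fst c" using uD hp by (simp add: coord_dom_def A.chart_inv_left[OF a] B.chart_inv_left[OF b])
    then have "u \<in> snd ?pc ` {p \<in> fst ?pc. \<phi> p \<in> fst c}"
      by (intro image_eqI[of _ _ "(h, p)"]) (use hp u in \<open>simp_all add: prod_chart_def vjoin_def\<close>)
    moreover have "chart_inv ?pc u = (chart_inv a (vfst u), chart_inv b (vsnd u))"
      unfolding u by (simp add: prod_chart_inv hp A.chart_inv_left[OF a] B.chart_inv_left[OF b])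
    ultimately show ?thesis by blast
  qed
  have "holo_on (snd c \<circ> \<phi> \<circ> chart_inv ?pc) (snd ?pc ` {p \<in> fst ?pc. \<phi> p \<in> fst c})"
    using \<phi> pc c unfolding holo_map_def by blast
  then obtain D where D: "((snd c \<circ> \<phi> \<circ> chart_inv ?pc) has_derivative D) (at u)" "\<forall>a v. D (a *s v) = a *s D v"
    using conjunct2[OF ev[OF u]] unfolding holo_on_def by blast
  have "(coord_map \<phi> a b c has_derivative D) (at u)"
    by (rule has_derivative_transform_within_open[OF D(1) coord_dom_open u])
      (simp add: ev coord_map_def)
  with D(2) show "\<exists>D. (coord_map \<phi> a b c has_derivative D) (at u) \<and> (\<forall>a v. D (a *s v) = a *s D v)"
    by (intro exI[of _ D] conjI)
qed

end

context hol_frame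
begin

text \<open>A map that carries each frame field to itself preserves the frame components of tangent
  vectors, and these determine the metric.\<close>

lemma invariant_frame_metric:
  assumes maps: "\<And>f p. f \<in> F \<Longrightarrow> p \<in> points X \<Longrightarrow> f p \<in> points X"
    and lin: "\<And>f c d p. \<lbrakk>f \<in> F; c \<in> atlas X; d \<in> atlas X; p \<in> fst c; f p \<in> fst d\<rbrakk> \<Longrightarrow> linear (dd (snd d \<circ> f \<circ> chart_inv c) (snd c p))"
      "\<And>f c d p a v. \<lbrakk>f \<in> F; c \<in> atlas X; d \<in> atlas X; p \<in> fst c; f p \<in> fst d\<rbrakk> \<Longrightarrow>
        dd (snd d \<circ> f \<circ> chart_inv c) (snd c p) (a *s v) = a *s dd (snd d \<circ> f \<circ> chart_inv c) (snd c p) v"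
    and equi: "\<And>f c d p j. \<lbrakk>f \<in> F; c \<in> atlas X; d \<in> atlas X; p \<in> fst c; f p \<in> fst d\<rbrakk> \<Longrightarrow>
        s j (f p) d = dd (snd d \<circ> f \<circ> chart_inv c) (snd c p) (s j p c)"
    and inv: "\<And>f. f \<in> F \<Longrightarrow> \<exists>g\<in>F. \<forall>p\<in>points X. g (f p) = p"
  shows "invariant_metric F M frame_metric"
proof -
  have mult: "frame_matrix d (snd d (f p)) *v a = dd (snd d \<circ> f \<circ> chart_inv c) (snd c p) (frame_matrix c (snd c p) *v a)"
    if "f \<in> F" "c \<in> atlas X" "d \<in> atlas X" "p \<in> fst c" "f p \<in> fst d" for f c d p a
    unfolding frame_matrix_mult[OF that(2,4)] frame_matrix_mult[OF that(3,5)]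
      linear_lin_comb[OF lin(1)[OF that] lin(2)[OF that]] equi[OF that] ..
  \<comment> \<open>A relation among the fields at \<open>f p\<close> is carried by the inverse
    \<open>g\<close> to the same relation at \<open>p\<close>, where the fields are
    independent.\<close>
  have fY: "f p \<in> Y" if f: "f \<in> F" and p: "p \<in> Y" for f p
  proof (rule ccontr)
    assume n: "f p \<notin> Y"
    have fX: "f p \<in> points X" by (rule maps[OF f Y_points[OF p]])
    obtain g where g: "g \<in> F" "g (f p) = p" using inv[OF f] Y_points[OF p] by blast
    note c = cht[OF Y_points[OF p]] and d = cht[OF fX]
    obtain a where a: "a \<noteq> 0" "frame_matrix (cht (f p)) (snd (cht (f p)) (f p)) *v a = 0"
      using n Y_iff[OF d] det_eq_0_ker by blast
    have gc: "g (f p) \<in> fst (cht p)" unfolding g(2) by (rule c(2))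
    have "frame_matrix (cht p) (snd (cht p) p) *v a = 0"
      using mult[OF g(1) d(1) c(1) d(2) gc, of a] unfolding a(2) g(2)
      by (simp add: linear_0[OF lin(1)[OF g(1) d(1) c(1) d(2) gc]])
    then show False using a(1) Y_iff[OF c] p det_eq_0_ker by blast
  qed
  have "coef (f p) (differential M M f p u) = coef p u" if f: "f \<in> F" and p: "p \<in> Y" and u: "u \<in> tangent_space M p" for f p u
  proof -
    define c' where "c' = (SOME c. c \<in> atlas M \<and> p \<in> fst c)"
    have "\<exists>c. c \<in> atlas M \<and> p \<in> fst c"
      using cht[OF Y_points[OF p]] p by (intro exI[of _ "restr Y (cht p)"]) (simp add: atlas_M)
    then have "c' \<in> atlas M \<and> p \<in> fst c'" unfolding c'_def by (rule someI_ex)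
    then obtain c where c: "c \<in> atlas X" "c' = restr Y c" "p \<in> fst c" unfolding atlas_M by auto
    note fp = fY[OF f p]
    note d = cht[OF Y_points[OF fp]]
    let ?L = "dd (snd (cht (f p)) \<circ> f \<circ> chart_inv c) (snd c p)"
    have "differential M M f p u (restr Y (cht (f p))) = ?L (u (restr Y c))"
      unfolding differential_def c'_def[symmetric] Let_def c(2)
      using d fp by (simp add: atlas_M dd_restr[OF c(1,3) p])
    moreover have "u (restr Y c) = frame_matrix c (snd c p) *v coef p u"
      unfolding coef_eq[OF u p c(1,3)] frame_inv(2)[OF c(1,3) p] ..
    ultimately have "differential M M f p u (restr Y (cht (f p))) = frame_matrix (cht (f p)) (snd (cht (f p)) (f p)) *v coef p u"
      using mult[OF f c(1) d(1) c(3) d(2)] by simp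
    then show ?thesis
      unfolding coef_def[of "f p"] by (simp add: frame_inv(1)[OF d fp])
  qed
  then show ?thesis
    unfolding invariant_metric_def points_M frame_metric_def using fY by auto
qed

end

section \<open>The fundamental vector fields of a Lie group action\<close>

locale lie_action =
  fixes X :: "('a, 'n::finite) mfd" and G :: "('a \<Rightarrow> 'a, 'm::finite) mfd"
    and s :: "'n \<Rightarrow> 'a \<Rightarrow> ('a, 'n) tvec"
  assumes X: "complex_manifold X" and G: "lie_subgroup_Aut0 X G" and dim: "CARD('m) = CARD('n)"
    and s: "field_basis s (lie_algebra X G)"
begin

sublocale cplx_mfd X by (rule cplx_mfd.intro[OF X])

lemma G_mfd: "complex_manifold G"
  using G by (simp add: lie_subgroup_Aut0_def complex_lie_group_def)

sublocale G: cplx_mfd G by (rule cplx_mfd.intro[OF G_mfd])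

lemma G_subgroup: "subgroup (points G) (BijGroup (points X))"
  using G by (simp add: lie_subgroup_Aut0_def)

lemma G_Bij: "f \<in> points G \<Longrightarrow> f \<in> Bij (points X)"
  using subgroup.subset[OF G_subgroup] by (auto simp: BijGroup_def)

lemma G_maps: "f \<in> points G \<Longrightarrow> p \<in> points X \<Longrightarrow> f p \<in> points X"
  using G_Bij by (auto simp: Bij_def bij_betw_def)

definition one :: "'a \<Rightarrow> 'a"
  where "one = (\<lambda>y\<in>points X. y)"

definition act :: "('a \<Rightarrow> 'a) \<times> 'a \<Rightarrow> 'a"
  where "act = (\<lambda>(f, x). f x)"

definition mulG :: "('a \<Rightarrow> 'a) \<times> ('a \<Rightarrow> 'a) \<Rightarrow> 'a \<Rightarrow> 'a"
  where "mulG = (\<lambda>(f, h). f \<otimes>\<^bsub>grp_of X G\<^esub> h)"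

lemma one_G: "one \<in> points G"
  using subgroup.one_closed[OF G_subgroup] by (simp add: BijGroup_def one_def)

lemma one_at: "p \<in> points X \<Longrightarrow> one p = p"
  by (simp add: one_def)

lemma mulG_eq: "f \<in> points G \<Longrightarrow> h \<in> points G \<Longrightarrow> mulG (f, h) = compose (points X) f h"
  using G_Bij by (simp add: mulG_def BijGroup_def)

lemma mulG_at: "f \<in> points G \<Longrightarrow> h \<in> points G \<Longrightarrow> p \<in> points X \<Longrightarrow> mulG (f, h) p = f (h p)"
  by (simp add: mulG_eq compose_eq)

lemma mulG_one: "f \<in> points G \<Longrightarrow> mulG (f, one) = f" "f \<in> points G \<Longrightarrow> mulG (one, f) = f"
proof -
  assume f: "f \<in> points G"
  have ext: "f \<in> extensional (points X)" using G_Bij[OF f] by (simp add: Bij_def)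
  show "mulG (f, one) = f"
    unfolding mulG_eq[OF f one_G] by (rule extensionalityI[OF compose_extensional ext]) (simp add: compose_eq one_at)
  show "mulG (one, f) = f"
    unfolding mulG_eq[OF one_G f]
    by (rule extensionalityI[OF compose_extensional ext]) (simp add: compose_eq one_at G_maps[OF f])
qed

lemma act_holo: "holo_map (prod_mfd G X) X act"
  using G by (simp add: lie_subgroup_Aut0_def act_def)

lemma mulG_holo: "holo_map (prod_mfd G G) G mulG"
  using G by (simp add: lie_subgroup_Aut0_def complex_lie_group_def mulG_def)

lemma G_holo: "f \<in> points G \<Longrightarrow> holo_map X X f"
proof -
  assume "f \<in> points G"
  then have "f \<in> Aut0 X" using G unfolding lie_subgroup_Aut0_def by blast
  then have "f \<in> topspace (Aut_topology X)"
    using connected_component_of_subset_topspace unfolding Aut0_def by fast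
  then show ?thesis unfolding Aut_topology_def topology_generated_by_topspace Aut_def by blast
qed

text \<open>The same choice as in \<open>differential\<close> at the identity, so that fundamental
  fields unfold to derivatives in this chart without a comparison of charts.\<close>

definition e :: "('a \<Rightarrow> 'a, 'm) chart"
  where "e = (SOME c. c \<in> atlas G \<and> one \<in> fst c)"

definition w0 :: "complex^'m"
  where "w0 = snd e one"

lemma e: "e \<in> atlas G" "one \<in> fst e"
  using someI_ex[OF G.ex_chart[OF one_G]] unfolding e_def by simp_all

lemma w0: "w0 \<in> snd e ` fst e" "chart_inv e w0 = one"
  using e by (simp_all add: w0_def G.chart_inv_left)

lemma e_points: "w \<in> snd e ` fst e \<Longrightarrow> chart_inv e w \<in> points G"
  using chart_inv_in[of w e] G.chart_sub[OF e(1)] by blast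

text \<open>The action in coordinates: a group element in the chart \<open>e\<close> around 1, a
  point in the chart \<open>c\<close>, and the value read in \<open>d\<close>. Likewise \<mu> below
  is the group law.\<close>

abbreviation F :: "('a, 'n) chart \<Rightarrow> ('a, 'n) chart \<Rightarrow> complex^('m + 'n) \<Rightarrow> complex^'n"
  where "F c d \<equiv> coord_map act e c d"

abbreviation \<Omega> :: "('a, 'n) chart \<Rightarrow> ('a, 'n) chart \<Rightarrow> (complex^('m + 'n)) set"
  where "\<Omega> c d \<equiv> coord_dom act e c d"

abbreviation \<mu> :: "complex^('m + 'm) \<Rightarrow> complex^'m"
  where "\<mu> \<equiv> coord_map mulG e e e"

abbreviation \<Psi> :: "(complex^('m + 'm)) set"
  where "\<Psi> \<equiv> coord_dom mulG e e e"

lemma F_holo: "c \<in> atlas X \<Longrightarrow> d \<in> atlas X \<Longrightarrow> holo_on (F c d) (\<Omega> c d)"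
  and \<Omega>_open: "c \<in> atlas X \<Longrightarrow> d \<in> atlas X \<Longrightarrow> open (\<Omega> c d)"
  by (rule coord_map_holo[OF G_mfd X X act_holo e(1)], assumption+)
    (rule coord_dom_open[OF G_mfd X X act_holo e(1)], assumption+)

lemma \<mu>_holo: "holo_on \<mu> \<Psi>"
  and \<Psi>_open: "open \<Psi>"
  by (rule coord_map_holo[OF G_mfd G_mfd G_mfd mulG_holo e(1) e(1) e(1)])
    (rule coord_dom_open[OF G_mfd G_mfd G_mfd mulG_holo e(1) e(1) e(1)])

lemma F_at: "c \<in> atlas X \<Longrightarrow> p \<in> fst c \<Longrightarrow> F c d (vjoin w (snd c p)) = snd d (chart_inv e w p)"
  by (simp add: coord_map_def act_def chart_inv_left)

lemma \<Omega>_iff: "c \<in> atlas X \<Longrightarrow> p \<in> fst c \<Longrightarrow>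
    vjoin w (snd c p) \<in> \<Omega> c d \<longleftrightarrow> w \<in> snd e ` fst e \<and> chart_inv e w p \<in> fst d"
  by (simp add: coord_dom_def act_def chart_inv_left)

lemma \<Omega>_w0: "c \<in> atlas X \<Longrightarrow> p \<in> fst c \<Longrightarrow> p \<in> fst d \<Longrightarrow> vjoin w0 (snd c p) \<in> \<Omega> c d"
  using chart_sub[of c] by (auto simp: \<Omega>_iff w0 one_at simp del: image_iff)

lemma F_w0: "c \<in> atlas X \<Longrightarrow> p \<in> fst c \<Longrightarrow> F c d (vjoin w0 (snd c p)) = snd d p"
  using chart_sub[of c] by (auto simp: F_at w0 one_at)

section \<open>The frame fields as derivatives of orbit maps\<close>

definition v :: "'n \<Rightarrow> ('a \<Rightarrow> 'a, 'm) tvec"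
  where "v j = (SOME v. v \<in> tangent_space G one \<and> s j = fundamental_field X G v)"

definition \<eta> :: "'n \<Rightarrow> complex^'m"
  where "\<eta> j = v j e"

lemma v: "s j = fundamental_field X G (v j)"
proof -
  have "s j \<in> lie_algebra X G" using s by (simp add: field_basis_def)
  then have "\<exists>v. v \<in> tangent_space G one \<and> s j = fundamental_field X G v"
    unfolding lie_algebra_def one_def by blast
  then show ?thesis unfolding v_def by (rule someI2_ex) simp
qed

lemma orbit_derivative:
  assumes "c \<in> atlas X" "d \<in> atlas X" "p \<in> fst c" "p \<in> fst d"
  shows "((snd d \<circ> (\<lambda>f. f p) \<circ> chart_inv e) has_derivative (\<lambda>v. dd (F c d) (vjoin w0 (snd c p)) (vjoin v 0))) (at w0)"
proof -
  have "((\<lambda>w. F c d (vjoin w (snd c p))) has_derivative (\<lambda>v. dd (F c d) (vjoin w0 (snd c p)) (vjoin v 0))) (at w0)"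
    by (rule has_derivative_slice(1)[OF holo_on_has_derivative[OF F_holo[OF assms(1,2)] \<Omega>_w0[OF assms(1,3,4)]]])
  moreover have "(\<lambda>w. F c d (vjoin w (snd c p))) = snd d \<circ> (\<lambda>f. f p) \<circ> chart_inv e"
    by (simp add: F_at[OF assms(1,3)] fun_eq_iff)
  ultimately show ?thesis by simp
qed

lemma fundamental_field_at:
  assumes "c \<in> atlas X" "d \<in> atlas X" "p \<in> fst c" "p \<in> fst d"
  shows "fundamental_field X G u p d = dd (F c d) (vjoin w0 (snd c p)) (vjoin (u e) 0)"
proof -
  have p: "p \<in> points X" using chart_sub assms by blast
  have "fundamental_field X G u p d = dd (snd d \<circ> (\<lambda>f. f p) \<circ> chart_inv e) w0 (u e)"
    using assms p unfolding fundamental_field_def differential_def one_def[symmetric] e_def[symmetric] Let_def w0_def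
    by (simp add: one_at)
  then show ?thesis by (simp add: dd_eq[OF orbit_derivative[OF assms]])
qed

lemma fundamental_field_0:
  "d \<notin> atlas X \<or> p \<notin> fst d \<or> p \<notin> points X \<Longrightarrow> fundamental_field X G u p d = 0"
  unfolding fundamental_field_def differential_def one_def[symmetric] by (auto simp: one_at)

text \<open>The field is the partial derivative of the action in the group variable at 1. From this
  formula follow its holomorphy and its behaviour under a change of chart.\<close>

lemma s_at:
  assumes "c \<in> atlas X" "d \<in> atlas X" "p \<in> fst c" "p \<in> fst d"
  shows "s j p d = dd (F c d) (vjoin w0 (snd c p)) (vjoin (\<eta> j) 0)"
  unfolding \<eta>_def by (rule trans[OF fun_cong[OF fun_cong[OF v]] fundamental_field_at[OF assms]])

lemma coords_obtain:
  assumes "x \<in> snd c ` fst c"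
  obtains p where "p \<in> fst c" "x = snd c p"
  using assms by blast

lemma s_transition:
  assumes cd: "c \<in> atlas X" "d \<in> atlas X" and p: "p \<in> fst c" "p \<in> fst d"
  shows "s j p d = dd (snd d \<circ> chart_inv c) (snd c p) (s j p c)"
proof -
  let ?S = "{w. vjoin w (snd c p) \<in> \<Omega> c c}"
  have S: "open ?S" by (rule open_vjoin_slices(1)[OF \<Omega>_open[OF cd(1,1)]])
  have "p \<in> points X" using chart_sub[OF cd(1)] p(1) by blast
  then have one_p: "chart_inv e w0 p = p" by (simp add: w0 one_at)
  have o: "((snd c \<circ> (\<lambda>w. chart_inv e w p)) has_derivative (\<lambda>v. dd (F c c) (vjoin w0 (snd c p)) (vjoin v 0))) (at w0)"
    using orbit_derivative[OF cd(1,1) p(1,1)] by (simp add: o_def)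
  have "((snd d \<circ> (\<lambda>w. chart_inv e w p)) has_derivative
      (\<lambda>v. dd (snd d \<circ> chart_inv c) (snd c (chart_inv e w0 p)) (dd (snd c \<circ> (\<lambda>w. chart_inv e w p)) w0 v))) (at w0)"
  proof (rule dd_through_chart[OF cd _ _ S])
    show "(snd c \<circ> (\<lambda>w. chart_inv e w p)) differentiable (at w0)" using o differentiable_def by blast
  qed (use one_p p cd \<Omega>_w0[OF cd(1) p(1) p(1)] in \<open>simp_all add: \<Omega>_iff\<close>)
  then have "((snd d \<circ> (\<lambda>f. f p) \<circ> chart_inv e) has_derivative
      (\<lambda>v. dd (snd d \<circ> chart_inv c) (snd c p) (dd (F c c) (vjoin w0 (snd c p)) (vjoin v 0)))) (at w0)"
    unfolding one_p dd_eq[OF o] by (simp add: o_def)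
  from has_derivative_unique[OF orbit_derivative[OF cd p] this]
  show "s j p d = dd (snd d \<circ> chart_inv c) (snd c p) (s j p c)"
    unfolding s_at[OF cd p] s_at[OF cd(1,1) p(1,1)] by (rule fun_cong)
qed

lemma s_holomorphic:
  assumes c: "c \<in> atlas X"
  shows "hol (\<lambda>z. s j (chart_inv c z) c $ i) (snd c ` fst c)"
proof -
  have hF: "hol (\<lambda>u. F c c u $ i) (\<Omega> c c)" for i using F_holo[OF c c] unfolding holo_on_iff_hol by blast
  have "hol (\<lambda>x. dd (F c c) (vjoin w0 x) (vjoin (\<eta> j) 0) $ i) {x. vjoin w0 x \<in> \<Omega> c c}"
    by (rule hol_slice(1)[OF hol_vec_dd[OF hF \<Omega>_open[OF c c]]])
  then have "hol (\<lambda>x. dd (F c c) (vjoin w0 x) (vjoin (\<eta> j) 0) $ i) (snd c ` fst c)"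
    by (rule hol_subset) (use \<Omega>_w0[OF c] in blast)
  then show "hol (\<lambda>z. s j (chart_inv c z) c $ i) (snd c ` fst c)"
  proof (rule hol_cong[OF coords_open[OF c], rotated])
    fix x assume "x \<in> snd c ` fst c"
    then obtain p where "p \<in> fst c" "x = snd c p" by (rule coords_obtain)
    then show "dd (F c c) (vjoin w0 x) (vjoin (\<eta> j) 0) $ i = s j (chart_inv c x) c $ i"
      by (simp add: chart_inv_left[OF c] s_at[OF c c])
  qed
qed

sublocale hol_frame X s
  by (intro hol_frame.intro hol_frame_axioms.intro cplx_mfd_axioms s_transition s_holomorphic)

text \<open>Converts coefficients with respect to the frame into coordinates on the tangent space of
  \<open>G\<close> at 1.\<close>

definition N :: "complex^'n^'m"
  where "N = (\<chi> i j. \<eta> j $ i)"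

lemma N_mult: "N *v a = (\<Sum>j\<in>UNIV. a $ j *s \<eta> j)"
  unfolding vec_eq_mult_columns by (simp add: N_def)

lemma vjoin_sum: "vjoin (\<Sum>j\<in>J. a j *s w j) 0 = (\<Sum>j\<in>J. a j *s vjoin (w j) 0)"
  by (induction J rule: infinite_finite_induct)
    (simp_all add: vjoin_add[of _ _ 0 0, simplified] vjoin_scale[of _ _ 0, simplified] vec_eq_iff vjoin_def split: sum.split)

lemma F_lin_comb:
  assumes c: "c \<in> atlas X" "d \<in> atlas X" and u: "u \<in> \<Omega> c d"
  shows "dd (F c d) u (vjoin (N *v a) 0) = (\<Sum>j\<in>UNIV. a $ j *s dd (F c d) u (vjoin (\<eta> j) 0))"
  unfolding N_mult vjoin_sum
  by (rule linear_lin_comb[OF linear_frechet_derivative[OF holo_on_differentiable[OF F_holo[OF c] u]]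
        holo_on_dd_scale[OF F_holo[OF c] u]])

text \<open>\<open>field_basis\<close> encodes independence as uniqueness of coefficients. A kernel
  vector and 0 both represent the zero field, which lies in the Lie algebra as the field of the zero
  tangent vector.\<close>

lemma N_inj: "N *v a = 0 \<Longrightarrow> a = 0"
proof -
  assume a: "N *v a = 0"
  define \<xi> where "\<xi> = fundamental_field X G (\<lambda>_. 0)"
  have "(\<lambda>_. 0) \<in> tangent_space G one"
    unfolding tangent_space_def
  proof (intro CollectI conjI ballI impI allI refl)
    fix c d assume "c \<in> atlas G" "d \<in> atlas G" "one \<in> fst c \<inter> fst d"
    then have "linear (dd (snd d \<circ> chart_inv c) (snd c one))" by (intro G.transition_derivative(2)) blast+
    from linear_0[OF this] show "0 = dd (snd d \<circ> chart_inv c) (snd c one) 0" by (rule sym)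
  qed
  then have \<xi>V: "\<xi> \<in> lie_algebra X G" unfolding \<xi>_def lie_algebra_def one_def by blast
  have lin0: "dd (F d d) (vjoin w0 (snd d p)) (vjoin 0 0) = 0" if "d \<in> atlas X" "p \<in> fst d" for d p
  proof -
    have "linear (dd (F d d) (vjoin w0 (snd d p)))"
      by (rule linear_frechet_derivative[OF holo_on_differentiable[OF F_holo[OF that(1,1)] \<Omega>_w0[OF that that(2)]]])
    moreover have "vjoin 0 0 = (0 :: complex^('m + 'n))" by (simp add: vjoin_def vec_eq_iff split: sum.split)
    ultimately show ?thesis by (simp add: linear_0)
  qed
  have \<xi>0: "\<xi> p d = 0" for p d
  proof (cases "d \<in> atlas X \<and> p \<in> fst d")
    case True
    then show ?thesis unfolding \<xi>_def using fundamental_field_at[of d d p] lin0 by simp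
  next
    case False
    then show ?thesis unfolding \<xi>_def by (intro fundamental_field_0) blast
  qed
  have comb0: "(\<Sum>i\<in>UNIV. a $ i *s s i p d) = 0" for p d
  proof (cases "d \<in> atlas X \<and> p \<in> fst d")
    case True
    then have d: "d \<in> atlas X" "p \<in> fst d" by auto
    show ?thesis
      using F_lin_comb[OF d(1,1) \<Omega>_w0[OF d d(2)], of a] unfolding a lin0[OF d] s_at[OF d(1,1) d(2,2)] by simp
  next
    case False
    then have "d \<notin> atlas X \<or> p \<notin> fst d \<or> p \<notin> points X" by blast
    from trans[OF fun_cong[OF fun_cong[OF v]] fundamental_field_0[OF this]]
    have "s i p d = 0" for i .
    then show ?thesis by simp
  qed
  define P where "P = (\<lambda>b::'n \<Rightarrow> complex. \<forall>p c. \<xi> p c = (\<Sum>i\<in>UNIV. b i *s s i p c))"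
  have "\<exists>!b. P b" unfolding P_def using s \<xi>V by (simp add: field_basis_def)
  moreover have "P (\<lambda>i. a $ i)" "P (\<lambda>_. 0)" unfolding P_def using comb0 \<xi>0 by simp_all
  ultimately have "(\<lambda>i. a $ i) = (\<lambda>_. 0)" by blast
  then show "a = 0" by (simp add: vec_eq_iff fun_eq_iff)
qed

definition W :: "complex^'m^'n"
  where "W = (SOME B. B ** N = mat 1)"

text \<open>Injectivity and the equality of the dimensions make \<open>N\<close> onto, so its left
  inverse is also a right inverse. Its two index types differ, hence the argument by
  dimensions.\<close>

lemma W: "W *v (N *v a) = a" "N *v (W *v b) = b"
proof -
  have inj: "inj ((*v) N)"
  proof (rule injI)
    fix a b assume "N *v a = N *v b"
    then have "N *v (a - b) = 0" by (simp add: matrix_vector_mult_diff_distrib)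
    then show "a = b" using N_inj by fastforce
  qed
  then have "\<exists>B. B ** N = mat 1" by (simp add: matrix_left_invertible_injective)
  then have "W ** N = mat 1" unfolding W_def by (rule someI_ex)
  then show WN: "W *v (N *v a) = a" for a by (simp add: matrix_vector_mul_assoc)
  have lin: "linear ((*v) N)" by simp
  have "dim (range ((*v) N)) = dim (UNIV :: (complex^'n) set)"
    by (rule dim_image_eq[OF lin]) (use inj in simp)
  then have "dim (range ((*v) N)) = DIM(complex^'m)" using dim by simp
  moreover have "subspace (range ((*v) N))" by (rule linear_subspace_image[OF lin subspace_UNIV])
  ultimately have "range ((*v) N) = UNIV" by (metis dim_eq_full span_eq_iff)
  then obtain a where "b = N *v a" by blast
  then show "N *v (W *v b) = b" by (simp add: WN)
qed

end

section \<open>Translations and the frame determinant\<close>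

context lie_action
begin

text \<open>Associativity of the action, in coordinates. The two translation lemmas below
  differentiate it in the second and in the first group variable.\<close>

lemma action_law:
  assumes c: "c \<in> atlas X" and p: "p \<in> fst c" and ww: "vjoin w w' \<in> \<Psi>" and w'p: "vjoin w' (snd c p) \<in> \<Omega> c c"
  shows "F c c (vjoin (\<mu> (vjoin w w')) (snd c p)) = F c c (vjoin w (F c c (vjoin w' (snd c p))))"
proof -
  define h h' where "h = chart_inv e w" and "h' = chart_inv e w'"
  have hh: "h \<in> points G" "h' \<in> points G" "mulG (h, h') \<in> fst e"
    using ww e_points unfolding coord_dom_def h_def h'_def by simp_all
  have h'p: "h' p \<in> fst c" using w'p unfolding \<Omega>_iff[OF c p] h'_def by simp
  have "p \<in> points X" using chart_sub[OF c] p by blast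
  then have "mulG (h, h') p = h (h' p)" by (rule mulG_at[OF hh(1,2)])
  moreover have "chart_inv e (\<mu> (vjoin w w')) = mulG (h, h')"
    using G.chart_inv_left[OF e(1) hh(3)] by (simp add: coord_map_def h_def h'_def)
  ultimately have "F c c (vjoin (\<mu> (vjoin w w')) (snd c p)) = snd c (h (h' p))"
    unfolding F_at[OF c p] by simp
  moreover have "F c c (vjoin w' (snd c p)) = snd c (h' p)" unfolding F_at[OF c p] h'_def ..
  ultimately show ?thesis
    using F_at[OF c h'p, of c w] by (simp add: h_def)
qed

lemma \<Psi>_w0: "w \<in> snd e ` fst e \<Longrightarrow> vjoin w w0 \<in> \<Psi>" "w \<in> snd e ` fst e \<Longrightarrow> vjoin w0 w \<in> \<Psi>"
  and \<mu>_w0: "w \<in> snd e ` fst e \<Longrightarrow> \<mu> (vjoin w w0) = w" "w \<in> snd e ` fst e \<Longrightarrow> \<mu> (vjoin w0 w) = w"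
  using w0 by (simp_all add: coord_dom_def coord_map_def mulG_one e_points chart_inv_in chart_inv_right del: image_iff)

lemma \<Omega>_E: "vjoin w x \<in> \<Omega> c d \<Longrightarrow> w \<in> snd e ` fst e" "vjoin w x \<in> \<Omega> c d \<Longrightarrow> x \<in> snd c ` fst c"
  by (simp_all add: coord_dom_def)

text \<open>The point h k p with k near 1 is read as (h k) p and as h (k p); both are differentiated
  at k = 1.\<close>

lemma dd_left_translation:
  assumes c: "c \<in> atlas X" and p: "p \<in> fst c" and u: "vjoin w (snd c p) \<in> \<Omega> c c"
  shows "dd (F c c) (vjoin w (snd c p)) (vjoin (dd \<mu> (vjoin w w0) (vjoin 0 b)) 0) =
    dd (F c c) (vjoin w (snd c p)) (vjoin 0 (dd (F c c) (vjoin w0 (snd c p)) (vjoin b 0)))"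
proof -
  note E = \<Omega>_E(1)[OF u]
  note dF = holo_on_has_derivative[OF F_holo[OF c c]]
  let ?S = "{w'. vjoin w w' \<in> \<Psi>} \<inter> {w'. vjoin w' (snd c p) \<in> \<Omega> c c}"
  have S: "open ?S" by (intro open_Int open_vjoin_slices \<Psi>_open \<Omega>_open c)
  have w0S: "w0 \<in> ?S" using \<Psi>_w0(1)[OF E] \<Omega>_w0[OF c p p] by simp
  have d\<mu>: "((\<lambda>w'. \<mu> (vjoin w w')) has_derivative (\<lambda>b. dd \<mu> (vjoin w w0) (vjoin 0 b))) (at w0)"
    by (rule has_derivative_slice(2)[OF holo_on_has_derivative[OF \<mu>_holo \<Psi>_w0(1)[OF E]]])
  have "((\<lambda>w'. F c c (vjoin (\<mu> (vjoin w w')) (snd c p))) has_derivative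
      (\<lambda>b. dd (F c c) (vjoin w (snd c p)) (vjoin (dd \<mu> (vjoin w w0) (vjoin 0 b)) 0))) (at w0)"
    using has_derivative_compose[OF has_derivative_vjoin[OF d\<mu> has_derivative_const], of "F c c" _ "snd c p"] dF[OF u]
    by (simp add: \<mu>_w0(1)[OF E])
  then have d1: "((\<lambda>w'. F c c (vjoin w (F c c (vjoin w' (snd c p))))) has_derivative
      (\<lambda>b. dd (F c c) (vjoin w (snd c p)) (vjoin (dd \<mu> (vjoin w w0) (vjoin 0 b)) 0))) (at w0)"
    by (rule has_derivative_transform_within_open[OF _ S w0S]) (simp add: action_law[OF c p])
  have "((\<lambda>w'. F c c (vjoin w' (snd c p))) has_derivative (\<lambda>b. dd (F c c) (vjoin w0 (snd c p)) (vjoin b 0))) (at w0)"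
    by (rule has_derivative_slice(1)[OF dF[OF \<Omega>_w0[OF c p p]]])
  from has_derivative_compose[OF has_derivative_vjoin[OF has_derivative_const this], of "F c c" _ w] dF[OF u]
  have d2: "((\<lambda>w'. F c c (vjoin w (F c c (vjoin w' (snd c p))))) has_derivative
      (\<lambda>b. dd (F c c) (vjoin w (snd c p)) (vjoin 0 (dd (F c c) (vjoin w0 (snd c p)) (vjoin b 0))))) (at w0)"
    by (simp add: F_w0[OF c p])
  show ?thesis by (rule fun_cong[OF has_derivative_unique[OF d1 d2]])
qed

text \<open>The same for k h p with k near 1, read as (k h) p and as k (h p).\<close>

lemma dd_right_translation:
  assumes c: "c \<in> atlas X" and p: "p \<in> fst c" and u: "vjoin w (snd c p) \<in> \<Omega> c c"
  shows "dd (F c c) (vjoin w (snd c p)) (vjoin (dd \<mu> (vjoin w0 w) (vjoin b 0)) 0) =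
    dd (F c c) (vjoin w0 (F c c (vjoin w (snd c p)))) (vjoin b 0)"
proof -
  note E = \<Omega>_E(1)[OF u]
  note dF = holo_on_has_derivative[OF F_holo[OF c c]]
  have hp: "chart_inv e w p \<in> fst c" using u by (simp add: \<Omega>_iff[OF c p])
  let ?S = "{w'. vjoin w' w \<in> \<Psi>}"
  have S: "open ?S" by (intro open_vjoin_slices \<Psi>_open)
  have w0S: "w0 \<in> ?S" using \<Psi>_w0(2)[OF E] by simp
  have d\<mu>: "((\<lambda>w'. \<mu> (vjoin w' w)) has_derivative (\<lambda>b. dd \<mu> (vjoin w0 w) (vjoin b 0))) (at w0)"
    by (rule has_derivative_slice(1)[OF holo_on_has_derivative[OF \<mu>_holo \<Psi>_w0(2)[OF E]]])
  have "((\<lambda>w'. F c c (vjoin (\<mu> (vjoin w' w)) (snd c p))) has_derivative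
      (\<lambda>b. dd (F c c) (vjoin w (snd c p)) (vjoin (dd \<mu> (vjoin w0 w) (vjoin b 0)) 0))) (at w0)"
    using has_derivative_compose[OF has_derivative_vjoin[OF d\<mu> has_derivative_const], of "F c c" _ "snd c p"] dF[OF u]
    by (simp add: \<mu>_w0(2)[OF E])
  then have d1: "((\<lambda>w'. F c c (vjoin w' (F c c (vjoin w (snd c p))))) has_derivative
      (\<lambda>b. dd (F c c) (vjoin w (snd c p)) (vjoin (dd \<mu> (vjoin w0 w) (vjoin b 0)) 0))) (at w0)"
    by (rule has_derivative_transform_within_open[OF _ S w0S]) (simp add: action_law[OF c p _ u])
  have "vjoin w0 (F c c (vjoin w (snd c p))) \<in> \<Omega> c c"
    unfolding F_at[OF c p] by (rule \<Omega>_w0[OF c hp hp])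
  from has_derivative_slice(1)[OF dF[OF this]]
  have d2: "((\<lambda>w'. F c c (vjoin w' (F c c (vjoin w (snd c p))))) has_derivative
      (\<lambda>b. dd (F c c) (vjoin w0 (F c c (vjoin w (snd c p)))) (vjoin b 0))) (at w0)" .
  show ?thesis by (rule fun_cong[OF has_derivative_unique[OF d1 d2]])
qed

lemma matrix_mult_column: "(A ** B) $ i $ j = (A *v (\<chi> k. B $ k $ j)) $ i"
  by (simp add: matrix_matrix_mult_def matrix_vector_mult_def)

text \<open>The differential at 1 of left translation by \<open>w\<close>, with \<eta> as basis at 1
  and its values expressed through \<open>W\<close>; \<open>r\<close> is the same for right
  translation. Thus l^-1 r is the adjoint action of the inverse group element in the basis
  \<eta>.\<close>

definition l :: "complex^'m \<Rightarrow> complex^'n^'n"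
  where "l w = (\<chi> i j. (W *v dd \<mu> (vjoin w w0) (vjoin 0 (\<eta> j))) $ i)"

definition r :: "complex^'m \<Rightarrow> complex^'n^'n"
  where "r w = (\<chi> i j. (W *v dd \<mu> (vjoin w0 w) (vjoin (\<eta> j) 0)) $ i)"

text \<open>The differential of the orbit map along \<eta>; \<open>Q\<close> below is the Jacobian
  of the translation in the space variable.\<close>

definition P :: "('a, 'n) chart \<Rightarrow> complex^('m + 'n) \<Rightarrow> complex^'n^'n"
  where "P c u = (\<chi> i j. dd (F c c) u (vjoin (\<eta> j) 0) $ i)"

definition Q :: "('a, 'n) chart \<Rightarrow> complex^('m + 'n) \<Rightarrow> complex^'n^'n"
  where "Q c u = (\<chi> i j. dd (F c c) u (vjoin 0 (axis j 1)) $ i)"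

lemma P_mult:
  assumes c: "c \<in> atlas X" and u: "u \<in> \<Omega> c c"
  shows "P c u *v a = dd (F c c) u (vjoin (N *v a) 0)"
  unfolding F_lin_comb[OF c c u] vec_eq_mult_columns[of "P c u"] by (simp add: P_def)

lemma Q_mult:
  assumes c: "c \<in> atlas X" and u: "u \<in> \<Omega> c c"
  shows "Q c u *v a = dd (F c c) u (vjoin 0 a)"
proof -
  have "vjoin 0 a = (\<Sum>j\<in>UNIV. a $ j *s vjoin (0 :: complex^'m) (axis j 1))"
    by (simp add: vec_eq_iff vjoin_def axis_def if_distrib split: sum.split cong: if_cong)
  then have "dd (F c c) u (vjoin 0 a) = (\<Sum>j\<in>UNIV. a $ j *s dd (F c c) u (vjoin 0 (axis j 1)))"
    by (simp only: linear_lin_comb[OF linear_frechet_derivative[OF holo_on_differentiable[OF F_holo[OF c c] u]]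
        holo_on_dd_scale[OF F_holo[OF c c] u]])
  then show ?thesis unfolding vec_eq_mult_columns by (simp add: Q_def)
qed

lemma frame_matrix_eq_P:
  assumes "c \<in> atlas X" "p \<in> fst c"
  shows "frame_matrix c (snd c p) = P c (vjoin w0 (snd c p))"
  by (simp add: frame_matrix_at[OF assms] P_def s_at[OF assms(1,1) assms(2,2)])

lemma P_l:
  assumes c: "c \<in> atlas X" and p: "p \<in> fst c" and u: "vjoin w (snd c p) \<in> \<Omega> c c"
  shows "P c (vjoin w (snd c p)) ** l w = Q c (vjoin w (snd c p)) ** frame_matrix c (snd c p)"
proof -
  have "P c (vjoin w (snd c p)) *v (\<chi> k. l w $ k $ j) = Q c (vjoin w (snd c p)) *v (\<chi> k. frame_matrix c (snd c p) $ k $ j)" for j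
  proof -
    have "(\<chi> k. l w $ k $ j) = W *v dd \<mu> (vjoin w w0) (vjoin 0 (\<eta> j))" by (simp add: l_def)
    moreover have "(\<chi> k. frame_matrix c (snd c p) $ k $ j) = dd (F c c) (vjoin w0 (snd c p)) (vjoin (\<eta> j) 0)"
      unfolding frame_matrix_eq_P[OF c p] by (simp add: P_def)
    ultimately show ?thesis
      by (simp add: P_mult[OF c u] Q_mult[OF c u] W dd_left_translation[OF c p u])
  qed
  then show ?thesis unfolding vec_eq_iff matrix_mult_column by simp
qed

lemma P_r:
  assumes c: "c \<in> atlas X" and p: "p \<in> fst c" and u: "vjoin w (snd c p) \<in> \<Omega> c c"
  shows "P c (vjoin w (snd c p)) ** r w = frame_matrix c (F c c (vjoin w (snd c p)))"
proof -
  have hp: "chart_inv e w p \<in> fst c" using u by (simp add: \<Omega>_iff[OF c p])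
  have "P c (vjoin w (snd c p)) *v (\<chi> k. r w $ k $ j) = (\<chi> k. frame_matrix c (F c c (vjoin w (snd c p))) $ k $ j)" for j
  proof -
    have "(\<chi> k. r w $ k $ j) = W *v dd \<mu> (vjoin w0 w) (vjoin (\<eta> j) 0)" by (simp add: r_def)
    then have "P c (vjoin w (snd c p)) *v (\<chi> k. r w $ k $ j) = dd (F c c) (vjoin w0 (F c c (vjoin w (snd c p)))) (vjoin (\<eta> j) 0)"
      by (simp add: P_mult[OF c u] W dd_right_translation[OF c p u])
    then show ?thesis
      unfolding F_at[OF c p] frame_matrix_eq_P[OF c hp] by (simp add: P_def)
  qed
  then show ?thesis unfolding vec_eq_iff matrix_mult_column by simp
qed

text \<open>The factor by which the translation by a group element near 1 multiplies the frame determinant: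
  the Jacobian of the translation times the determinant of the adjoint representation.\<close>

definition H :: "('a, 'n) chart \<Rightarrow> complex^('m + 'n) \<Rightarrow> complex"
  where "H c u = det (Q c u) * det (r (vfst u)) / det (l (vfst u))"

text \<open>Division by \<open>det (l w)\<close> is safe here. The set is open and contains the
  coordinates of all \<open>(w0, x)\<close>, because \<open>l w0\<close> is the identity, and
  derivatives are taken only there.\<close>

definition \<Omega>' :: "('a, 'n) chart \<Rightarrow> (complex^('m + 'n)) set"
  where "\<Omega>' c = {u \<in> \<Omega> c c. det (l (vfst u)) \<noteq> 0}"

text \<open>The determinants of \<open>P_l\<close> and \<open>P_r\<close> with det P eliminated. As
  det P vanishes where det S does, it is solved for by dividing by det l and is never a divisor
  itself.\<close>

lemma det_translation:
  assumes c: "c \<in> atlas X" and p: "p \<in> fst c" and u: "vjoin w (snd c p) \<in> \<Omega>' c"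
  shows "det (frame_matrix c (F c c (vjoin w (snd c p)))) = H c (vjoin w (snd c p)) * det (frame_matrix c (snd c p))"
proof -
  have u': "vjoin w (snd c p) \<in> \<Omega> c c" and nz: "det (l w) \<noteq> 0" using u by (simp_all add: \<Omega>'_def)
  have "det (P c (vjoin w (snd c p))) * det (l w) = det (Q c (vjoin w (snd c p))) * det (frame_matrix c (snd c p))"
    by (simp add: det_mul[symmetric] P_l[OF c p u'])
  moreover have "det (P c (vjoin w (snd c p))) * det (r w) = det (frame_matrix c (F c c (vjoin w (snd c p))))"
    by (simp add: det_mul[symmetric] P_r[OF c p u'])
  moreover have "y = q * \<rho> / d * \<sigma>" if "x * d = q * \<sigma>" "x * \<rho> = y" "d \<noteq> 0" for x y d q \<sigma> \<rho> :: complex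
  proof -
    have "x = q * \<sigma> / d" using that(1,3) by (simp add: eq_divide_eq)
    then show ?thesis using that(2) by (simp add: mult_ac)
  qed
  ultimately show ?thesis using nz unfolding H_def vfst_vjoin by blast
qed

lemma \<mu>_comp: "hol (\<lambda>u. \<mu> u $ k) \<Psi>"
  using \<mu>_holo unfolding holo_on_iff_hol by blast

lemma hol_vfst:
  assumes "hol f T" "\<And>u. u \<in> U \<Longrightarrow> vfst u \<in> T"
  shows "hol (\<lambda>u. f (vfst u)) U"
proof (rule hol_compose[OF assms(1) _ assms(2)])
  fix u :: "complex^('b + 'c)"
  have "(vfst has_derivative vfst) (at u)"
    by (rule bounded_linear_imp_has_derivative[OF bounded_linear_vfst])
  moreover have "\<forall>v. vfst (\<i> *s v) = \<i> *s vfst (v :: complex^('b + 'c))" by (simp add: vec_eq_iff vfst_def)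
  ultimately show "\<exists>D. (vfst has_derivative D) (at u) \<and> (\<forall>v. D (\<i> *s v) = \<i> *s D v)"
    by (intro exI[of _ vfst] conjI)
qed

lemma hol_l: "hol (\<lambda>w. l w $ i $ j) (snd e ` fst e)"
  and hol_r: "hol (\<lambda>w. r w $ i $ j) (snd e ` fst e)"
proof -
  have d: "hol (\<lambda>w. dd \<mu> (vjoin w w0) b $ k) (snd e ` fst e)" "hol (\<lambda>w. dd \<mu> (vjoin w0 w) b $ k) (snd e ` fst e)" for b k
    by (rule hol_subset[OF hol_slice(2)[OF hol_vec_dd[OF \<mu>_comp \<Psi>_open]]], use \<Psi>_w0 in blast,
        rule hol_subset[OF hol_slice(1)[OF hol_vec_dd[OF \<mu>_comp \<Psi>_open]]], use \<Psi>_w0 in blast)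
  have "hol (\<lambda>w. \<Sum>k\<in>UNIV. W $ i $ k * dd \<mu> (vjoin w w0) (vjoin 0 (\<eta> j)) $ k) (snd e ` fst e)"
    "hol (\<lambda>w. \<Sum>k\<in>UNIV. W $ i $ k * dd \<mu> (vjoin w0 w) (vjoin (\<eta> j) 0) $ k) (snd e ` fst e)"
    by (intro hol_sum hol_mult hol_const d)+
  then show "hol (\<lambda>w. l w $ i $ j) (snd e ` fst e)" "hol (\<lambda>w. r w $ i $ j) (snd e ` fst e)"
    by (simp_all add: l_def r_def matrix_vector_mult_def)
qed

text \<open>Left translation by 1 is the identity map.\<close>

lemma l_w0: "l w0 = mat 1"
proof -
  have S: "open {w'. vjoin w0 w' \<in> \<Psi>}" by (rule open_vjoin_slices[OF \<Psi>_open])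
  have "((\<lambda>w'. \<mu> (vjoin w0 w')) has_derivative (\<lambda>b. dd \<mu> (vjoin w0 w0) (vjoin 0 b))) (at w0)"
    by (rule has_derivative_slice(2)[OF holo_on_has_derivative[OF \<mu>_holo \<Psi>_w0(1)[OF w0(1)]]])
  moreover have "((\<lambda>w'. \<mu> (vjoin w0 w')) has_derivative (\<lambda>b. b)) (at w0)"
    by (rule has_derivative_transform_within_open[OF has_derivative_ident G.coords_open[OF e(1)] w0(1)])
      (simp add: \<mu>_w0 del: image_iff)
  ultimately have "(\<lambda>b. dd \<mu> (vjoin w0 w0) (vjoin 0 b)) = (\<lambda>b. b)" by (rule has_derivative_unique)
  then have d: "dd \<mu> (vjoin w0 w0) (vjoin 0 b) = b" for b by (rule fun_cong)
  have "N *v axis j 1 = \<eta> j" for j by (simp add: vec_eq_iff matrix_vector_mult_axis N_def)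
  then have "W *v \<eta> j = axis j 1" for j using W(1)[of "axis j 1"] by simp
  then show ?thesis by (simp add: l_def d vec_eq_iff mat_def axis_def)
qed

lemma \<Omega>'_open: "c \<in> atlas X \<Longrightarrow> open (\<Omega>' c)"
  and hol_H: "c \<in> atlas X \<Longrightarrow> hol (H c) (\<Omega>' c)"
proof -
  assume c: "c \<in> atlas X"
  have l: "hol (\<lambda>u. det (l (vfst u))) (\<Omega> c c)" and r: "hol (\<lambda>u. det (r (vfst u))) (\<Omega> c c)"
    by (intro hol_vfst[OF hol_det[OF hol_l]] hol_vfst[OF hol_det[OF hol_r]], simp add: coord_dom_def)+
  have "open (\<Omega> c c \<inter> (\<lambda>u. det (l (vfst u))) -` (- {0}))"
    by (rule continuous_open_preimage[OF hol_continuous_on[OF l] \<Omega>_open[OF c c] open_Compl[OF closed_singleton]])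
  moreover have "\<Omega> c c \<inter> (\<lambda>u. det (l (vfst u))) -` (- {0}) = \<Omega>' c" by (auto simp: \<Omega>'_def)
  ultimately show "open (\<Omega>' c)" by simp
  have sub: "\<Omega>' c \<subseteq> \<Omega> c c" by (auto simp: \<Omega>'_def)
  have "hol (\<lambda>u. F c c u $ i) (\<Omega> c c)" for i using F_holo[OF c c] unfolding holo_on_iff_hol by blast
  note hol_vec_dd[OF this \<Omega>_open[OF c c]]
  then have "hol (\<lambda>u. Q c u $ i $ j) (\<Omega> c c)" for i j by (simp add: Q_def)
  note Q = hol_det[OF this]
  show "hol (H c) (\<Omega>' c)"
    unfolding H_def[abs_def]
    by (rule hol_subset[OF hol_divide[OF hol_mult[OF hol_subset[OF Q sub] hol_subset[OF r sub]] hol_subset[OF l sub]] order_refl])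
      (simp add: \<Omega>'_def)
qed

lemma \<Omega>'_w0: "c \<in> atlas X \<Longrightarrow> p \<in> fst c \<Longrightarrow> vjoin w0 (snd c p) \<in> \<Omega>' c"
  by (simp add: \<Omega>'_def \<Omega>_w0 l_w0)

text \<open>\<open>det_translation\<close> differentiated in the group variable at 1. On the left
  the chain rule produces the derivative along the frame; on the right only \<open>H\<close> depends
  on the group variable, so det S survives as a factor.\<close>

lemma dd_det_along_frame:
  assumes c: "c \<in> atlas X" and p: "p \<in> fst c"
  shows "dd (\<lambda>z. det (frame_matrix c z)) (snd c p) (frame_matrix c (snd c p) *v a) =
    dd (H c) (vjoin w0 (snd c p)) (vjoin (N *v a) 0) * det (frame_matrix c (snd c p))"
proof -
  let ?\<sigma> = "\<lambda>z. det (frame_matrix c z)" and ?x = "snd c p"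
  note F0 = \<Omega>_w0[OF c p p]
  have S: "open {w. vjoin w ?x \<in> \<Omega>' c}" by (rule open_vjoin_slices[OF \<Omega>'_open[OF c]])
  have w0S: "w0 \<in> {w. vjoin w ?x \<in> \<Omega>' c}" using \<Omega>'_w0[OF c p] by simp
  have d\<sigma>: "(?\<sigma> has_derivative dd ?\<sigma> (F c c (vjoin w0 ?x))) (at (F c c (vjoin w0 ?x)))"
    unfolding F_w0[OF c p]
    by (rule hol_has_derivative[OF hol_det[OF frame_matrix_hol[OF c]]]) (use p in blast)
  have "((\<lambda>w. ?\<sigma> (F c c (vjoin w ?x))) has_derivative
      (\<lambda>b. dd ?\<sigma> (F c c (vjoin w0 ?x)) (dd (F c c) (vjoin w0 ?x) (vjoin b 0)))) (at w0)"
    by (rule has_derivative_compose[OF has_derivative_slice(1)[OF holo_on_has_derivative[OF F_holo[OF c c] F0]] d\<sigma>])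
  then have d1: "((\<lambda>w. H c (vjoin w ?x) * ?\<sigma> ?x) has_derivative
      (\<lambda>b. dd ?\<sigma> ?x (dd (F c c) (vjoin w0 ?x) (vjoin b 0)))) (at w0)"
    unfolding F_w0[OF c p]
    by (rule has_derivative_transform_within_open[OF _ S w0S]) (simp add: det_translation[OF c p])
  have d2: "((\<lambda>w. H c (vjoin w ?x) * ?\<sigma> ?x) has_derivative (\<lambda>b. dd (H c) (vjoin w0 ?x) (vjoin b 0) * ?\<sigma> ?x)) (at w0)"
    by (rule has_derivative_mult_left[OF has_derivative_slice(1)[OF hol_has_derivative[OF hol_H[OF c] \<Omega>'_w0[OF c p]]]])
  have "frame_matrix c ?x *v a = dd (F c c) (vjoin w0 ?x) (vjoin (N *v a) 0)"
    unfolding frame_matrix_eq_P[OF c p] by (rule P_mult[OF c F0])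
  then show ?thesis using fun_cong[OF has_derivative_unique[OF d1 d2], of "N *v a"] by simp
qed

text \<open>The factor of det S in \<open>dd_det_along_frame\<close> is a linear form in
  \<open>a\<close> with coefficients continuous on the whole chart, divisor included; compactness
  bounds them.\<close>

lemma frame_log_bound:
  assumes c: "c \<in> atlas X" and z0: "z0 \<in> snd c ` fst c"
  shows "\<exists>\<rho>>0. \<exists>B. \<forall>z\<in>cball z0 \<rho>. \<forall>a.
    cmod (dd (\<lambda>z. det (frame_matrix c z)) z (frame_matrix c z *v a)) \<le> B * norm a * cmod (det (frame_matrix c z))"
proof -
  obtain \<rho> where \<rho>: "\<rho> > 0" "cball z0 \<rho> \<subseteq> snd c ` fst c"
    using coords_open[OF c] z0 open_contains_cball by blast
  have in\<Omega>: "vjoin w0 z \<in> \<Omega>' c" if "z \<in> cball z0 \<rho>" for z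
  proof -
    have "z \<in> snd c ` fst c" using that \<rho>(2) by blast
    then obtain p where "p \<in> fst c" "z = snd c p" by (rule coords_obtain)
    then show ?thesis using \<Omega>'_w0[OF c] by simp
  qed
  \<comment> \<open>The linear form is put into a matrix with equal rows in order to reuse
    \<open>matrix_bounded_on_compact\<close>; the index \<open>undefined\<close> below picks any
    row.\<close>
  let ?D = "\<lambda>z. (\<chi> i j. dd (H c) (vjoin w0 z) (vjoin (\<eta> j) 0)) :: complex^'n^'n"
  have "continuous_on (cball z0 \<rho>) (\<lambda>z. ?D z $ i $ j)" for i j
    by simp (rule continuous_on_compose2[OF hol_dd_continuous_on[OF hol_H[OF c] \<Omega>'_open[OF c]]
          continuous_vjoin[OF continuous_on_const continuous_on_id]], use in\<Omega> in blast)
  from matrix_bounded_on_compact[OF compact_cball this]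
  obtain B where B: "\<And>z a. z \<in> cball z0 \<rho> \<Longrightarrow> norm (?D z *v a) \<le> B * norm a" by metis
  have "cmod (dd (\<lambda>z. det (frame_matrix c z)) z (frame_matrix c z *v a)) \<le> B * norm a * cmod (det (frame_matrix c z))"
    if z: "z \<in> cball z0 \<rho>" for z a
  proof -
    have "z \<in> snd c ` fst c" using z \<rho>(2) by blast
    then obtain p where p: "p \<in> fst c" "z = snd c p" by (rule coords_obtain)
    have "dd (H c) (vjoin w0 z) (vjoin (N *v a) 0) = (?D z *v a) $ undefined"
      unfolding N_mult vjoin_sum hol_dd_sum[OF hol_H[OF c] in\<Omega>[OF z]]
      by (simp add: matrix_vector_mult_def mult.commute)
    then have "cmod (dd (H c) (vjoin w0 z) (vjoin (N *v a) 0)) \<le> B * norm a"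
      using B[OF z, of a] Finite_Cartesian_Product.norm_nth_le[of "?D z *v a" undefined] by simp
    then show ?thesis
      using dd_det_along_frame[OF c p(1), of a] unfolding p(2)[symmetric] by (simp add: norm_mult mult_right_mono)
  qed
  then show ?thesis using \<rho>(1) by blast
qed

section \<open>The abelian case: invariance and commutation of the fields\<close>

lemma G_derivative:
  assumes f: "f \<in> points G" and c: "c \<in> atlas X" "d \<in> atlas X" and p: "p \<in> fst c" "f p \<in> fst d"
  shows "((snd d \<circ> f \<circ> chart_inv c) has_derivative dd (snd d \<circ> f \<circ> chart_inv c) (snd c p)) (at (snd c p))"
    and "dd (snd d \<circ> f \<circ> chart_inv c) (snd c p) (a *s b) = a *s dd (snd d \<circ> f \<circ> chart_inv c) (snd c p) b"
proof -
  have h: "holo_on (snd d \<circ> f \<circ> chart_inv c) (snd c ` {p \<in> fst c. f p \<in> fst d})"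
    using G_holo[OF f] c unfolding holo_map_def by blast
  have x: "snd c p \<in> snd c ` {p \<in> fst c. f p \<in> fst d}" using p by blast
  show "((snd d \<circ> f \<circ> chart_inv c) has_derivative dd (snd d \<circ> f \<circ> chart_inv c) (snd c p)) (at (snd c p))"
    by (rule holo_on_has_derivative[OF h x])
  show "dd (snd d \<circ> f \<circ> chart_inv c) (snd c p) (a *s b) = a *s dd (snd d \<circ> f \<circ> chart_inv c) (snd c p) b"
    by (rule holo_on_dd_scale[OF h x])
qed

text \<open>In an abelian group the orbit map of \<open>f p\<close> is \<open>f\<close> after the
  orbit map of \<open>p\<close>; both are differentiated at 1.\<close>

lemma frame_equivariant:
  assumes comm: "comm_group (grp_of X G)" and f: "f \<in> points G"
    and c: "c \<in> atlas X" "d \<in> atlas X" and p: "p \<in> fst c" "f p \<in> fst d"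
  shows "s j (f p) d = dd (snd d \<circ> f \<circ> chart_inv c) (snd c p) (s j p c)"
proof -
  have pX: "p \<in> points X" using chart_sub[OF c(1)] p(1) by blast
  have swap: "h (f q) = f (h q)" if "h \<in> points G" "q \<in> points X" for h q
  proof -
    have "mulG (h, f) = mulG (f, h)"
    proof -
      have "comm_monoid (grp_of X G)" using comm unfolding comm_group_def by blast
      from comm_monoid.m_comm[OF this, of h f] show ?thesis using that(1) f by (simp add: mulG_def)
    qed
    then show ?thesis using mulG_at[OF that(1) f that(2)] mulG_at[OF f that] by simp
  qed
  let ?S = "{w. vjoin w (snd c p) \<in> \<Omega> c c}" and ?f = "snd d \<circ> f \<circ> chart_inv c"
  have S: "open ?S" by (rule open_vjoin_slices[OF \<Omega>_open[OF c(1,1)]])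
  have w0S: "w0 \<in> ?S" using \<Omega>_w0[OF c(1) p(1,1)] by simp
  have "((\<lambda>w. ?f (F c c (vjoin w (snd c p)))) has_derivative
      (\<lambda>b. dd ?f (snd c p) (dd (F c c) (vjoin w0 (snd c p)) (vjoin b 0)))) (at w0)"
    using has_derivative_compose[OF has_derivative_slice(1)[OF holo_on_has_derivative[OF F_holo[OF c(1,1)] \<Omega>_w0[OF c(1) p(1,1)]]],
        of ?f] G_derivative(1)[OF f c p] by (simp add: F_w0[OF c(1) p(1)])
  then have "((snd d \<circ> (\<lambda>h. h (f p)) \<circ> chart_inv e) has_derivative
      (\<lambda>b. dd ?f (snd c p) (dd (F c c) (vjoin w0 (snd c p)) (vjoin b 0)))) (at w0)"
  proof (rule has_derivative_transform_within_open[OF _ S w0S])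
    fix w assume "w \<in> ?S"
    then have w: "w \<in> snd e ` fst e" "chart_inv e w p \<in> fst c" by (simp_all add: \<Omega>_iff[OF c(1) p(1)])
    have "chart_inv e w (f p) = f (chart_inv e w p)" by (rule swap[OF e_points[OF w(1)] pX])
    then show "?f (F c c (vjoin w (snd c p))) = (snd d \<circ> (\<lambda>h. h (f p)) \<circ> chart_inv e) w"
      by (simp add: F_at[OF c(1) p(1)] chart_inv_left[OF c(1) w(2)])
  qed
  from has_derivative_unique[OF orbit_derivative[OF c(2,2) p(2,2)] this]
  show ?thesis
    unfolding s_at[OF c(2,2) p(2,2)] s_at[OF c(1,1) p(1,1)] by (rule fun_cong)
qed

text \<open>The invariance of the \<open>k\<close>-th field under the group is differentiated at 1
  along the \<open>m\<close>-th generator. One side becomes the derivative of the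
  \<open>k\<close>-th field along the \<open>m\<close>-th, the other a mixed second derivative of
  the action. Exchanging its two directions turns it into the derivative of the \<open>m\<close>-th
  field along the \<open>k\<close>-th.\<close>

lemma frame_commutes:
  assumes comm: "comm_group (grp_of X G)" and c: "c \<in> atlas X" and z: "z \<in> snd c ` fst c"
  shows "dd (\<lambda>y. frame_matrix c y $ i $ k) z (\<chi> i. frame_matrix c z $ i $ m) =
    dd (\<lambda>y. frame_matrix c y $ i $ m) z (\<chi> i. frame_matrix c z $ i $ k)"
proof -
  obtain p where p: "p \<in> fst c" "z = snd c p" using z by (rule coords_obtain)
  let ?F = "\<lambda>u. F c c u $ i"
  have hF: "hol (\<lambda>u. F c c u $ i) (\<Omega> c c)" for i using F_holo[OF c c] unfolding holo_on_iff_hol by blast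
  note \<Omega>o = \<Omega>_open[OF c c]
  note z\<Omega> = \<Omega>_w0[OF c p(1) p(1), folded p(2)]
  have col: "(\<chi> i. frame_matrix c y $ i $ k) = dd (F c c) (vjoin w0 y) (vjoin (\<eta> k) 0)"
    and ent: "frame_matrix c y $ i $ k = dd ?F (vjoin w0 y) (vjoin (\<eta> k) 0)"
    if y: "y \<in> snd c ` fst c" for y k
  proof -
    obtain q where q: "q \<in> fst c" "y = snd c q" using y by (rule coords_obtain)
    show "(\<chi> i. frame_matrix c y $ i $ k) = dd (F c c) (vjoin w0 y) (vjoin (\<eta> k) 0)"
      unfolding q(2) frame_matrix_eq_P[OF c q(1)] by (simp add: P_def)
    then have "frame_matrix c y $ i $ k = dd (F c c) (vjoin w0 y) (vjoin (\<eta> k) 0) $ i" by (metis vec_lambda_beta)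
    then show "frame_matrix c y $ i $ k = dd ?F (vjoin w0 y) (vjoin (\<eta> k) 0)"
      unfolding q(2) dd_vec_nth[OF holo_on_differentiable[OF F_holo[OF c c] \<Omega>_w0[OF c q(1) q(1)]]] .
  qed
  define b where "b = (\<chi> i. frame_matrix c z $ i $ k)"
  define t where "t = (\<chi> i. frame_matrix c z $ i $ m)"
  have hd: "hol (\<lambda>u. dd ?F u a) (\<Omega> c c)" for a by (rule hol_dd[OF hF \<Omega>o])
  text \<open>Along the orbit of the \<open>m\<close>-th field, the \<open>k\<close>-th field is transported by the translations.\<close>
  let ?S = "{w. vjoin w z \<in> \<Omega> c c}"
  have S: "open ?S" by (rule open_vjoin_slices[OF \<Omega>o])
  have w0S: "w0 \<in> ?S" using z\<Omega> by simp
  have "((\<lambda>w. dd ?F (vjoin w z) (vjoin 0 b)) has_derivative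
      (\<lambda>x. dd (\<lambda>u. dd ?F u (vjoin 0 b)) (vjoin w0 z) (vjoin x 0))) (at w0)"
    by (rule has_derivative_slice(1)[OF hol_has_derivative[OF hd z\<Omega>]])
  then have d1: "((\<lambda>w. frame_matrix c (F c c (vjoin w z)) $ i $ k) has_derivative
      (\<lambda>x. dd (\<lambda>u. dd ?F u (vjoin 0 b)) (vjoin w0 z) (vjoin x 0))) (at w0)"
  proof (rule has_derivative_transform_within_open[OF _ S w0S])
    fix w assume "w \<in> ?S"
    then have wz: "vjoin w z \<in> \<Omega> c c" by simp
    then have w: "w \<in> snd e ` fst e" "chart_inv e w p \<in> fst c" unfolding p(2) by (simp_all add: \<Omega>_iff[OF c p(1)])
    define h where "h = chart_inv e w"
    have h: "h \<in> points G" "h p \<in> fst c" using e_points[OF w(1)] w(2) by (simp_all add: h_def)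
    have "F c c (vjoin w z) = snd c (h p)" unfolding p(2) F_at[OF c p(1)] h_def ..
    then have "frame_matrix c (F c c (vjoin w z)) $ i $ k = s k (h p) c $ i"
      by (simp add: frame_matrix_at[OF c h(2)])
    also have "\<dots> = dd (snd c \<circ> h \<circ> chart_inv c) z (s k p c) $ i"
      unfolding p(2) frame_equivariant[OF comm h(1) c c p(1) h(2)] ..
    also have "s k p c = b" unfolding b_def p(2) frame_matrix_at[OF c p(1)] by (simp add: vec_eq_iff)
    also have "dd (snd c \<circ> h \<circ> chart_inv c) z = (\<lambda>b. dd (F c c) (vjoin w z) (vjoin 0 b))"
    proof -
      have "((\<lambda>y. F c c (vjoin w y)) has_derivative (\<lambda>b. dd (F c c) (vjoin w z) (vjoin 0 b))) (at z)"
        by (rule has_derivative_slice(2)[OF holo_on_has_derivative[OF F_holo[OF c c] wz]])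
      then have "((snd c \<circ> h \<circ> chart_inv c) has_derivative (\<lambda>b. dd (F c c) (vjoin w z) (vjoin 0 b))) (at z)"
        by (rule has_derivative_transform_within_open[OF _ coords_open[OF c] z])
          (simp add: coord_map_def act_def h_def)
      then show ?thesis by (rule dd_eq)
    qed
    also have "dd (F c c) (vjoin w z) (vjoin 0 b) $ i = dd ?F (vjoin w z) (vjoin 0 b)"
      by (rule dd_vec_nth[OF holo_on_differentiable[OF F_holo[OF c c] wz], symmetric])
    finally show "dd ?F (vjoin w z) (vjoin 0 b) = frame_matrix c (F c c (vjoin w z)) $ i $ k" by simp
  qed
  have dA: "((\<lambda>y. frame_matrix c y $ i $ k) has_derivative dd (\<lambda>y. frame_matrix c y $ i $ k) z) (at z)" for k
    by (rule hol_has_derivative[OF frame_matrix_hol[OF c] z])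
  have "((\<lambda>w. frame_matrix c (F c c (vjoin w z)) $ i $ k) has_derivative
      (\<lambda>x. dd (\<lambda>y. frame_matrix c y $ i $ k) z (dd (F c c) (vjoin w0 z) (vjoin x 0)))) (at w0)"
    using has_derivative_compose[OF has_derivative_slice(1)[OF holo_on_has_derivative[OF F_holo[OF c c] z\<Omega>]],
        of "\<lambda>y. frame_matrix c y $ i $ k"] dA[of k] by (simp add: F_w0[OF c p(1)] p(2))
  from fun_cong[OF has_derivative_unique[OF this d1], of "\<eta> m"]
  have "dd (\<lambda>y. frame_matrix c y $ i $ k) z t = dd (\<lambda>u. dd ?F u (vjoin 0 b)) (vjoin w0 z) (vjoin (\<eta> m) 0)"
    unfolding t_def col[OF z] .
  also have "\<dots> = dd (\<lambda>u. dd ?F u (vjoin (\<eta> m) 0)) (vjoin w0 z) (vjoin 0 b)"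
    by (rule hol_dd_commute[OF hF \<Omega>o z\<Omega>])
  also have "\<dots> = dd (\<lambda>y. frame_matrix c y $ i $ m) z b"
  proof -
    have "((\<lambda>y. dd ?F (vjoin w0 y) (vjoin (\<eta> m) 0)) has_derivative
        (\<lambda>b. dd (\<lambda>u. dd ?F u (vjoin (\<eta> m) 0)) (vjoin w0 z) (vjoin 0 b))) (at z)"
      by (rule has_derivative_slice(2)[OF hol_has_derivative[OF hd z\<Omega>]])
    then have "((\<lambda>y. frame_matrix c y $ i $ m) has_derivative
        (\<lambda>b. dd (\<lambda>u. dd ?F u (vjoin (\<eta> m) 0)) (vjoin w0 z) (vjoin 0 b))) (at z)"
      by (rule has_derivative_transform_within_open[OF _ coords_open[OF c] z]) (simp add: ent del: image_iff)
    then show ?thesis by (simp add: dd_eq)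
  qed
  finally show ?thesis unfolding b_def t_def .
qed

lemma frame_metric_invariant:
  assumes comm: "comm_group (grp_of X G)"
  shows "invariant_metric (points G) M frame_metric"
proof (rule invariant_frame_metric)
  fix f c d p assume "f \<in> points G" "c \<in> atlas X" "d \<in> atlas X" "p \<in> fst c" "f p \<in> fst d"
  note a = this
  show "linear (dd (snd d \<circ> f \<circ> chart_inv c) (snd c p))"
    using has_derivative_linear[OF G_derivative(1)[OF a]] .
  show "dd (snd d \<circ> f \<circ> chart_inv c) (snd c p) (k *s b) = k *s dd (snd d \<circ> f \<circ> chart_inv c) (snd c p) b" for k b
    by (rule G_derivative(2)[OF a])
  show "s j (f p) d = dd (snd d \<circ> f \<circ> chart_inv c) (snd c p) (s j p c)" for j
    by (rule frame_equivariant[OF comm a])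
next
  fix f assume f: "f \<in> points G"
  interpret BG: group "BijGroup (points X)" by (rule group_BijGroup)
  let ?g = "inv\<^bsub>BijGroup (points X)\<^esub> f"
  have g: "?g \<in> points G" by (rule subgroup.m_inv_closed[OF G_subgroup f])
  have "?g \<otimes>\<^bsub>BijGroup (points X)\<^esub> f = \<one>\<^bsub>BijGroup (points X)\<^esub>"
    by (rule BG.l_inv[OF subgroup.mem_carrier[OF G_subgroup f]])
  also have "\<dots> = one" by (simp add: BijGroup_def one_def)
  finally have "?g \<otimes>\<^bsub>BijGroup (points X)\<^esub> f = one" .
  then have "mulG (?g, f) = one" by (simp add: mulG_def)
  then have "?g (f p) = p" if "p \<in> points X" for p
    using mulG_at[OF g f that] one_at[OF that] by simp
  then show "\<exists>g\<in>points G. \<forall>p\<in>points X. g (f p) = p" using g by blast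
qed (rule G_maps)

end

theorem corollary3p8:
  fixes X :: "('a, 'n::finite) mfd"
    and G :: "('a \<Rightarrow> 'a, 'm::finite) mfd"
    and s :: "'n \<Rightarrow> 'a \<Rightarrow> ('a, 'n) tvec"
    and D :: "'a set"
  assumes X: "complex_manifold X" "compact_space (mtop X)"
    and G: "lie_subgroup_Aut0 X G" "divisorial X G"
    and s: "field_basis s (lie_algebra X G)"
    and D: "D = zero_divisor_support X (wedge_section s)"
  shows "(\<exists>g. hermitian_metric (open_submfd X (points X - D)) g \<and>
              complete_metric (open_submfd X (points X - D)) g \<and>
              ricci_flat (open_submfd X (points X - D)) g) \<and>
         (comm_group (grp_of X G) \<longrightarrow>
          (\<exists>g. hermitian_metric (open_submfd X (points X - D)) g \<and>
               complete_metric (open_submfd X (points X - D)) g \<and>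
               ricci_flat (open_submfd X (points X - D)) g \<and>
               kaehler (open_submfd X (points X - D)) g \<and>
               invariant_metric (points G) (open_submfd X (points X - D)) g))"
proof -
  note cpt = X(2) and D' = D
  interpret lie_action X G s
    using X(1) G(1) s G(2) by unfold_locales (simp_all add: divisorial_def)
  have M: "open_submfd X (points X - D) = M" by (simp add: D' Y_def)
  have complete: "complete_metric M frame_metric"
    by (rule complete_frame_metric[OF cpt frame_log_bound])
  have "kaehler M frame_metric" if "comm_group (grp_of X G)"
    by (rule kaehler_frame_metric[OF frame_commutes[OF that]])
  then show ?thesis
    unfolding M using hermitian_frame_metric complete ricci_flat_frame_metric frame_metric_invariant by blast
qed

end
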